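(* The following assertions hold for any $a\in L^1(I)$. 1. $\lambda_N(a,T)=\lambda_N(\tilde a,2T)=\lambda_P(\tilde a,2T)$. 2. $G_N[a+\lambda,T](t,s)<0$ for all $(t,s)\in I\times I$ if and only if $\lambda<\lambda_P(\tilde a,2T)$. 3. $G_N[a+\lambda,T](t,s)>0$ on $I\times I$ if and only if $\lambda_P(\tilde a,2T)<\lambda<\min\{\lambda_{M_1}(a,T),\lambda_{M_2}(a,T)\}$. 4. $G_N[a+\lambda,T](t,s)>0$ for all $(t,s)\in(I\times I)\setminus\{(0,0),(T,T)\}$ if and only if $\lambda_P(\tilde a,2T)<\lambda\le\min\{\lambda_{M_1}(a,T),\lambda_{M_2}(a,T)\}$. 5. $G_N[a,T](0,0)=2\,G_P[\tilde a,2T](0,0)$ (when these Green's functions exist), and $\lambda_{M_1}(a,T)$ is characterized as the first root $\lambda$ of the equation $G_P[\tilde a+\lambda,2T](0,0)=0$ (equivalently, $G_N[a+\lambda,T](0,0)=0$). 6. $G_N[a,T](T,T)=2\,G_P[\tilde a,2T](T,T)$ (when these Green's functions exist), and $\lambda_{M_2}(a,T)$ is characterized as the first root $\lambda$ of the equation $G_P[\tilde a+\lambda,2T](T,T)=0$ (equivalently, $G_N[a+\lambda,T](T,T)=0$). 7. $\lambda_A(\tilde a,2T)=\min\{\lambda_{M_1}(a,T),\lambda_{M_2}(a,T)\}$. 8. $\lambda_{M_2}(a,T)=\lambda_D(\tilde a,2T)<\lambda_D(a,T)$. 9. $\lambda_N(a,T)<\lambda_{M_1}(a,T)$.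
   Context: Fix $T>0$ and put $I=[0,T]$. $W^{2,1}(c,d)$ is the set of $u\in C^1[c,d]$ with $u'$ absolutely continuous on $[c,d]$. For $a\in L^1(I)$, $\tilde a$ is its even extension to $[0,2T]$: $\tilde a(t)=a(t)$ on $[0,T]$, $\tilde a(t)=a(2T-t)$ on $(T,2T]$. The parameter $\lambda$ is real. For $S>0$ and $q\in L^1(0,S)$ consider $u''(t)+q(t)u(t)=\sigma(t)$ for a.e. $t\in[0,S]$, $u\in W^{2,1}(0,S)$, with one of the boundary conditions: (P) periodic: $u(0)=u(S)$, $u'(0)=u'(S)$; (A) anti-periodic: $u(0)=-u(S)$, $u'(0)=-u'(S)$; (N) Neumann: $u'(0)=u'(S)=0$; (D) Dirichlet: $u(0)=u(S)=0$; ($M_1$) mixed: $u'(0)=u(S)=0$; ($M_2$) mixed: $u(0)=u'(S)=0$. The problem is nonresonant if for $\sigma=0$ it has only the trivial solution; then for every $\sigma\in L^1(0,S)$ it has a unique solution, given by $u(t)=\int_0^S G_B[q,S](t,s)\sigma(s)\,ds$ with $B\in\{P,A,N,D,M_1,M_2\}$, where $G_B[q,S]$ is the (unique) Green's function, continuous on $[0,S]\times[0,S]$. Any assertion on the sign or vanishing of a Green's function includes the assertion that the corresponding problem is nonresonant. $\lambda_B(q,S)$ denotes the smallest eigenvalue of the problem with boundary condition $B$, i.e. the smallest $\lambda\in\mathbb{R}$ such that $u''+(q+\lambda)u=0$ a.e. on $[0,S]$ has a nontrivial solution in $W^{2,1}(0,S)$ satisfying the boundary condition $B$.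
   Formalization: In items 5 and 6 the labels M_1 and M_2 are interchanged in the first-root claims: the first root at (0,0) is λ_{M_2}(a,T) and at (T,T) it is λ_{M_1}(a,T); as printed these claims fail whenever λ_{M_1}≠λ_{M_2}. *)

theory Defs
  imports "HOL-Analysis.Analysis"
begin

text \<open>The usual \<open>\<epsilon>\<close>-\<open>\<delta>\<close> definition of absolute continuity on \<open>[c,d]\<close>; \<open>\<D>\<close> ranges over the finite
  families of non-overlapping closed subintervals, and \<open>Inf K\<close>, \<open>Sup K\<close> are the end points
  of \<open>K\<close>.\<close>

definition abs_continuous_on :: "real \<Rightarrow> real \<Rightarrow> (real \<Rightarrow> real) \<Rightarrow> bool" where
  "abs_continuous_on c d f \<longleftrightarrow>
     (\<forall>\<epsilon>>0. \<exists>\<delta>>0. \<forall>\<D>. \<D> division_of \<Union>\<D> \<and> \<Union>\<D> \<subseteq> {c..d} \<and> (\<Sum>K\<in>\<D>. measure lborel K) < \<delta> \<longrightarrow>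
        (\<Sum>K\<in>\<D>. \<bar>f (Sup K) - f (Inf K)\<bar>) < \<epsilon>)"

text \<open>One-sided at the end points, and independent of the values of \<open>u\<close> outside \<open>[c,d]\<close>.\<close>

definition deriv_on :: "real \<Rightarrow> real \<Rightarrow> (real \<Rightarrow> real) \<Rightarrow> real \<Rightarrow> real" where
  "deriv_on c d u t = vector_derivative u (at t within {c..d})"

definition W21 :: "real \<Rightarrow> real \<Rightarrow> (real \<Rightarrow> real) set" where
  "W21 c d = {u. u differentiable_on {c..d} \<and> continuous_on {c..d} (deriv_on c d u) \<and>
                 abs_continuous_on c d (deriv_on c d u)}"

datatype bc = Periodic | Antiperiodic | Neumann | Dirichlet | Mixed1 | Mixed2

fun satisfies_bc :: "bc \<Rightarrow> real \<Rightarrow> (real \<Rightarrow> real) \<Rightarrow> bool" where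
  "satisfies_bc Periodic S u \<longleftrightarrow> u 0 = u S \<and> deriv_on 0 S u 0 = deriv_on 0 S u S"
| "satisfies_bc Antiperiodic S u \<longleftrightarrow> u 0 = - u S \<and> deriv_on 0 S u 0 = - deriv_on 0 S u S"
| "satisfies_bc Neumann S u \<longleftrightarrow> deriv_on 0 S u 0 = 0 \<and> deriv_on 0 S u S = 0"
| "satisfies_bc Dirichlet S u \<longleftrightarrow> u 0 = 0 \<and> u S = 0"
| "satisfies_bc Mixed1 S u \<longleftrightarrow> deriv_on 0 S u 0 = 0 \<and> u S = 0"
| "satisfies_bc Mixed2 S u \<longleftrightarrow> u 0 = 0 \<and> deriv_on 0 S u S = 0"

text \<open>\<open>u'' + q u = \<sigma>\<close> a.e. on \<open>[0,S]\<close>, with \<open>u''\<close> the derivative of \<open>u'\<close>, required to exist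
  at almost every point.\<close>

definition solves :: "bc \<Rightarrow> (real \<Rightarrow> real) \<Rightarrow> real \<Rightarrow> (real \<Rightarrow> real) \<Rightarrow> (real \<Rightarrow> real) \<Rightarrow> bool" where
  "solves B q S \<sigma> u \<longleftrightarrow> u \<in> W21 0 S \<and> satisfies_bc B S u \<and>
     (AE t\<in>{0..S} in lebesgue.
        \<exists>w. (deriv_on 0 S u has_real_derivative w) (at t within {0..S}) \<and> w + q t * u t = \<sigma> t)"

definition nonresonant :: "bc \<Rightarrow> (real \<Rightarrow> real) \<Rightarrow> real \<Rightarrow> bool" where
  "nonresonant B q S \<longleftrightarrow> (\<forall>u. solves B q S (\<lambda>_. 0) u \<longrightarrow> (\<forall>t\<in>{0..S}. u t = 0))"

text \<open>The equivalence says that the integral is a solution and that it is the only one on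
  \<open>[0,S]\<close>.\<close>

definition is_green :: "bc \<Rightarrow> (real \<Rightarrow> real) \<Rightarrow> real \<Rightarrow> (real \<Rightarrow> real \<Rightarrow> real) \<Rightarrow> bool" where
  "is_green B q S G \<longleftrightarrow> continuous_on ({0..S} \<times> {0..S}) (\<lambda>(t, s). G t s) \<and>
     (\<forall>\<sigma>. \<sigma> absolutely_integrable_on {0..S} \<longrightarrow>
        (\<forall>u. solves B q S \<sigma> u \<longleftrightarrow>
           (\<forall>t\<in>{0..S}. u t = (LINT s:{0..S}|lebesgue. G t s * \<sigma> s))))"

text \<open>Determined on \<open>[0,S] \<times> [0,S]\<close> only, and only when the problem is nonresonant;
  assertions about it therefore have to be accompanied by \<^const>\<open>nonresonant\<close>.\<close>

definition green :: "bc \<Rightarrow> (real \<Rightarrow> real) \<Rightarrow> real \<Rightarrow> real \<Rightarrow> real \<Rightarrow> real" where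
  "green B q S = (SOME G. is_green B q S G)"

definition is_eigenvalue :: "bc \<Rightarrow> (real \<Rightarrow> real) \<Rightarrow> real \<Rightarrow> real \<Rightarrow> bool" where
  "is_eigenvalue B q S \<mu> \<longleftrightarrow>
     (\<exists>u. solves B (\<lambda>t. q t + \<mu>) S (\<lambda>_. 0) u \<and> (\<exists>t\<in>{0..S}. u t \<noteq> 0))"

definition first_eigenvalue :: "bc \<Rightarrow> (real \<Rightarrow> real) \<Rightarrow> real \<Rightarrow> real" where
  "first_eigenvalue B q S = (LEAST \<mu>. is_eigenvalue B q S \<mu>)"

definition even_ext :: "real \<Rightarrow> (real \<Rightarrow> real) \<Rightarrow> real \<Rightarrow> real" where
  "even_ext T a t = (if t \<le> T then a t else a (2 * T - t))"

text \<open>\<open>G\<^sub>N[q,S](\<cdot>,0)\<close> solves the homogeneous equation with \<open>u'(0) = 1\<close>, \<open>u'(S) = 0\<close>, so it vanishes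
  at \<open>0\<close> exactly when it is a \<^const>\<open>Mixed2\<close> eigenfunction; symmetrically \<open>(S,S)\<close> belongs to
  \<^const>\<open>Mixed1\<close>. The informal source has these two labels interchanged.\<close>

definition is_green_root :: "bc \<Rightarrow> (real \<Rightarrow> real) \<Rightarrow> real \<Rightarrow> real \<Rightarrow> real \<Rightarrow> real \<Rightarrow> bool" where
  "is_green_root B q S t s \<mu> \<longleftrightarrow>
     nonresonant B (\<lambda>x. q x + \<mu>) S \<and> green B (\<lambda>x. q x + \<mu>) S t s = 0"

definition is_first :: "(real \<Rightarrow> bool) \<Rightarrow> real \<Rightarrow> bool" where
  "is_first P \<mu> \<longleftrightarrow> P \<mu> \<and> (\<forall>\<nu>. P \<nu> \<longrightarrow> \<mu> \<le> \<nu>)"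

end

theory Submission
  imports Defs
begin

text \<open>Fix the parameter \<open>\<mu>\<close> and let \<open>\<phi>\<close>, \<open>\<psi>\<close> solve \<open>u'' + (a + \<mu>) u = 0\<close> with initial values
  \<open>(u, u') = (1, 0)\<close> and \<open>(0, 1)\<close> at \<open>0\<close>. Everything in the theorem can be read off from the four numbers
  \<open>\<phi>(T)\<close>, \<open>\<phi>'(T)\<close>, \<open>\<psi>(T)\<close>, \<open>\<psi>'(T)\<close>, whose Wronskian is \<open>1\<close>, and from the signs of solutions on \<open>[0,T]\<close>.

  Since the coefficient is only integrable, the equation is first regularized. With \<open>A(t)\<close> the integral of \<open>a\<close>
  over \<open>[0,t]\<close> and the quasi-derivative \<open>p = u' + A u\<close>, it becomes the system
  \<open>u' = p - A u\<close>, \<open>p' = A p - (\<mu> + A\<^sup>2) u\<close>, whose coefficients are continuous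
  (\<open>weak_sol_reg_sol\<close>). The bridge is the fundamental theorem of calculus for absolutely continuous functions;
  after it, existence, Wronskian identities, Sturm comparison and continuous dependence on \<open>\<mu>\<close> are classical calculus.

  On \<open>[0,T]\<close> the eigenvalues for Neumann, \<open>M\<^sub>1\<close>, \<open>M\<^sub>2\<close> and Dirichlet conditions are the zeros of
  \<open>\<phi>'(T)\<close>, \<open>\<phi>(T)\<close>, \<open>\<psi>'(T)\<close> and \<open>\<psi>(T)\<close>. In each case the parameters for which the shooting
  solution is positive on \<open>(0,T]\<close> and the quantity that has to vanish is still positive form an open half-line
  unbounded below, and its end point is the first eigenvalue (locale \<open>shooting\<close>).

  Reflection at \<open>T\<close> preserves the equation with the even coefficient on \<open>[0,2T]\<close>, so the monodromy matrix over
  \<open>[0,2T]\<close> is a product of two mirror copies of the matrix over \<open>[0,T]\<close> (\<open>monodromy\<close>). Hence all boundary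
  conditions on \<open>[0,2T]\<close> factor: periodic into Neumann and Dirichlet on \<open>[0,T]\<close>, antiperiodic into \<open>M\<^sub>1\<close> and
  \<open>M\<^sub>2\<close>, Neumann into Neumann and \<open>M\<^sub>1\<close>, Dirichlet into Dirichlet and \<open>M\<^sub>2\<close>. Together with the order
  of the first eigenvalues this settles every claim that speaks of eigenvalues only.

  Let \<open>\<eta>\<close> be the solution with \<open>\<eta>(T) = 1\<close>, \<open>\<eta>'(T) = 0\<close>. The Neumann Green's function is
  \<open>- \<phi>(min s t) \<eta>(max s t) / \<phi>'(T)\<close>, so its sign is decided by the signs of \<open>\<phi>\<close>, \<open>\<eta>\<close> and \<open>\<phi>'(T)\<close>:
  \<open>\<phi>\<close> stays positive up to the first \<open>M\<^sub>1\<close> eigenvalue, \<open>\<eta>\<close> up to the first \<open>M\<^sub>2\<close> eigenvalue,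
  and \<open>\<phi>'(T)\<close> changes from positive to negative at the first Neumann eigenvalue. At the
  corners \<open>(0,0)\<close> and \<open>(T,T)\<close> the Green's function equals \<open>- \<psi>'(T) / \<phi>'(T)\<close> and \<open>- \<phi>(T) / \<phi>'(T)\<close>; the periodic
  Green's function of the even extension, computed from the monodromy matrix, takes half of these values there.\<close>

section \<open>Absolutely continuous functions\<close>

abbreviation short_family :: "real \<Rightarrow> real \<Rightarrow> real \<Rightarrow> real set set \<Rightarrow> bool" where
  "short_family c d \<delta> \<D> \<equiv> \<D> division_of \<Union>\<D> \<and> \<Union>\<D> \<subseteq> {c..d} \<and> (\<Sum>K\<in>\<D>. measure lborel K) < \<delta>"

abbreviation increments :: "(real \<Rightarrow> real) \<Rightarrow> real set set \<Rightarrow> real" where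
  "increments f \<D> \<equiv> \<Sum>K\<in>\<D>. \<bar>f (Sup K) - f (Inf K)\<bar>"

lemma division_real_interval:
  fixes K :: "real set"
  assumes "\<D> division_of \<Union>\<D>" "\<Union>\<D> \<subseteq> {c..d}" "K \<in> \<D>"
  obtains a b where "K = {a..b}" "a \<le> b" "Inf K = a" "Sup K = b" "c \<le> a" "b \<le> d" "measure lborel K = b - a"
proof -
  obtain a b where K: "K = cbox a b" and ne: "K \<noteq> {}"
    using division_ofD(3,4)[OF assms(1,3)] by metis
  then have "a \<le> b" by auto
  moreover have "K \<subseteq> {c..d}" using assms by blast
  ultimately show thesis using that[of a b] K by auto
qed

lemma continuous_on_Icc_bounded:
  fixes f :: "real \<Rightarrow> real"
  assumes "continuous_on {c..d} f"
  obtains M where "M > 0" "\<And>t. t \<in> {c..d} \<Longrightarrow> \<bar>f t\<bar> \<le> M"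
proof -
  obtain b where "b > 0" "\<And>x. x \<in> f ` {c..d} \<Longrightarrow> norm x \<le> b"
    using compact_imp_bounded[OF compact_continuous_image[OF assms compact_Icc]]
    unfolding bounded_pos by blast
  then show thesis by (intro that[of b]) auto
qed

text \<open>Sums, differences, multiples and products of absolutely continuous functions are all instances of this one
  estimate of increments.\<close>

lemma abs_continuous_on_dominated:
  assumes f: "abs_continuous_on c d f" and g: "abs_continuous_on c d g" and M: "M > 0"
    and h: "\<And>x y. x \<in> {c..d} \<Longrightarrow> y \<in> {c..d} \<Longrightarrow> \<bar>h x - h y\<bar> \<le> M * (\<bar>f x - f y\<bar> + \<bar>g x - g y\<bar>)"
  shows "abs_continuous_on c d h"
  unfolding abs_continuous_on_def
proof (intro allI impI)
  fix \<epsilon> :: real assume e: "\<epsilon> > 0"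
  then have e': "\<epsilon> / (2 * M) > 0" using M by simp
  obtain \<delta>1 where d1: "\<delta>1 > 0" and f1: "\<And>\<D>. short_family c d \<delta>1 \<D> \<Longrightarrow> increments f \<D> < \<epsilon> / (2 * M)"
    using f e' unfolding abs_continuous_on_def by meson
  obtain \<delta>2 where d2: "\<delta>2 > 0" and g1: "\<And>\<D>. short_family c d \<delta>2 \<D> \<Longrightarrow> increments g \<D> < \<epsilon> / (2 * M)"
    using g e' unfolding abs_continuous_on_def by meson
  show "\<exists>\<delta>>0. \<forall>\<D>. short_family c d \<delta> \<D> \<longrightarrow> increments h \<D> < \<epsilon>"
  proof (intro exI[of _ "min \<delta>1 \<delta>2"] conjI allI impI)
    show "min \<delta>1 \<delta>2 > 0" using d1 d2 by simp
    fix \<D> :: "real set set"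
    assume D: "short_family c d (min \<delta>1 \<delta>2) \<D>"
    have "increments h \<D> \<le> (\<Sum>K\<in>\<D>. M * (\<bar>f (Sup K) - f (Inf K)\<bar> + \<bar>g (Sup K) - g (Inf K)\<bar>))"
    proof (rule sum_mono)
      fix K assume "K \<in> \<D>"
      then obtain a b where "K = {a..b}" "a \<le> b" "Inf K = a" "Sup K = b" "c \<le> a" "b \<le> d"
        using division_real_interval D by metis
      then show "\<bar>h (Sup K) - h (Inf K)\<bar> \<le> M * (\<bar>f (Sup K) - f (Inf K)\<bar> + \<bar>g (Sup K) - g (Inf K)\<bar>)"
        using h[of b a] by auto
    qed
    also have "\<dots> = M * (increments f \<D> + increments g \<D>)"
      by (simp add: distrib_left sum_distrib_left sum.distrib)
    also have "\<dots> < M * (\<epsilon> / (2 * M) + \<epsilon> / (2 * M))"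
      using f1[of \<D>] g1[of \<D>] D M by (intro mult_strict_left_mono add_strict_mono) auto
    also have "\<dots> = \<epsilon>" using M by (simp add: field_simps)
    finally show "increments h \<D> < \<epsilon>" .
  qed
qed

lemma abs_continuous_on_add:
  assumes "abs_continuous_on c d f" "abs_continuous_on c d g"
  shows "abs_continuous_on c d (\<lambda>t. f t + g t)"
  by (rule abs_continuous_on_dominated[OF assms, of 1]) auto

lemma abs_continuous_on_cmult:
  assumes "abs_continuous_on c d f"
  shows "abs_continuous_on c d (\<lambda>t. k * f t)"
proof (rule abs_continuous_on_dominated[OF assms assms, of "\<bar>k\<bar> + 1"])
  fix x y
  have "\<bar>k * f x - k * f y\<bar> = \<bar>k\<bar> * \<bar>f x - f y\<bar>" by (simp add: abs_mult flip: right_diff_distrib)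
  also have "\<dots> \<le> (\<bar>k\<bar> + 1) * (\<bar>f x - f y\<bar> + \<bar>f x - f y\<bar>)" by (intro mult_mono) auto
  finally show "\<bar>k * f x - k * f y\<bar> \<le> (\<bar>k\<bar> + 1) * (\<bar>f x - f y\<bar> + \<bar>f x - f y\<bar>)" .
qed auto

lemma abs_continuous_on_diff:
  assumes "abs_continuous_on c d f" "abs_continuous_on c d g"
  shows "abs_continuous_on c d (\<lambda>t. f t - g t)"
  by (rule abs_continuous_on_dominated[OF assms, of 1]) auto

lemma abs_continuous_on_mult:
  assumes f: "abs_continuous_on c d f" and g: "abs_continuous_on c d g"
    and cf: "continuous_on {c..d} f" and cg: "continuous_on {c..d} g"
  shows "abs_continuous_on c d (\<lambda>t. f t * g t)"
proof -
  obtain M1 where M1: "M1 > 0" "\<And>t. t \<in> {c..d} \<Longrightarrow> \<bar>f t\<bar> \<le> M1"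
    using continuous_on_Icc_bounded[OF cf] by blast
  obtain M2 where M2: "M2 > 0" "\<And>t. t \<in> {c..d} \<Longrightarrow> \<bar>g t\<bar> \<le> M2"
    using continuous_on_Icc_bounded[OF cg] by blast
  define M where "M = max M1 M2"
  have M: "M > 0" "\<And>t. t \<in> {c..d} \<Longrightarrow> \<bar>f t\<bar> \<le> M" "\<And>t. t \<in> {c..d} \<Longrightarrow> \<bar>g t\<bar> \<le> M"
    using M1 M2 by (auto simp: M_def max.coboundedI1 max.coboundedI2)
  \<comment> \<open>M bounds both factors, so the product rule for increments gives the required estimate.\<close>
  show ?thesis
  proof (rule abs_continuous_on_dominated[OF f g M(1)])
    fix x y assume xy: "x \<in> {c..d}" "y \<in> {c..d}"
    have "\<bar>f x * g x - f y * g y\<bar> = \<bar>g x * (f x - f y) + f y * (g x - g y)\<bar>" by (simp add: algebra_simps)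
    also have "\<dots> \<le> \<bar>g x\<bar> * \<bar>f x - f y\<bar> + \<bar>f y\<bar> * \<bar>g x - g y\<bar>"
      by (metis abs_mult abs_triangle_ineq)
    also have "\<dots> \<le> M * \<bar>f x - f y\<bar> + M * \<bar>g x - g y\<bar>"
      by (intro add_mono mult_right_mono M xy) auto
    finally show "\<bar>f x * g x - f y * g y\<bar> \<le> M * (\<bar>f x - f y\<bar> + \<bar>g x - g y\<bar>)" by (simp add: algebra_simps)
  qed
qed

lemma abs_continuous_on_C1:
  assumes f: "\<And>t. t \<in> {c..d} \<Longrightarrow> (f has_real_derivative f' t) (at t within {c..d})"
    and cf: "continuous_on {c..d} f'"
  shows "abs_continuous_on c d f"
proof -
  obtain M where M: "M > 0" "\<And>t. t \<in> {c..d} \<Longrightarrow> \<bar>f' t\<bar> \<le> M"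
    using continuous_on_Icc_bounded[OF cf] by blast
  have lip: "\<bar>f x - f y\<bar> \<le> M * \<bar>x - y\<bar>" if "x \<in> {c..d}" "y \<in> {c..d}" for x y
    using field_differentiable_bound[OF convex_real_interval(5) f, where B=M and x=x and y=y] M that by auto
  show ?thesis
    unfolding abs_continuous_on_def
  proof (intro allI impI)
    fix \<epsilon> :: real assume e: "\<epsilon> > 0"
    show "\<exists>\<delta>>0. \<forall>\<D>. short_family c d \<delta> \<D> \<longrightarrow> increments f \<D> < \<epsilon>"
    proof (intro exI[of _ "\<epsilon> / M"] conjI allI impI)
      show "\<epsilon> / M > 0" using e M by simp
      fix \<D> :: "real set set"
      assume D: "short_family c d (\<epsilon> / M) \<D>"
      have "increments f \<D> \<le> (\<Sum>K\<in>\<D>. M * measure lborel K)"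
      proof (rule sum_mono)
        fix K assume "K \<in> \<D>"
        then obtain a b where "K = {a..b}" "a \<le> b" "Inf K = a" "Sup K = b" "c \<le> a" "b \<le> d" "measure lborel K = b - a"
          using division_real_interval D by metis
        then show "\<bar>f (Sup K) - f (Inf K)\<bar> \<le> M * measure lborel K"
          using lip[of b a] by auto
      qed
      also have "\<dots> = M * (\<Sum>K\<in>\<D>. measure lborel K)" by (simp add: sum_distrib_left)
      also have "\<dots> < M * (\<epsilon> / M)" using D M by (intro mult_strict_left_mono) auto
      also have "\<dots> = \<epsilon>" using M by simp
      finally show "increments f \<D> < \<epsilon>" .
    qed
  qed
qed

text \<open>Split \<open>\<bar>f\<bar>\<close> into its truncation at height \<open>n\<close> and the excess. By dominated convergence the excess has small
  integral over the whole interval once \<open>n\<close> is large; the truncated part contributes at most \<open>n\<close> times the total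
  length of the subintervals.\<close>

lemma abs_continuous_on_integral:
  fixes f :: "real \<Rightarrow> real"
  assumes f: "f absolutely_integrable_on {c..d}"
  shows "abs_continuous_on c d (\<lambda>t. integral {c..t} f)"
  unfolding abs_continuous_on_def
proof (intro allI impI)
  fix \<epsilon> :: real assume e: "\<epsilon> > 0"
  have fi: "f integrable_on {c..d}" and ai: "(\<lambda>x. \<bar>f x\<bar>) integrable_on {c..d}"
    using f by (auto simp: absolutely_integrable_on_def)
  define g where "g n x = \<bar>f x\<bar> - min \<bar>f x\<bar> (real n)" for n x
  have gi: "g n integrable_on {c..d}" for n
  proof -
    have "(\<lambda>x. min \<bar>f x\<bar> (real n)) absolutely_integrable_on {c..d}"
      by (intro absolutely_integrable_min_1 absolutely_integrable_on_const set_integrable_abs f) auto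
    then show ?thesis unfolding g_def
      by (intro integrable_diff ai) (simp add: absolutely_integrable_on_def)
  qed
  have "(\<lambda>n. integral {c..d} (g n)) \<longlonglongrightarrow> integral {c..d} (\<lambda>x. 0)"
  proof (rule dominated_convergence(2)[OF gi ai])
    show "norm (g n x) \<le> \<bar>f x\<bar>" for n x by (auto simp: g_def)
    show "(\<lambda>n. g n x) \<longlonglongrightarrow> 0" for x
    proof (rule tendsto_eventually)
      obtain N where "\<bar>f x\<bar> \<le> real N" using real_arch_simple by blast
      then show "\<forall>\<^sub>F n in sequentially. g n x = 0"
        by (intro eventually_sequentiallyI[of N]) (auto simp: g_def)
    qed
  qed
  then obtain n where n: "integral {c..d} (g n) < \<epsilon> / 2"
    using e order_tendstoD(2)[of _ "0::real" _ "\<epsilon> / 2"] eventually_happens'[OF sequentially_bot] by fastforce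
  show "\<exists>\<delta>>0. \<forall>\<D>. short_family c d \<delta> \<D> \<longrightarrow>
        (\<Sum>K\<in>\<D>. \<bar>integral {c..Sup K} f - integral {c..Inf K} f\<bar>) < \<epsilon>"
  proof (intro exI[of _ "\<epsilon> / (2 * (n + 1))"] conjI allI impI)
    show "\<epsilon> / (2 * (n + 1)) > 0" using e by simp
    fix \<D> :: "real set set"
    assume D: "short_family c d (\<epsilon> / (2 * (n + 1))) \<D>"
    have "(\<Sum>K\<in>\<D>. \<bar>integral {c..Sup K} f - integral {c..Inf K} f\<bar>) \<le> (\<Sum>K\<in>\<D>. integral K (g n) + n * measure lborel K)"
    proof (rule sum_mono)
      fix K assume "K \<in> \<D>"
      then obtain a b where K: "K = {a..b}" "a \<le> b" "Inf K = a" "Sup K = b" "c \<le> a" "b \<le> d" "measure lborel K = b - a"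
        using division_real_interval D by metis
      then have sub: "{a..b} \<subseteq> {c..d}" by auto
      have "integral {c..b} f = integral {c..a} f + integral {a..b} f"
        using K by (intro Henstock_Kurzweil_Integration.integral_combine[symmetric] integrable_on_subinterval[OF fi]) auto
      moreover have "\<bar>integral {a..b} f\<bar> \<le> integral {a..b} (\<lambda>x. g n x + n)"
        using integral_norm_bound_integral[of f "{a..b}" "\<lambda>x. g n x + n"]
          integrable_on_subinterval[OF fi sub] integrable_on_subinterval[OF gi sub]
        by (fastforce simp: g_def intro!: integrable_add)
      moreover have "integral {a..b} (\<lambda>x. g n x + n) = integral {a..b} (g n) + n * (b - a)"
        using integrable_on_subinterval[OF gi sub] K by (subst integral_add) auto
      ultimately show "\<bar>integral {c..Sup K} f - integral {c..Inf K} f\<bar> \<le> integral K (g n) + n * measure lborel K"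
        using K by simp
    qed
    also have "\<dots> = (\<Sum>K\<in>\<D>. integral K (g n)) + n * (\<Sum>K\<in>\<D>. measure lborel K)"
      by (simp add: sum.distrib sum_distrib_left)
    also have "(\<Sum>K\<in>\<D>. integral K (g n)) = integral (\<Union>\<D>) (g n)"
      using D has_integral_combine_division_topdown[OF gi] by (metis integral_unique)
    also have "\<dots> \<le> integral {c..d} (g n)"
      using D has_integral_combine_division_topdown[OF gi]
      by (intro integral_subset_le gi) (auto simp: g_def integrable_on_def)
    also have "n * (\<Sum>K\<in>\<D>. measure lborel K) \<le> (n + 1) * (\<epsilon> / (2 * (n + 1)))"
      using D by (intro mult_mono) (auto intro!: sum_nonneg)
    also have "\<dots> = \<epsilon> / 2" by (simp add: field_simps)
    finally show "(\<Sum>K\<in>\<D>. \<bar>integral {c..Sup K} f - integral {c..Inf K} f\<bar>) < \<epsilon>" using n by simp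
  qed
qed

text \<open>A direct gauge argument. At a tag where \<open>f\<close> is differentiable the gauge makes the increment of \<open>f\<close> close to the
  Riemann term; the tags in the null set \<open>N\<close> are confined to intervals inside an open set of measure below \<open>\<delta>\<close>,
  where absolute continuity makes the increments of \<open>f\<close> sum to less than half of the tolerance.\<close>

lemma fundamental_theorem_of_calculus_abs_continuous:
  fixes f g :: "real \<Rightarrow> real"
  assumes cd: "c \<le> d" and ac: "abs_continuous_on c d f" and N: "negligible N"
    and der: "\<And>t. t \<in> {c..d} - N \<Longrightarrow> (f has_real_derivative g t) (at t within {c..d})"
  shows "(g has_integral f d - f c) {c..d}"
proof -
  define g0 where "g0 t = (if t \<in> N then 0 else g t)" for t
  have "(g0 has_integral f d - f c) {c..d}"
    unfolding has_integral_real
  proof (intro allI impI)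
    fix e :: real assume e: "e > 0"
    obtain \<delta> where \<delta>: "\<delta> > 0" and f1: "\<And>\<D>. short_family c d \<delta> \<D> \<Longrightarrow> increments f \<D> < e / 2"
      using ac e unfolding abs_continuous_on_def by (meson half_gt_zero)
    obtain U where "open U" "N \<subseteq> U" and U: "U - N \<in> lmeasurable" "emeasure lebesgue (U - N) < ennreal \<delta>"
      using sets_lebesgue_outer_open[of N \<delta>] N \<delta> negligible_imp_sets by metis
    have null: "N \<in> null_sets lebesgue" using N by (simp add: negligible_iff_null_sets)
    have "U = (U - N) \<union> N" using \<open>N \<subseteq> U\<close> by blast
    then have "U \<in> lmeasurable"
      by (metis N U(1) fmeasurable.Un negligible_imp_measurable)
    moreover have "measure lebesgue (U - N) < \<delta>"
      using U \<delta> by (simp add: emeasure_eq_measure2 ennreal_less_iff)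
    then have "measure lebesgue U < \<delta>"
      using measure_Diff_null_set[OF _ null, of U] \<open>U \<in> lmeasurable\<close> by (simp add: fmeasurableD)
    ultimately have U: "open U" "N \<subseteq> U" "U \<in> lmeasurable" "measure lebesgue U < \<delta>"
      using \<open>open U\<close> \<open>N \<subseteq> U\<close> by auto
    \<comment> \<open>The added 1 makes \<open>e1 * (d - c)\<close> strictly smaller than \<open>e / 2\<close> and allows \<open>c = d\<close>.\<close>
    define e1 where "e1 = e / (2 * (d - c + 1))"
    have e1: "e1 > 0" using e cd by (simp add: e1_def)
    have "\<exists>r>0. \<forall>y. y \<in> {c..d} \<and> \<bar>y - x\<bar> < r \<longrightarrow> \<bar>f y - f x - g x * (y - x)\<bar> \<le> e1 * \<bar>y - x\<bar>"
      if "x \<in> {c..d} - N" for x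
      using der[OF that] e1 unfolding has_field_derivative_def has_derivative_within_alt real_norm_def
      by (meson)
    then obtain r where r: "\<And>x. x \<in> {c..d} - N \<Longrightarrow> r x > 0"
      "\<And>x y. x \<in> {c..d} - N \<Longrightarrow> y \<in> {c..d} \<Longrightarrow> \<bar>y - x\<bar> < r x \<Longrightarrow> \<bar>f y - f x - g x * (y - x)\<bar> \<le> e1 * \<bar>y - x\<bar>"
      by metis
    define \<gamma> where "\<gamma> x = (if x \<in> N then U else if x \<in> {c..d} then ball x (r x) else ball x 1)" for x
    show "\<exists>\<gamma>. gauge \<gamma> \<and> (\<forall>\<D>. \<D> tagged_division_of {c..d} \<and> \<gamma> fine \<D> \<longrightarrow>
        norm ((\<Sum>(x,k)\<in>\<D>. measure lborel k *\<^sub>R g0 x) - (f d - f c)) < e)"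
    proof (intro exI[of _ \<gamma>] conjI allI impI)
      show "gauge \<gamma>" unfolding gauge_def \<gamma>_def using U r by auto
      fix p assume p: "p tagged_division_of {c..d} \<and> \<gamma> fine p"
      then have tag: "p tagged_division_of {c..d}" and fine: "\<gamma> fine p" by auto
      have fin: "finite p" using tag by blast
      have el: "\<exists>a b. k = {a..b} \<and> a \<le> x \<and> x \<le> b \<and> c \<le> a \<and> b \<le> d \<and> k \<subseteq> \<gamma> x" if "(x,k) \<in> p" for x k
      proof -
        obtain a b where k: "k = cbox a b" using tagged_division_ofD(4)[OF tag] \<open>(x,k) \<in> p\<close> by blast
        moreover have "x \<in> k" "k \<subseteq> {c..d}" using tagged_division_ofD(2,3)[OF tag that] by auto
        moreover have "k \<subseteq> \<gamma> x" using fine that by (auto simp: fine_def)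
        ultimately show ?thesis by (intro exI[of _ a] exI[of _ b]) auto
      qed
      let ?D = "\<lambda>(x,k). f (Sup k) - f (Inf k)"
      let ?E = "\<lambda>xk. \<bar>(case xk of (x,k) \<Rightarrow> measure lborel k *\<^sub>R g0 x) - ?D xk\<bar>"
      define pN where "pN = {(x,k) \<in> p. x \<in> N}"
      define pR where "pR = p - pN"
      have sub: "pN \<subseteq> p" "pR \<subseteq> p" by (auto simp: pN_def pR_def)
      have "(\<Sum>(x,k)\<in>p. measure lborel k *\<^sub>R g0 x) - (f d - f c) = (\<Sum>xk\<in>p. (case xk of (x,k) \<Rightarrow> measure lborel k *\<^sub>R g0 x) - ?D xk)"
        unfolding additive_tagged_division_1[OF cd tag, of f, symmetric] by (simp add: split_def sum_subtractf)
      also have "norm \<dots> \<le> (\<Sum>xk\<in>p. ?E xk)"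
        by (simp add: sum_abs)
      also have "\<dots> = (\<Sum>xk\<in>pR. ?E xk) + (\<Sum>xk\<in>pN. ?E xk)"
        unfolding pR_def by (rule sum.subset_diff[OF sub(1) fin])
      also have "(\<Sum>xk\<in>pR. ?E xk) \<le> (\<Sum>xk\<in>pR. e1 * (case xk of (x,k) \<Rightarrow> measure lborel k))"
      proof (rule sum_mono, clarify)
        fix x k assume xk: "(x,k) \<in> pR"
        then have "(x,k) \<in> p" "x \<notin> N" by (auto simp: pR_def pN_def)
        then obtain a b where k: "k = {a..b}" "a \<le> x" "x \<le> b" "c \<le> a" "b \<le> d" "k \<subseteq> ball x (r x)"
          using el[of x k] by (auto simp: \<gamma>_def split: if_splits)
        have "\<bar>f b - f x - g x * (b - x)\<bar> \<le> e1 * \<bar>b - x\<bar>" "\<bar>f a - f x - g x * (a - x)\<bar> \<le> e1 * \<bar>a - x\<bar>"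
        proof -
          have "a \<in> ball x (r x)" "b \<in> ball x (r x)" using k by (meson atLeastAtMost_iff order_refl order_trans subsetD)+
          then have "\<bar>a - x\<bar> < r x" "\<bar>b - x\<bar> < r x" by (auto simp: dist_real_def)
          then show "\<bar>f b - f x - g x * (b - x)\<bar> \<le> e1 * \<bar>b - x\<bar>" "\<bar>f a - f x - g x * (a - x)\<bar> \<le> e1 * \<bar>a - x\<bar>"
            using k \<open>x \<notin> N\<close> r(2)[of x b] r(2)[of x a] by auto
        qed
        moreover have "measure lborel k * g0 x - (f b - f a) = (f a - f x - g x * (a - x)) - (f b - f x - g x * (b - x))"
          using k \<open>x \<notin> N\<close> by (simp add: g0_def algebra_simps)
        moreover have "e1 * \<bar>b - x\<bar> + e1 * \<bar>a - x\<bar> = e1 * measure lborel k" using k by (simp add: algebra_simps)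
        ultimately have "\<bar>measure lborel k * g0 x - (f b - f a)\<bar> \<le> e1 * measure lborel k" by linarith
        then show "\<bar>measure lborel k *\<^sub>R g0 x - (f (Sup k) - f (Inf k))\<bar> \<le> e1 * measure lborel k" using k by simp
      qed
      also have "\<dots> \<le> (\<Sum>xk\<in>p. e1 * (case xk of (x,k) \<Rightarrow> measure lborel k))"
        using sub fin e1 by (intro sum_mono2) auto
      also have "\<dots> = e1 * (d - c)"
        using additive_content_tagged_division[of p c d] tag cd by (simp add: sum_distrib_left[symmetric])
      also have "\<dots> < e / 2"
        using e cd by (simp add: e1_def field_simps)
      also have "(\<Sum>xk\<in>pN. ?E xk) = (\<Sum>(x,k)\<in>pN. if k = {} then 0 else \<bar>f (Sup k) - f (Inf k)\<bar>)"
        by (rule sum.cong) (use el in \<open>fastforce simp: pN_def g0_def\<close>)+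
      also have "\<dots> = (\<Sum>k\<in>snd ` pN. if k = {} then 0 else \<bar>f (Sup k) - f (Inf k)\<bar>)"
      proof (rule sum.over_tagged_division_lemma)
        have "pN tagged_partial_division_of {c..d}"
          using tag sub(1) tagged_partial_division_subset unfolding tagged_division_of_def by blast
        then show "pN tagged_division_of \<Union>(snd ` pN)" by (rule tagged_partial_division_of_Union_self)
        show "(if cbox u v = {} then 0 else \<bar>f (Sup (cbox u v)) - f (Inf (cbox u v))\<bar>) = 0" if "box u v = {}" for u v :: real
          using that by auto
      qed
      also have "\<dots> = (\<Sum>k\<in>snd ` pN. \<bar>f (Sup k) - f (Inf k)\<bar>)"
        by (rule sum.cong) (use el in \<open>fastforce simp: pN_def\<close>)+
      also have "\<dots> < e / 2"
      proof (rule f1, intro conjI)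
        have "pN tagged_partial_division_of {c..d}"
          using tag sub(1) tagged_partial_division_subset unfolding tagged_division_of_def by blast
        then show div: "snd ` pN division_of \<Union>(snd ` pN)" by (rule partial_division_of_tagged_division)
        show "\<Union>(snd ` pN) \<subseteq> {c..d}" using el by (fastforce simp: pN_def)
        have "(\<Sum>K\<in>snd ` pN. measure lborel K) = measure lebesgue (\<Union>(snd ` pN))"
        proof -
          have "measure lborel K = measure lebesgue K" if "K \<in> snd ` pN" for K
            using division_ofD(4)[OF div that] by auto
          then show ?thesis using content_division[OF div] by simp
        qed
        also have "\<dots> \<le> measure lebesgue U"
        proof (rule measure_mono_fmeasurable)
          show "\<Union>(snd ` pN) \<subseteq> U" using el by (fastforce simp: pN_def \<gamma>_def)
          show "\<Union>(snd ` pN) \<in> sets lebesgue" using div by (metis lmeasurable_division fmeasurableD)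
        qed (rule U)
        also have "\<dots> < \<delta>" by (rule U)
        finally show "(\<Sum>K\<in>snd ` pN. measure lborel K) < \<delta>" .
      qed
      finally show "norm ((\<Sum>(x,k)\<in>p. measure lborel k *\<^sub>R g0 x) - (f d - f c)) < e" by simp
    qed
  qed
  then show ?thesis
    by (rule has_integral_spike[OF N, rotated]) (auto simp: g0_def)
qed

text \<open>Difference quotients to the right converge at almost every point; the same fact for the reflected function covers
  those to the left.\<close>

lemma indefinite_integral_has_derivative_ae:
  fixes f :: "real \<Rightarrow> real"
  assumes f: "f integrable_on {c..d}"
  obtains N where "negligible N"
    "\<And>t. t \<in> {c..d} - N \<Longrightarrow> ((\<lambda>t. integral {c..t} f) has_real_derivative f t) (at t within {c..d})"
proof -
  define F where "F t = (if t \<in> {c..d} then f t else 0)" for t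
  have Fint: "F integrable_on {x..y}" for x y
    using integrable_restrict_UNIV[of "{c..d}" f] f unfolding F_def
    by (metis (lifting) integrable_on_subinterval subset_UNIV)
  have Fr: "(\<lambda>t. F (- t)) integrable_on {x..y}" for x y
    using Fint[of "-y" "-x"] Henstock_Kurzweil_Integration.integrable_reflect_real[where f=F and a="-y" and b="-x"] by simp
  obtain N1 where N1: "negligible N1" "\<And>x e. \<lbrakk>x \<notin> N1; 0 < e\<rbrakk> \<Longrightarrow> \<exists>r>0. \<forall>h. 0 < h \<and> h < r \<longrightarrow> \<bar>integral {x..x+h} F / h - F x\<bar> < e"
    using integrable_ccontinuous_explicit[of F] Fint by (auto simp: divide_inverse mult.commute)
  obtain N2 where N2: "negligible N2" "\<And>x e. \<lbrakk>x \<notin> N2; 0 < e\<rbrakk> \<Longrightarrow> \<exists>r>0. \<forall>h. 0 < h \<and> h < r \<longrightarrow> \<bar>integral {x..x+h} (\<lambda>t. F (- t)) / h - F (- x)\<bar> < e"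
    using integrable_ccontinuous_explicit[of "\<lambda>t. F (- t)"] Fr by (auto simp: divide_inverse mult.commute)
  show thesis
  proof (rule that[of "N1 \<union> uminus ` N2"])
    show "negligible (N1 \<union> uminus ` N2)"
      using N1(1) N2(1)
      by (auto intro!: negligible_Un negligible_differentiable_image_negligible linear_imp_differentiable_on
          bounded_linear.linear bounded_linear_minus bounded_linear_ident)
    fix t assume t: "t \<in> {c..d} - (N1 \<union> uminus ` N2)"
    then have t': "t \<notin> N1" "- t \<notin> N2" "t \<in> {c..d}" by force+
    have Iab: "integral {c..y} f - integral {c..x} f = integral {x..y} F" if "c \<le> x" "x \<le> y" "y \<le> d" for x y
    proof -
      have "integral {c..x} f + integral {x..y} f = integral {c..y} f"
        using that by (intro Henstock_Kurzweil_Integration.integral_combine integrable_on_subinterval[OF f]) auto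
      moreover have "integral {x..y} f = integral {x..y} F"
        using that by (intro integral_cong) (auto simp: F_def)
      ultimately show ?thesis by simp
    qed
    show "((\<lambda>t. integral {c..t} f) has_real_derivative f t) (at t within {c..d})"
      unfolding has_field_derivative_def has_derivative_within_alt real_norm_def
    proof (intro conjI allI impI)
      show "bounded_linear ((*) (f t))" by (rule bounded_linear_mult_right)
      fix e :: real assume e: "e > 0"
      obtain r1 where r1: "r1 > 0" "\<And>h. 0 < h \<Longrightarrow> h < r1 \<Longrightarrow> \<bar>integral {t..t+h} F / h - F t\<bar> < e"
        using N1(2)[OF t'(1) e] by blast
      obtain r2 where r2: "r2 > 0" "\<And>h. 0 < h \<Longrightarrow> h < r2 \<Longrightarrow> \<bar>integral {-t..-t+h} (\<lambda>t. F (- t)) / h - F t\<bar> < e"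
        using N2(2)[OF t'(2) e] by auto
      show "\<exists>r>0. \<forall>y\<in>{c..d}. \<bar>y - t\<bar> < r \<longrightarrow> \<bar>integral {c..y} f - integral {c..t} f - f t * (y - t)\<bar> \<le> e * \<bar>y - t\<bar>"
      proof (intro exI[of _ "min r1 r2"] conjI ballI impI)
        show "min r1 r2 > 0" using r1 r2 by simp
        fix y assume y: "y \<in> {c..d}" "\<bar>y - t\<bar> < min r1 r2"
        consider "y = t" | "y > t" | "y < t" by linarith
        then show "\<bar>integral {c..y} f - integral {c..t} f - f t * (y - t)\<bar> \<le> e * \<bar>y - t\<bar>"
        proof cases
          case 1 then show ?thesis by simp
        next
          case 2
          have "\<bar>integral {t..y} F / (y - t) - f t\<bar> < e"
            using r1(2)[of "y - t"] 2 y t' by (simp add: F_def)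
          moreover have "integral {t..y} F - f t * (y - t) = (integral {t..y} F / (y - t) - f t) * (y - t)"
            using 2 by (simp add: field_simps)
          ultimately have "\<bar>integral {t..y} F - f t * (y - t)\<bar> \<le> e * \<bar>y - t\<bar>"
            by (simp add: abs_mult mult_right_mono)
          then show ?thesis using Iab[of t y] 2 y t' by simp
        next
          case 3
          have "integral {-t..-y} (\<lambda>t. F (- t)) = integral {y..t} F"
            using integral_reflect_real[where f=F and a=y and b=t] by simp
          then have "\<bar>integral {y..t} F / (t - y) - f t\<bar> < e"
            using r2(2)[of "t - y"] 3 y t' by (simp add: F_def)
          moreover have "integral {y..t} F - f t * (t - y) = (integral {y..t} F / (t - y) - f t) * (t - y)"
            using 3 by (simp add: field_simps)
          ultimately have "\<bar>integral {y..t} F - f t * (t - y)\<bar> \<le> e * \<bar>t - y\<bar>"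
            by (simp add: abs_mult mult_right_mono)
          moreover have "integral {c..y} f - integral {c..t} f - f t * (y - t) = - (integral {y..t} F - f t * (t - y))"
            using Iab[of y t] 3 y t' by (simp add: algebra_simps)
          ultimately show ?thesis by (simp add: abs_minus_commute)
        qed
      qed
    qed
  qed
qed

lemma abs_continuous_on_cong:
  assumes "\<And>t. t \<in> {c..d} \<Longrightarrow> f t = g t"
  shows "abs_continuous_on c d f \<longleftrightarrow> abs_continuous_on c d g"
proof -
  have *: "abs_continuous_on c d g" if "abs_continuous_on c d f" "\<And>t. t \<in> {c..d} \<Longrightarrow> f t = g t" for f g
    by (rule abs_continuous_on_dominated[OF that(1) that(1), of 1]) (simp_all add: that(2))
  show ?thesis using *[of f g] *[of g f] assms by auto
qed

lemma abs_continuous_on_subset: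
  assumes "abs_continuous_on c d f" "c \<le> c'" "d' \<le> d"
  shows "abs_continuous_on c' d' f"
proof -
  have sub: "\<Union>\<D> \<subseteq> {c..d}" if "\<Union>\<D> \<subseteq> {c'..d'}" for \<D> :: "real set set"
    using that assms(2,3) by fastforce
  show ?thesis
    unfolding abs_continuous_on_def
  proof (intro allI impI)
    fix \<epsilon> :: real assume "\<epsilon> > 0"
    then obtain \<delta> where "\<delta> > 0" "\<forall>\<D>. short_family c d \<delta> \<D> \<longrightarrow> increments f \<D> < \<epsilon>"
      using assms(1)[unfolded abs_continuous_on_def, rule_format] by blast
    then show "\<exists>\<delta>>0. \<forall>\<D>. short_family c' d' \<delta> \<D> \<longrightarrow> increments f \<D> < \<epsilon>"
      using sub by (intro exI[of _ \<delta>]) simp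
  qed
qed

text \<open>An absolutely continuous function whose almost everywhere derivative has a continuous representative is the integral
  of that representative, hence differentiable everywhere. This is how pointwise statements are recovered from almost
  everywhere ones.\<close>

lemma abs_continuous_on_imp_C1:
  assumes ac: "abs_continuous_on 0 S f" and N: "negligible N"
    and der: "\<And>t. t \<in> {0..S} - N \<Longrightarrow> (f has_real_derivative h t) (at t within {0..S})"
    and ch: "continuous_on {0..S} h" and t: "t \<in> {0..S}"
  shows "(f has_real_derivative h t) (at t within {0..S})"
proof -
  have eq: "f s = f 0 + integral {0..s} h" if s: "s \<in> {0..S}" for s
  proof -
    have "(h has_integral f s - f 0) {0..s}"
    proof (rule fundamental_theorem_of_calculus_abs_continuous[where f = f and g = h, OF _ _ N])
      show "abs_continuous_on 0 s f" by (rule abs_continuous_on_subset[OF ac]) (use s in auto)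
      show "(f has_real_derivative h r) (at r within {0..s})" if "r \<in> {0..s} - N" for r
        using der[of r] that s by (auto intro: has_field_derivative_subset)
    qed (use s in auto)
    then show ?thesis by (simp add: integral_unique)
  qed
  have "((\<lambda>s. f 0 + integral {0..s} h) has_real_derivative h t) (at t within {0..S})"
    using DERIV_add[OF DERIV_const integral_has_real_derivative[OF ch t], of "f 0"] by simp
  then show ?thesis
    unfolding has_field_derivative_def by (rule has_derivative_transform[OF t eq, rotated])
qed

section \<open>Linear systems with continuous coefficients\<close>

lemma nonpos_deriv_imp_le:
  fixes f :: "real \<Rightarrow> real"
  assumes ab: "a \<le> b"
    and d: "\<And>t. t \<in> {a..b} \<Longrightarrow> (f has_real_derivative f' t) (at t within {a..b})"
    and n: "\<And>t. t \<in> {a<..<b} \<Longrightarrow> f' t \<le> 0"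
  shows "f b \<le> f a"
proof (cases "a = b")
  case False
  then obtain x where x: "x \<in> {a<..<b}" "f b - f a = f' x * (b - a)"
    using mvt_simple[of a b f "\<lambda>t h. f' t * h"] ab d by (auto simp: has_field_derivative_def)
  then show ?thesis using n[OF x(1)] ab mult_nonpos_nonneg[of "f' x" "b - a"] by auto
qed simp

lemma neg_deriv_imp_less:
  fixes f :: "real \<Rightarrow> real"
  assumes ab: "a < b"
    and d: "\<And>t. t \<in> {a..b} \<Longrightarrow> (f has_real_derivative f' t) (at t within {a..b})"
    and n: "\<And>t. t \<in> {a<..<b} \<Longrightarrow> f' t < 0"
  shows "f b < f a"
proof -
  obtain x where x: "x \<in> {a<..<b}" "f b - f a = f' x * (b - a)"
    using mvt_simple[of a b f "\<lambda>t h. f' t * h"] ab d by (auto simp: has_field_derivative_def)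
  then show ?thesis using n[OF x(1)] ab mult_neg_pos[of "f' x" "b - a"] by auto
qed

text \<open>Picard iteration with Bielecki's weight: after multiplication by \<open>exp (- k t)\<close> the integral operator contracts by
  the factor \<open>L / k\<close> on the whole interval, so no patching of short intervals is needed.\<close>

lemma global_ode_solution:
  fixes F :: "real \<Rightarrow> 'a::banach \<Rightarrow> 'a"
  assumes S: "0 \<le> S" and L: "0 \<le> L"
    and cF: "continuous_on ({0..S} \<times> UNIV) (\<lambda>(t, x). F t x)"
    and lip: "\<And>t x y. t \<in> {0..S} \<Longrightarrow> norm (F t x - F t y) \<le> L * norm (x - y)"
  obtains x where "x 0 = x0"
    "\<And>t. t \<in> {0..S} \<Longrightarrow> (x has_vector_derivative F t (x t)) (at t within {0..S})"
proof -
  define k where "k = L + 1"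
  have k: "k > 0" using L by (simp add: k_def)
  have cFc: "continuous_on {0..S} (\<lambda>s. F s (f s))" if "continuous_on {0..S} f" for f
  proof -
    have "continuous_on {0..S} (\<lambda>s. (s, f s))" by (intro continuous_intros that)
    from continuous_on_compose2[OF cF this] show ?thesis by (simp add: image_subset_iff)
  qed
  define h where "h g t = exp (- k * t) *\<^sub>R (x0 + integral {0..t} (\<lambda>s. F s (exp (k * s) *\<^sub>R apply_bcontfun g s)))"
    for g :: "real \<Rightarrow>\<^sub>C 'a" and t
  have cint: "continuous_on {0..S} (\<lambda>s. F s (exp (k * s) *\<^sub>R apply_bcontfun g s))" for g :: "real \<Rightarrow>\<^sub>C 'a"
    by (intro cFc continuous_intros) auto
  have "\<exists>G :: real \<Rightarrow>\<^sub>C 'a. (\<forall>t\<in>cbox 0 S. G t = h g t) \<and> (\<forall>t. G t = h g (clamp 0 S t))" for g :: "real \<Rightarrow>\<^sub>C 'a"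
  proof -
    have "continuous_on (cbox 0 S) (h g)"
      unfolding h_def box_real
      by (intro continuous_intros indefinite_integral_continuous_1 integrable_continuous_real cint)
    then show ?thesis by (rule continuous_on_cbox_bcontfunE) blast
  qed
  then obtain \<Phi> :: "(real \<Rightarrow>\<^sub>C 'a) \<Rightarrow> (real \<Rightarrow>\<^sub>C 'a)" where
    \<Phi>: "\<And>g t. t \<in> {0..S} \<Longrightarrow> \<Phi> g t = h g t" "\<And>g t. \<Phi> g t = h g (clamp 0 S t)"
    unfolding box_real by metis
  have contr: "dist (\<Phi> g1) (\<Phi> g2) \<le> (L / k) * dist g1 g2" for g1 g2
  proof (rule dist_bound)
    fix t
    define \<tau> where "\<tau> = clamp 0 S t"
    have \<tau>: "\<tau> \<in> {0..S}" using S clamp_in_interval[of "0::real" S t] by (auto simp: \<tau>_def)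
    let ?f = "\<lambda>g s. F s (exp (k * s) *\<^sub>R apply_bcontfun g s)"
    have int: "?f g integrable_on {0..\<tau>}" for g
      using \<tau> by (intro integrable_continuous_real continuous_on_subset[OF cint]) auto
    have der: "((\<lambda>s. L * dist g1 g2 * exp (k * s)) has_integral (L * dist g1 g2 / k * exp (k * \<tau>) - L * dist g1 g2 / k * exp (k * 0))) {0..\<tau>}"
      using \<tau> k by (intro fundamental_theorem_of_calculus)
        (auto intro!: derivative_eq_intros simp flip: has_real_derivative_iff_has_vector_derivative)
    have "dist (\<Phi> g1 t) (\<Phi> g2 t) = norm (exp (- k * \<tau>) *\<^sub>R (integral {0..\<tau>} (?f g1) - integral {0..\<tau>} (?f g2)))"
      unfolding \<Phi>(2) h_def \<tau>_def[symmetric] by (simp add: dist_norm flip: scaleR_diff_right)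
    also have "\<dots> = exp (- k * \<tau>) * norm (integral {0..\<tau>} (\<lambda>s. ?f g1 s - ?f g2 s))"
      using int by (simp add: integral_diff)
    also have "norm (integral {0..\<tau>} (\<lambda>s. ?f g1 s - ?f g2 s)) \<le> integral {0..\<tau>} (\<lambda>s. L * dist g1 g2 * exp (k * s))"
    proof (rule integral_norm_bound_integral)
      show "(\<lambda>s. ?f g1 s - ?f g2 s) integrable_on {0..\<tau>}" by (intro integrable_diff int)
      show "(\<lambda>s. L * dist g1 g2 * exp (k * s)) integrable_on {0..\<tau>}" using der by blast
      fix s assume s: "s \<in> {0..\<tau>}"
      then have "norm (?f g1 s - ?f g2 s) \<le> L * norm (exp (k * s) *\<^sub>R apply_bcontfun g1 s - exp (k * s) *\<^sub>R apply_bcontfun g2 s)"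
        using \<tau> by (intro lip) auto
      also have "\<dots> = L * (exp (k * s) * dist (g1 s) (g2 s))"
        by (simp add: dist_norm flip: scaleR_diff_right)
      also have "\<dots> \<le> L * (exp (k * s) * dist g1 g2)"
        using L by (intro mult_left_mono dist_bounded) auto
      finally show "norm (?f g1 s - ?f g2 s) \<le> L * dist g1 g2 * exp (k * s)" by (simp add: algebra_simps)
    qed
    also have "\<dots> = L * dist g1 g2 / k * exp (k * \<tau>) - L * dist g1 g2 / k * exp (k * 0)"
      using der by (rule integral_unique)
    also have "\<dots> \<le> L * dist g1 g2 / k * exp (k * \<tau>)" using L k by simp
    also have "exp (- k * \<tau>) * \<dots> = L / k * dist g1 g2"
      by (simp add: exp_minus field_simps)
    finally show "dist (\<Phi> g1 t) (\<Phi> g2 t) \<le> L / k * dist g1 g2" by (simp add: mult_left_mono)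
  qed
  obtain g where g: "\<Phi> g = g"
    using banach_fix_type[of "L / k" \<Phi>] L k contr by (auto simp: k_def)
  define x where "x t = exp (k * t) *\<^sub>R apply_bcontfun g t" for t
  have x: "x t = x0 + integral {0..t} (\<lambda>s. F s (x s))" if "t \<in> {0..S}" for t
  proof -
    have "g t = h g t" using \<Phi>(1)[OF that, of g] g by simp
    then show ?thesis by (simp add: x_def h_def exp_minus)
  qed
  have cx: "continuous_on {0..S} x" unfolding x_def by (intro continuous_intros) auto
  show thesis
  proof (rule that[of x])
    show "x 0 = x0" using x[of 0] S by simp
    fix t assume t: "t \<in> {0..S}"
    have "((\<lambda>t. x0 + integral {0..t} (\<lambda>s. F s (x s))) has_vector_derivative F t (x t)) (at t within {0..S})"
      using integral_has_vector_derivative[OF cFc[OF cx] t] by (auto intro!: derivative_eq_intros)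
    then show "(x has_vector_derivative F t (x t)) (at t within {0..S})"
      by (rule has_vector_derivative_transform[OF t, rotated]) (use x in auto)
  qed
qed

lemma gronwall_sum_of_squares:
  fixes E :: "real \<Rightarrow> real"
  assumes t: "0 \<le> t" and C: "0 \<le> C" and D: "0 \<le> D" and E0: "E 0 = 0"
    and der: "\<And>s. s \<in> {0..t} \<Longrightarrow> (E has_real_derivative E' s) (at s within {0..t})"
    and le: "\<And>s. s \<in> {0..t} \<Longrightarrow> E' s \<le> C * E s + D"
  shows "E t \<le> D * t * exp (C * t)"
proof -
  have "E t * exp (- C * t) - D * t \<le> E 0 * exp (- C * 0) - D * 0"
  proof (rule nonpos_deriv_imp_le[OF t])
    fix s assume s: "s \<in> {0..t}"
    show "((\<lambda>s. E s * exp (- C * s) - D * s) has_real_derivative (E' s - C * E s) * exp (- C * s) - D) (at s within {0..t})"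
      by (auto intro!: derivative_eq_intros der[OF s] simp: algebra_simps)
  next
    fix s assume s: "s \<in> {0<..<t}"
    have "(E' s - C * E s) * exp (- C * s) \<le> D * exp (- C * s)"
      using le[of s] s by (intro mult_right_mono) auto
    also have "\<dots> \<le> D * 1" using C D s by (intro mult_left_mono) auto
    finally show "(E' s - C * E s) * exp (- C * s) - D \<le> 0" by simp
  qed
  then have "E t * exp (- C * t) * exp (C * t) \<le> D * t * exp (C * t)" using E0 by (intro mult_right_mono) auto
  then show ?thesis by (simp add: exp_minus field_simps)
qed

section \<open>The regularized equation\<close>

text \<open>The system for \<open>u\<close> and its quasi-derivative \<open>p = u' + A u\<close>, formally equivalent to
  \<open>u'' + (A' + \<Lambda>) u = 0\<close>; \<open>A\<close> need not be differentiable. The parameter \<open>\<Lambda>\<close> is a function so that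
  comparison functions with variable parameter are covered.\<close>

definition reg_sol :: "(real \<Rightarrow> real) \<Rightarrow> (real \<Rightarrow> real) \<Rightarrow> real \<Rightarrow> (real \<Rightarrow> real) \<Rightarrow> (real \<Rightarrow> real) \<Rightarrow> bool" where
  "reg_sol A \<Lambda> S u p \<longleftrightarrow> (\<forall>t\<in>{0..S}.
     (u has_real_derivative p t - A t * u t) (at t within {0..S}) \<and>
     (p has_real_derivative A t * p t - (\<Lambda> t + (A t)\<^sup>2) * u t) (at t within {0..S}))"

lemma reg_solD:
  assumes "reg_sol A \<Lambda> S u p" "t \<in> {0..S}"
  shows "(u has_real_derivative p t - A t * u t) (at t within {0..S})"
    "(p has_real_derivative A t * p t - (\<Lambda> t + (A t)\<^sup>2) * u t) (at t within {0..S})"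
  using assms by (auto simp: reg_sol_def)

lemma reg_sol_continuous:
  assumes "reg_sol A \<Lambda> S u p"
  shows "continuous_on {0..S} u" "continuous_on {0..S} p"
  by (rule DERIV_continuous_on[OF reg_solD(1)[OF assms]], assumption)
     (rule DERIV_continuous_on[OF reg_solD(2)[OF assms]])

lemma reg_sol_subinterval:
  assumes "reg_sol A \<Lambda> S u p" "R \<le> S"
  shows "reg_sol A \<Lambda> R u p"
  unfolding reg_sol_def
proof (intro ballI)
  fix t assume "t \<in> {0..R}"
  then have t: "t \<in> {0..S}" and sub: "{0..R} \<subseteq> {0..S}" using assms(2) by auto
  show "(u has_real_derivative p t - A t * u t) (at t within {0..R}) \<and>
     (p has_real_derivative A t * p t - (\<Lambda> t + (A t)\<^sup>2) * u t) (at t within {0..R})"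
    using reg_solD[OF assms(1) t] has_field_derivative_subset[OF _ sub] by blast
qed

lemma reg_sol_cong:
  assumes "reg_sol A \<Lambda> S u p" "\<And>t. t \<in> {0..S} \<Longrightarrow> A t = A' t" "\<And>t. t \<in> {0..S} \<Longrightarrow> \<Lambda> t = \<Lambda>' t"
  shows "reg_sol A' \<Lambda>' S u p"
  using assms unfolding reg_sol_def by auto

lemma reg_sol_lincomb:
  assumes "reg_sol A \<Lambda> S u p" "reg_sol A \<Lambda> S v q"
  shows "reg_sol A \<Lambda> S (\<lambda>t. a * u t + b * v t) (\<lambda>t. a * p t + b * q t)"
  unfolding reg_sol_def
proof (intro ballI conjI)
  fix t assume t: "t \<in> {0..S}"
  note [derivative_intros] = reg_solD[OF assms(1) t] reg_solD[OF assms(2) t]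
  show "((\<lambda>t. a * u t + b * v t) has_real_derivative a * p t + b * q t - A t * (a * u t + b * v t)) (at t within {0..S})"
    by (auto intro!: derivative_eq_intros simp: algebra_simps)
  show "((\<lambda>t. a * p t + b * q t) has_real_derivative A t * (a * p t + b * q t) - (\<Lambda> t + (A t)\<^sup>2) * (a * u t + b * v t)) (at t within {0..S})"
    by (auto intro!: derivative_eq_intros simp: algebra_simps)
qed

lemma reg_sol_exists:
  assumes S: "0 \<le> S" and A: "continuous_on {0..S} A"
  obtains u p where "reg_sol A (\<lambda>_. \<mu>) S u p" "u 0 = c0" "p 0 = c1"
proof -
  obtain M where M: "M > 0" "\<And>t. t \<in> {0..S} \<Longrightarrow> \<bar>A t\<bar> \<le> M"
    using continuous_on_Icc_bounded[OF A] by blast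
  define F where "F t x = (snd x - A t * fst x, A t * snd x - (\<mu> + (A t)\<^sup>2) * fst x)" for t and x :: "real \<times> real"
  define L where "L = (1 + M) + (M + (\<bar>\<mu>\<bar> + M\<^sup>2))"
  have A': "continuous_on ({0..S} \<times> UNIV) (\<lambda>x. A (fst x))"
    by (rule continuous_on_compose2[OF A]) (auto intro!: continuous_intros)
  have cF: "continuous_on ({0..S} \<times> UNIV) (\<lambda>(t, x). F t x)"
    unfolding F_def split_beta by (intro continuous_intros A')
  have lip: "norm (F t x - F t y) \<le> L * norm (x - y)" if t: "t \<in> {0..S}" for t x y
  proof -
    define a b where "a = fst x - fst y" and "b = snd x - snd y"
    have ab: "\<bar>a\<bar> \<le> norm (x - y)" "\<bar>b\<bar> \<le> norm (x - y)"
      using norm_fst_le[where x=a and y=b] norm_snd_le[where x=a and y=b]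
      by (auto simp: a_def b_def minus_prod_def)
    have eq: "F t x - F t y = (b - A t * a, A t * b - (\<mu> + (A t)\<^sup>2) * a)"
      by (simp add: F_def a_def b_def algebra_simps)
    have A2: "\<bar>\<mu> + (A t)\<^sup>2\<bar> \<le> \<bar>\<mu>\<bar> + M\<^sup>2"
    proof -
      have "(A t)\<^sup>2 \<le> M\<^sup>2" using M(2)[OF t] by (metis abs_ge_zero power2_abs power_mono)
      then show ?thesis using abs_triangle_ineq[of \<mu> "(A t)\<^sup>2"] by simp
    qed
    have n: "norm (x - y) \<ge> 0" by simp
    have "\<bar>A t * a\<bar> \<le> M * norm (x - y)" "\<bar>A t * b\<bar> \<le> M * norm (x - y)"
      unfolding abs_mult using M(2)[OF t] M(1) ab by (intro mult_mono; simp)+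
    moreover have "\<bar>(\<mu> + (A t)\<^sup>2) * a\<bar> \<le> (\<bar>\<mu>\<bar> + M\<^sup>2) * norm (x - y)"
      unfolding abs_mult using A2 ab by (intro mult_mono) auto
    moreover have "norm (F t x - F t y) \<le> \<bar>b - A t * a\<bar> + \<bar>A t * b - (\<mu> + (A t)\<^sup>2) * a\<bar>"
      unfolding eq using norm_Pair_le[of "b - A t * a" "A t * b - (\<mu> + (A t)\<^sup>2) * a"] by simp
    moreover have "L * norm (x - y) = norm (x - y) + M * norm (x - y) + (M * norm (x - y) + (\<bar>\<mu>\<bar> + M\<^sup>2) * norm (x - y))"
      by (simp add: L_def algebra_simps)
    ultimately show ?thesis using ab by linarith
  qed
  have "0 \<le> L" using M(1) by (simp add: L_def)
  from global_ode_solution[OF S this cF lip, of "(c0, c1)"]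
  obtain x where x: "x 0 = (c0, c1)" "\<And>t. t \<in> {0..S} \<Longrightarrow> (x has_vector_derivative F t (x t)) (at t within {0..S})"
    by blast
  have "reg_sol A (\<lambda>_. \<mu>) S (fst \<circ> x) (snd \<circ> x)"
    unfolding reg_sol_def
  proof (intro ballI conjI)
    fix t assume t: "t \<in> {0..S}"
    have d: "(x has_derivative (\<lambda>h. h *\<^sub>R F t (x t))) (at t within {0..S})"
      using x(2)[OF t] by (simp add: has_vector_derivative_def)
    show "(fst \<circ> x has_real_derivative (snd \<circ> x) t - A t * (fst \<circ> x) t) (at t within {0..S})"
      using has_derivative_fst[OF d] by (simp add: has_field_derivative_def F_def o_def mult_commute_abs)
    show "(snd \<circ> x has_real_derivative A t * (snd \<circ> x) t - (\<mu> + (A t)\<^sup>2) * (fst \<circ> x) t) (at t within {0..S})"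
      using has_derivative_snd[OF d] by (simp add: has_field_derivative_def F_def o_def mult_commute_abs)
  qed
  then show thesis by (rule that) (use x in auto)
qed

text \<open>In \<open>u\<^sub>1 p\<^sub>2 - p\<^sub>1 u\<^sub>2\<close> the terms with \<open>A\<close> cancel, so this is the classical Wronskian
  \<open>u\<^sub>1 u\<^sub>2' - u\<^sub>1' u\<^sub>2\<close>.\<close>

lemma wronskian_has_derivative:
  assumes "reg_sol A \<Lambda>1 S u1 p1" "reg_sol A \<Lambda>2 S u2 p2" "t \<in> {0..S}"
  shows "((\<lambda>t. u1 t * p2 t - p1 t * u2 t) has_real_derivative (\<Lambda>1 t - \<Lambda>2 t) * (u1 t * u2 t)) (at t within {0..S})"
proof -
  note [derivative_intros] = reg_solD[OF assms(1,3)] reg_solD[OF assms(2,3)]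
  show ?thesis
    by (auto intro!: derivative_eq_intros simp: algebra_simps)
qed

lemma wronskian_constant:
  assumes "reg_sol A \<Lambda> S u1 p1" "reg_sol A \<Lambda> S u2 p2" "t \<in> {0..S}" "s \<in> {0..S}"
  shows "u1 t * p2 t - p1 t * u2 t = u1 s * p2 s - p1 s * u2 s"
proof -
  have "\<exists>c. \<forall>t\<in>{0..S}. u1 t * p2 t - p1 t * u2 t = c"
  proof (rule has_field_derivative_zero_constant)
    show "((\<lambda>t. u1 t * p2 t - p1 t * u2 t) has_real_derivative 0) (at t within {0..S})" if "t \<in> {0..S}" for t
      using wronskian_has_derivative[OF assms(1,2) that] by simp
  qed auto
  then show ?thesis using assms(3,4) by auto
qed

text \<open>Wronskians with \<open>\<phi>\<close> and \<open>\<psi>\<close> are constant, and by Cramer's rule they are the coordinates of \<open>u\<close> in this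
  basis. Uniqueness for the initial value problem follows from it.\<close>

lemma reg_sol_expand:
  assumes "reg_sol A \<Lambda> S u p" "reg_sol A \<Lambda> S \<phi> p\<phi>" "reg_sol A \<Lambda> S \<psi> p\<psi>"
    and init: "\<phi> 0 = 1" "p\<phi> 0 = 0" "\<psi> 0 = 0" "p\<psi> 0 = 1" and t: "t \<in> {0..S}"
  shows "u t = u 0 * \<phi> t + p 0 * \<psi> t" "p t = u 0 * p\<phi> t + p 0 * p\<psi> t"
    "\<phi> t * p\<psi> t - p\<phi> t * \<psi> t = 1"
proof -
  have 0: "0 \<in> {0..S}" using t by auto
  have a: "u t * p\<psi> t - p t * \<psi> t = u 0" using wronskian_constant[OF assms(1,3) t 0] init by simp
  have b: "u t * p\<phi> t - p t * \<phi> t = - p 0" using wronskian_constant[OF assms(1,2) t 0] init by simp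
  show c: "\<phi> t * p\<psi> t - p\<phi> t * \<psi> t = 1" using wronskian_constant[OF assms(2,3) t 0] init by simp
  have "u t * (\<phi> t * p\<psi> t - p\<phi> t * \<psi> t) = (u t * p\<psi> t - p t * \<psi> t) * \<phi> t - (u t * p\<phi> t - p t * \<phi> t) * \<psi> t"
    by (simp add: algebra_simps)
  then show "u t = u 0 * \<phi> t + p 0 * \<psi> t" unfolding a b c by simp
  have "p t * (\<phi> t * p\<psi> t - p\<phi> t * \<psi> t) = (u t * p\<psi> t - p t * \<psi> t) * p\<phi> t - (u t * p\<phi> t - p t * \<phi> t) * p\<psi> t"
    by (simp add: algebra_simps)
  then show "p t = u 0 * p\<phi> t + p 0 * p\<psi> t" unfolding a b c by simp
qed

lemma reg_sol_unique:
  assumes A: "continuous_on {0..S} A" and "reg_sol A (\<lambda>_. \<mu>) S u p" "reg_sol A (\<lambda>_. \<mu>) S v q"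
    and s: "s \<in> {0..S}" and eq: "u s = v s" "p s = q s" and t: "t \<in> {0..S}"
  shows "u t = v t \<and> p t = q t"
proof -
  have S: "0 \<le> S" using s by auto
  obtain \<phi> p\<phi> where \<phi>: "reg_sol A (\<lambda>_. \<mu>) S \<phi> p\<phi>" "\<phi> 0 = 1" "p\<phi> 0 = 0"
    using reg_sol_exists[OF S A] by blast
  obtain \<psi> p\<psi> where \<psi>: "reg_sol A (\<lambda>_. \<mu>) S \<psi> p\<psi>" "\<psi> 0 = 0" "p\<psi> 0 = 1"
    using reg_sol_exists[OF S A] by blast
  have 0: "0 \<in> {0..S}" using t by auto
  have "u 0 = v 0"
    using wronskian_constant[OF assms(2) \<psi>(1) s 0] wronskian_constant[OF assms(3) \<psi>(1) s 0] eq \<psi> by simp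
  moreover have "p 0 = q 0"
    using wronskian_constant[OF assms(2) \<phi>(1) s 0] wronskian_constant[OF assms(3) \<phi>(1) s 0] eq \<phi> by simp
  ultimately show ?thesis
    using reg_sol_expand[OF assms(2) \<phi>(1) \<psi>(1) \<phi>(2,3) \<psi>(2,3) t]
      reg_sol_expand[OF assms(3) \<phi>(1) \<psi>(1) \<phi>(2,3) \<psi>(2,3) t] by simp
qed

text \<open>Gronwall's argument for the squared distance \<open>E = (v - u)\<^sup>2 + (q - p)\<^sup>2\<close>: it starts at \<open>0\<close> and satisfies
  \<open>E' \<le> C E + D\<close>, where \<open>D\<close> is proportional to \<open>(\<nu> - \<mu>)\<^sup>2\<close>.\<close>

lemma reg_sol_continuous_parameter:
  assumes S: "0 \<le> S" and A: "continuous_on {0..S} A" and e: "e > 0"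
    and uv: "reg_sol A (\<lambda>_. \<mu>) S u p"
  obtains \<delta> where "\<delta> > 0"
    "\<And>\<nu> v q t. \<bar>\<nu> - \<mu>\<bar> < \<delta> \<Longrightarrow> reg_sol A (\<lambda>_. \<nu>) S v q \<Longrightarrow> v 0 = u 0 \<Longrightarrow> q 0 = p 0 \<Longrightarrow> t \<in> {0..S} \<Longrightarrow>
       \<bar>v t - u t\<bar> < e \<and> \<bar>q t - p t\<bar> < e"
proof -
  obtain M where M: "M > 0" "\<And>t. t \<in> {0..S} \<Longrightarrow> \<bar>A t\<bar> \<le> M"
    using continuous_on_Icc_bounded[OF A] by blast
  obtain Y where Y: "Y > 0" "\<And>t. t \<in> {0..S} \<Longrightarrow> \<bar>u t\<bar> \<le> Y"
    using continuous_on_Icc_bounded[OF reg_sol_continuous(1)[OF uv]] by blast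
  define K where "K = \<bar>\<mu>\<bar> + 1"
  define C where "C = 2 + 2 * M + K + M\<^sup>2"
  define Q where "Q = Y\<^sup>2 * S * exp (C * S) + 1"
  have C: "C \<ge> 0" using M by (simp add: C_def K_def)
  have Q: "Q > 0" using S by (simp add: Q_def add_nonneg_pos)
  show thesis
  proof (rule that[of "min 1 (e / sqrt Q)"])
    show "min 1 (e / sqrt Q) > 0" using e Q by simp
    fix \<nu> v q t
    assume \<nu>: "\<bar>\<nu> - \<mu>\<bar> < min 1 (e / sqrt Q)" and vq: "reg_sol A (\<lambda>_. \<nu>) S v q"
      and init: "v 0 = u 0" "q 0 = p 0" and t: "t \<in> {0..S}"
    define w r where "w t = v t - u t" and "r t = q t - p t" for t
    define D where "D = (\<nu> - \<mu>)\<^sup>2 * Y\<^sup>2"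
    define E' where "E' s = 2 * w s * (r s - A s * w s) + 2 * r s * (A s * r s - (\<nu> + (A s)\<^sup>2) * w s - (\<nu> - \<mu>) * u s)" for s
    have "(w t)\<^sup>2 + (r t)\<^sup>2 \<le> D * t * exp (C * t)"
    proof (rule gronwall_sum_of_squares[where E' = E'])
      show "0 \<le> t" using t by simp
      show "0 \<le> D" by (simp add: D_def)
      show "(w 0)\<^sup>2 + (r 0)\<^sup>2 = 0" using init by (simp add: w_def r_def)
      fix s assume s: "s \<in> {0..t}"
      then have s': "s \<in> {0..S}" using t by auto
      have dw: "(w has_real_derivative r s - A s * w s) (at s within {0..S})"
        using DERIV_diff[OF reg_solD(1)[OF vq s'] reg_solD(1)[OF uv s']]
        unfolding w_def r_def by (simp add: algebra_simps)
      have dr: "(r has_real_derivative A s * r s - (\<nu> + (A s)\<^sup>2) * w s - (\<nu> - \<mu>) * u s) (at s within {0..S})"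
        using DERIV_diff[OF reg_solD(2)[OF vq s'] reg_solD(2)[OF uv s']]
        unfolding w_def r_def by (simp add: algebra_simps)
      have "((\<lambda>s. (w s)\<^sup>2 + (r s)\<^sup>2) has_real_derivative E' s) (at s within {0..S})"
        unfolding E'_def by (auto intro!: derivative_eq_intros dw dr)
      then show "((\<lambda>s. (w s)\<^sup>2 + (r s)\<^sup>2) has_real_derivative E' s) (at s within {0..t})"
        using t by (auto intro: has_field_derivative_subset)
      define W where "W = (w s)\<^sup>2 + (r s)\<^sup>2"
      have W: "(w s)\<^sup>2 \<le> W" "(r s)\<^sup>2 \<le> W" "2 * \<bar>w s * r s\<bar> \<le> W"
        using sum_squares_bound[of "\<bar>w s\<bar>" "\<bar>r s\<bar>"] by (auto simp: W_def abs_mult)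
      have 1: "2 * (w s * r s) \<le> W" using W(3) by linarith
      have 2: "2 * A s * ((r s)\<^sup>2 - (w s)\<^sup>2) \<le> 2 * M * W"
      proof -
        have "2 * A s * ((r s)\<^sup>2 - (w s)\<^sup>2) \<le> 2 * (\<bar>A s\<bar> * \<bar>(r s)\<^sup>2 - (w s)\<^sup>2\<bar>)"
          using abs_ge_self[of "A s * ((r s)\<^sup>2 - (w s)\<^sup>2)"] by (simp add: abs_mult)
        also have "\<dots> \<le> 2 * (M * W)"
        proof -
          have "\<bar>(r s)\<^sup>2 - (w s)\<^sup>2\<bar> \<le> W" by (simp add: W_def abs_le_iff)
          then show ?thesis using M(2)[OF s'] M(1) by (intro mult_left_mono mult_mono) auto
        qed
        finally show ?thesis by simp
      qed
      have 3: "- 2 * (\<nu> + (A s)\<^sup>2) * (r s * w s) \<le> (K + M\<^sup>2) * W"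
      proof -
        have "(A s)\<^sup>2 \<le> M\<^sup>2" using M(2)[OF s'] by (metis abs_ge_zero power2_abs power_mono)
        then have a: "\<bar>\<nu> + (A s)\<^sup>2\<bar> \<le> K + M\<^sup>2"
          using \<nu> zero_le_power2[of "A s"] unfolding K_def by linarith
        have "- 2 * (\<nu> + (A s)\<^sup>2) * (r s * w s) \<le> \<bar>\<nu> + (A s)\<^sup>2\<bar> * (2 * \<bar>w s * r s\<bar>)"
        proof -
          have "- 2 * (\<nu> + (A s)\<^sup>2) * (r s * w s) = 2 * - ((\<nu> + (A s)\<^sup>2) * (w s * r s))" by (simp add: algebra_simps)
          also have "\<dots> \<le> 2 * \<bar>(\<nu> + (A s)\<^sup>2) * (w s * r s)\<bar>" by (intro mult_left_mono abs_ge_minus_self) simp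
          finally show ?thesis by (simp add: abs_mult)
        qed
        also have "\<dots> \<le> (K + M\<^sup>2) * W"
          using a W(3) by (intro mult_mono) (auto simp: K_def)
        finally show ?thesis .
      qed
      have 4: "- 2 * (r s * ((\<nu> - \<mu>) * u s)) \<le> W + D"
      proof -
        have "0 \<le> (r s + (\<nu> - \<mu>) * u s)\<^sup>2" by simp
        then have "- 2 * (r s * ((\<nu> - \<mu>) * u s)) \<le> (r s)\<^sup>2 + (\<nu> - \<mu>)\<^sup>2 * (u s)\<^sup>2"
          by (simp add: power2_eq_square algebra_simps)
        moreover have "(u s)\<^sup>2 \<le> Y\<^sup>2" using Y(2)[OF s'] by (metis abs_ge_zero power2_abs power_mono)
        ultimately show ?thesis using W(2) mult_left_mono[of "(u s)\<^sup>2" "Y\<^sup>2" "(\<nu> - \<mu>)\<^sup>2"] by (simp add: D_def)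
      qed
      have "E' s = 2 * (w s * r s) + 2 * A s * ((r s)\<^sup>2 - (w s)\<^sup>2) + - 2 * (\<nu> + (A s)\<^sup>2) * (r s * w s) + - 2 * (r s * ((\<nu> - \<mu>) * u s))"
        by (simp add: E'_def power2_eq_square algebra_simps)
      also have "\<dots> \<le> W + 2 * M * W + (K + M\<^sup>2) * W + (W + D)" using 1 2 3 4 by linarith
      also have "\<dots> = C * W + D" by (simp add: C_def algebra_simps)
      finally show "E' s \<le> C * ((w s)\<^sup>2 + (r s)\<^sup>2) + D" by (simp add: W_def)
    qed (rule C)
    also have "\<dots> \<le> D * S * exp (C * S)"
      using t C by (intro mult_mono iffD2[OF exp_le_cancel_iff] mult_left_mono) (auto simp: D_def)
    also have "\<dots> \<le> (\<nu> - \<mu>)\<^sup>2 * Q" by (simp add: D_def Q_def algebra_simps)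
    also have "\<dots> < e\<^sup>2"
    proof -
      have "\<bar>\<nu> - \<mu>\<bar> * sqrt Q < e" using \<nu> Q by (simp add: field_simps)
      then have "(\<bar>\<nu> - \<mu>\<bar> * sqrt Q)\<^sup>2 < e\<^sup>2" using Q by (intro power_strict_mono) auto
      then show ?thesis using Q by (simp add: power_mult_distrib)
    qed
    finally have "(w t)\<^sup>2 + (r t)\<^sup>2 < e\<^sup>2" .
    then have "(w t)\<^sup>2 < e\<^sup>2" "(r t)\<^sup>2 < e\<^sup>2" using zero_le_power2[of "r t"] zero_le_power2[of "w t"] by linarith+
    then have "\<bar>w t\<bar>\<^sup>2 < e\<^sup>2" "\<bar>r t\<bar>\<^sup>2 < e\<^sup>2" by simp_all
    then have "\<bar>w t\<bar> < e" "\<bar>r t\<bar> < e" using e by (meson less_imp_le power2_less_imp_less)+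
    then show "\<bar>v t - u t\<bar> < e \<and> \<bar>q t - p t\<bar> < e" by (simp add: w_def r_def)
  qed
qed

text \<open>If \<open>A\<close> is the primitive of an even coefficient about \<open>S / 2\<close>, then \<open>A(S - t) = A(S) - A(t)\<close>, and \<open>u(S - t)\<close>
  solves the same system. Its quasi-derivative carries the extra term \<open>B u\<close> because \<open>A\<close> is anchored at \<open>0\<close>.\<close>

lemma reg_sol_reflect:
  assumes sol: "reg_sol A (\<lambda>_. \<mu>) S u p"
    and A: "\<And>t. t \<in> {0..S} \<Longrightarrow> A (S - t) = B - A t"
  shows "reg_sol A (\<lambda>_. \<mu>) S (\<lambda>t. u (S - t)) (\<lambda>t. - p (S - t) + B * u (S - t))"
  unfolding reg_sol_def
proof (intro ballI conjI)
  fix t assume t: "t \<in> {0..S}"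
  then have t': "S - t \<in> {0..S}" by auto
  have im: "(\<lambda>t. S - t) ` {0..S} = {0..S}" by (auto simp: image_iff intro!: bexI[of _ "S - _"])
  have r: "((\<lambda>t. f (S - t)) has_real_derivative - D) (at t within {0..S})"
    if "(f has_real_derivative D) (at (S - t) within {0..S})" for f D
  proof -
    have "((\<lambda>t. S - t) has_real_derivative 0 - 1) (at t within {0..S})"
      by (rule DERIV_diff[OF DERIV_const DERIV_ident])
    then show ?thesis
      using DERIV_image_chain[of f D "\<lambda>t. S - t" t "{0..S}" "- 1"] that im by (simp add: o_def)
  qed
  have du: "((\<lambda>t. u (S - t)) has_real_derivative - (p (S - t) - A (S - t) * u (S - t))) (at t within {0..S})"
    by (rule r[OF reg_solD(1)[OF sol t']])
  have dp: "((\<lambda>t. p (S - t)) has_real_derivative - (A (S - t) * p (S - t) - (\<mu> + (A (S - t))\<^sup>2) * u (S - t))) (at t within {0..S})"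
    by (rule r[OF reg_solD(2)[OF sol t']])
  show "((\<lambda>t. u (S - t)) has_real_derivative (- p (S - t) + B * u (S - t)) - A t * u (S - t)) (at t within {0..S})"
    using du by (simp add: A[OF t] algebra_simps)
  show "((\<lambda>t. - p (S - t) + B * u (S - t)) has_real_derivative
      A t * (- p (S - t) + B * u (S - t)) - (\<mu> + (A t)\<^sup>2) * u (S - t)) (at t within {0..S})"
    using DERIV_add[OF DERIV_minus[OF dp] DERIV_cmult[OF du, of B]]
    by (simp add: A[OF t] algebra_simps power2_eq_square)
qed

section \<open>Sturm comparison\<close>

lemma positive_start:
  assumes S: "0 < S" and sol: "reg_sol A \<Lambda> S u p"
    and init: "u 0 > 0 \<or> u 0 = 0 \<and> p 0 > 0"
  obtains d where "0 < d" "d \<le> S" "\<And>t. t \<in> {0<..<d} \<Longrightarrow> u t > 0"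
proof -
  have "\<exists>d>0. \<forall>t\<in>{0..S}. 0 < t \<and> t < d \<longrightarrow> u t > 0"
  proof (cases "u 0 > 0")
    case True
    have "continuous (at 0 within {0..S}) u"
      using reg_sol_continuous(1)[OF sol] S by (simp add: continuous_on_eq_continuous_within)
    then have "(u \<longlongrightarrow> u 0) (at 0 within {0..S})" by (simp add: continuous_within)
    then have "\<forall>\<^sub>F t in at 0 within {0..S}. u t > 0" using True by (rule order_tendstoD)
    then show ?thesis unfolding eventually_at by (auto simp: dist_real_def)
  next
    case False
    then have "u 0 = 0" "p 0 > 0" using init by auto
    then have "(u has_real_derivative p 0) (at 0 within {0..S})"
      using reg_solD(1)[OF sol, of 0] S by simp
    from has_real_derivative_pos_inc_right[OF this \<open>p 0 > 0\<close>]
    show ?thesis using \<open>u 0 = 0\<close> by auto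
  qed
  then obtain d where "d > 0" "\<And>t. t \<in> {0..S} \<Longrightarrow> 0 < t \<Longrightarrow> t < d \<Longrightarrow> u t > 0" by blast
  then show thesis using S by (intro that[of "min d S"]) auto
qed

lemma first_nonpositive_point:
  fixes u :: "real \<Rightarrow> real"
  assumes cu: "continuous_on {0..S} u" and d: "0 < d" "\<And>t. t \<in> {0<..<d} \<Longrightarrow> u t > 0"
    and ex: "\<exists>t\<in>{0<..S}. u t \<le> 0"
  obtains c where "c \<in> {0<..S}" "u c = 0" "\<And>t. t \<in> {0<..<c} \<Longrightarrow> u t > 0"
proof -
  define K where "K = {d/2..S} \<inter> u -` {..0}"
  have "closed K" unfolding K_def
    using d by (intro continuous_closed_preimage continuous_on_subset[OF cu]) auto
  then have "compact K" unfolding K_def by (auto intro: compact_Int_closed simp: compact_eq_bounded_closed bounded_Int)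
  moreover have "K \<noteq> {}"
  proof -
    obtain t where t: "t \<in> {0<..S}" "u t \<le> 0" using ex by blast
    then have "\<not> t < d" using d(2)[of t] by auto
    then have "t \<in> K" using t d by (auto simp: K_def)
    then show ?thesis by blast
  qed
  ultimately obtain c where c: "c \<in> K" "\<And>t. t \<in> K \<Longrightarrow> c \<le> t"
    using continuous_attains_inf[of K "\<lambda>t. t"] by auto
  have pos: "u t > 0" if "t \<in> {0<..<c}" for t
    using d(2)[of t] c(2)[of t] c(1) that d(1) by (cases "t < d") (force simp: K_def)+
  have cS: "c \<in> {0<..S}" "u c \<le> 0" using c(1) d(1) by (auto simp: K_def)
  have "u c \<ge> 0"
  proof (rule ccontr)
    assume "\<not> u c \<ge> 0"
    then have "u c < 0" by simp
    then obtain x where x: "c/2 \<le> x" "x \<le> c" "u x = 0"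
      using IVT2'[of u c 0 "c/2"] pos[of "c/2"] cS continuous_on_subset[OF cu, of "{c/2..c}"] by auto
    then have "x < c" using \<open>u c < 0\<close> by (cases "x = c") auto
    then show False using pos[of x] x cS by auto
  qed
  then show thesis using that[OF cS(1) _ pos] cS by simp
qed

lemma nonpos_deriv_at_zero:
  fixes u :: "real \<Rightarrow> real"
  assumes "0 < c" "c \<le> S" and der: "(u has_real_derivative l) (at c within {0..S})"
    and "u c = 0" and "\<And>t. t \<in> {0<..<c} \<Longrightarrow> u t \<ge> 0"
  shows "l \<le> 0"
proof (rule ccontr)
  assume "\<not> l \<le> 0"
  then obtain d where d: "d > 0" "\<And>h. h > 0 \<Longrightarrow> c - h \<in> {0..S} \<Longrightarrow> h < d \<Longrightarrow> u (c - h) < u c"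
    using has_real_derivative_pos_inc_left[OF der] by auto
  define h where "h = min (c/2) (d/2)"
  have "u (c - h) < u c" using d assms(1,2) by (intro d(2)) (auto simp: h_def)
  moreover have "u (c - h) \<ge> 0" using assms(1) d(1) by (intro assms(5)) (auto simp: h_def min_def)
  ultimately show False using assms(4) by simp
qed

lemma wronskian_less:
  assumes "reg_sol A \<Lambda>1 S u1 p1" "reg_sol A \<Lambda>2 S u2 p2" and c: "0 < c" "c \<le> S"
    and \<Lambda>: "\<And>t. t \<in> {0..S} \<Longrightarrow> \<Lambda>1 t < \<Lambda>2 t"
    and pos: "\<And>t. t \<in> {0<..<c} \<Longrightarrow> u1 t > 0" "\<And>t. t \<in> {0<..<c} \<Longrightarrow> u2 t > 0"
  shows "u1 c * p2 c - p1 c * u2 c < u1 0 * p2 0 - p1 0 * u2 0"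
proof (rule neg_deriv_imp_less[OF c(1)])
  fix t assume "t \<in> {0..c}"
  then show "((\<lambda>t. u1 t * p2 t - p1 t * u2 t) has_real_derivative (\<Lambda>1 t - \<Lambda>2 t) * (u1 t * u2 t)) (at t within {0..c})"
    using wronskian_has_derivative[OF assms(1,2), of t] c by (auto intro: has_field_derivative_subset)
next
  fix t assume t: "t \<in> {0<..<c}"
  then show "(\<Lambda>1 t - \<Lambda>2 t) * (u1 t * u2 t) < 0"
    using \<Lambda>[of t] pos[OF t] c by (intro mult_neg_pos) auto
qed

text \<open>Up to the first zero \<open>c\<close> of \<open>u\<^sub>1\<close> the Wronskian decreases strictly from a nonpositive value, whereas at \<open>c\<close> it
  would be \<open>- u\<^sub>1'(c) u\<^sub>2(c) \<ge> 0\<close>. So there is no such zero.\<close>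

lemma sturm_comparison:
  assumes S: "0 < S" and 1: "reg_sol A \<Lambda>1 S u1 p1" and 2: "reg_sol A \<Lambda>2 S u2 p2"
    and \<Lambda>: "\<And>t. t \<in> {0..S} \<Longrightarrow> \<Lambda>1 t < \<Lambda>2 t"
    and pos: "\<And>t. t \<in> {0<..S} \<Longrightarrow> u2 t > 0"
    and init: "u1 0 > 0 \<or> u1 0 = 0 \<and> p1 0 > 0" "u1 0 * p2 0 - p1 0 * u2 0 \<le> 0"
  shows "\<forall>t\<in>{0<..S}. u1 t > 0" "u1 S * p2 S - p1 S * u2 S < 0"
proof -
  show pos1: "\<forall>t\<in>{0<..S}. u1 t > 0"
  proof (rule ccontr)
    assume "\<not> ?thesis"
    then have ex: "\<exists>t\<in>{0<..S}. u1 t \<le> 0" by force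
    obtain d where d: "0 < d" "\<And>t. t \<in> {0<..<d} \<Longrightarrow> u1 t > 0"
      using positive_start[OF S 1 init(1)] by blast
    obtain c where c: "c \<in> {0<..S}" "u1 c = 0" "\<And>t. t \<in> {0<..<c} \<Longrightarrow> u1 t > 0"
      using first_nonpositive_point[OF reg_sol_continuous(1)[OF 1] d ex] by blast
    have "p1 c \<le> 0"
      using nonpos_deriv_at_zero[of c S u1 "p1 c"] reg_solD(1)[OF 1, of c] c by (auto intro: less_imp_le)
    moreover have "u1 c * p2 c - p1 c * u2 c < u1 0 * p2 0 - p1 0 * u2 0"
      using c pos by (intro wronskian_less[OF 1 2 _ _ \<Lambda>]) auto
    ultimately show False
      using c pos[of c] init(2) mult_nonpos_nonneg[of "p1 c" "u2 c"] by (auto simp: less_imp_le)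
  qed
  show "u1 S * p2 S - p1 S * u2 S < 0"
    using wronskian_less[OF 1 2 S order_refl \<Lambda>] pos1 pos init(2) by fastforce
qed

text \<open>For a positive solution the Riccati variable \<open>z = p / u\<close> satisfies \<open>z' = - \<mu> - (z - A)\<^sup>2\<close>, so for large \<open>\<mu>\<close> it
  would have to run from \<open>\<infinity>\<close> to \<open>- \<infinity>\<close> within a time shorter than \<open>S / 2\<close>. The function
  \<open>arctan (z / \<kappa>)\<close> measures this: its slope is at most \<open>- \<kappa> / 2\<close>, while its range has length \<open>\<pi>\<close>.\<close>

lemma positive_solution_bound:
  assumes S: "0 < S" and A: "continuous_on {0..S} A"
  obtains B where "\<And>\<mu> u p. reg_sol A (\<lambda>_. \<mu>) S u p \<Longrightarrow> (\<And>t. t \<in> {0<..S} \<Longrightarrow> u t > 0) \<Longrightarrow> \<mu> \<le> B"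
proof -
  obtain M where M: "M > 0" "\<And>t. t \<in> {0..S} \<Longrightarrow> \<bar>A t\<bar> \<le> M"
    using continuous_on_Icc_bounded[OF A] by blast
  \<comment> \<open>Above this bound \<open>\<kappa> > 4 \<pi> / S\<close>, so \<open>arctan\<close> would drop by more than \<open>\<pi>\<close> on \<open>[S/2, S]\<close>.\<close>
  show thesis
  proof (rule that[of "M\<^sup>2 + 8 * pi\<^sup>2 / S\<^sup>2"], rule ccontr)
    fix \<mu> u p assume sol: "reg_sol A (\<lambda>_. \<mu>) S u p" and pos: "\<And>t. t \<in> {0<..S} \<Longrightarrow> u t > 0"
      and "\<not> \<mu> \<le> M\<^sup>2 + 8 * pi\<^sup>2 / S\<^sup>2"
    then have \<mu>: "\<mu> - M\<^sup>2 > 8 * pi\<^sup>2 / S\<^sup>2" by simp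
    define \<kappa> where "\<kappa> = sqrt (2 * (\<mu> - M\<^sup>2))"
    have "(4 * pi / S)\<^sup>2 < 2 * (\<mu> - M\<^sup>2)" using \<mu> by (simp add: power_divide power_mult_distrib)
    moreover have "0 \<le> 2 * (\<mu> - M\<^sup>2)"
      using calculation by (meson less_imp_le order_trans zero_le_power2)
    ultimately have \<kappa>: "\<kappa> > 4 * pi / S" "\<kappa>\<^sup>2 = 2 * (\<mu> - M\<^sup>2)"
      unfolding \<kappa>_def by (auto intro: real_less_rsqrt simp del: right_diff_distrib_numeral)
    have \<kappa>0: "\<kappa> > 0" 
    proof -
      have "4 * pi / S > 0" using S by simp
      then show ?thesis using \<kappa>(1) by linarith
    qed
    define z where "z t = p t / u t" for t
    define \<theta> where "\<theta> t = arctan (z t / \<kappa>) + \<kappa> / 2 * t" for t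
    have "\<theta> S \<le> \<theta> (S / 2)"
    proof (rule nonpos_deriv_imp_le[where f = \<theta> and a = "S / 2" and b = S])
      show "S / 2 \<le> S" using S by simp
      fix t assume t: "t \<in> {S/2..S}"
      then have t': "t \<in> {0..S}" "u t > 0" using S pos[of t] by auto
      have pz: "p t = z t * u t" using t'(2) by (simp add: z_def)
      have "(A t * p t - (\<mu> + (A t)\<^sup>2) * u t) * u t - p t * (p t - A t * u t) = (- \<mu> - (z t - A t)\<^sup>2) * (u t * u t)"
        unfolding pz by (simp add: power2_eq_square algebra_simps)
      then have "((A t * p t - (\<mu> + (A t)\<^sup>2) * u t) * u t - p t * (p t - A t * u t)) / (u t * u t) = - \<mu> - (z t - A t)\<^sup>2"
        using t'(2) by simp
      then have "(z has_real_derivative - \<mu> - (z t - A t)\<^sup>2) (at t within {0..S})"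
        using DERIV_divide[OF reg_solD(2,1)[OF sol t'(1)]] t'(2) unfolding z_def by simp
      then have dz: "(z has_real_derivative - \<mu> - (z t - A t)\<^sup>2) (at t within {S/2..S})"
        using S by (auto intro: has_field_derivative_subset)
      show "(\<theta> has_real_derivative (- \<mu> - (z t - A t)\<^sup>2) / \<kappa> / (1 + (z t / \<kappa>)\<^sup>2) + \<kappa> / 2) (at t within {S/2..S})"
      proof -
        have "((\<lambda>t. arctan (z t / \<kappa>)) has_real_derivative inverse (1 + (z t / \<kappa>)\<^sup>2) * ((- \<mu> - (z t - A t)\<^sup>2) / \<kappa>)) (at t within {S/2..S})"
          by (rule DERIV_chain2[OF DERIV_arctan DERIV_cdivide[OF dz]])
        then have "((\<lambda>t. arctan (z t / \<kappa>)) has_real_derivative (- \<mu> - (z t - A t)\<^sup>2) / \<kappa> / (1 + (z t / \<kappa>)\<^sup>2)) (at t within {S/2..S})"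
          by (simp only: divide_inverse mult.commute mult.left_commute mult.assoc)
        then show ?thesis
          unfolding \<theta>_def by (rule DERIV_add[OF _ DERIV_cmult_Id])
      qed
    next
      fix t assume t: "t \<in> {S/2<..<S}"
      have "0 \<le> (z t - 2 * A t)\<^sup>2" by simp
      moreover have "(A t)\<^sup>2 \<le> M\<^sup>2" 
      proof -
        have "t \<in> {0..S}" using t S by auto
        then show ?thesis using power_mono[OF M(2), of t 2] by simp
      qed
      ultimately have "(z t - A t)\<^sup>2 \<ge> (z t)\<^sup>2 / 2 - M\<^sup>2" by (simp add: power2_eq_square algebra_simps)
      then have "- \<mu> - (z t - A t)\<^sup>2 \<le> - (\<kappa>\<^sup>2 + (z t)\<^sup>2) / 2" using \<kappa>(2) by simp
      then have "(- \<mu> - (z t - A t)\<^sup>2) / \<kappa> / (1 + (z t / \<kappa>)\<^sup>2) \<le> (- (\<kappa>\<^sup>2 + (z t)\<^sup>2) / 2) / \<kappa> / (1 + (z t / \<kappa>)\<^sup>2)"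
        using \<kappa>0 by (intro divide_right_mono) auto
      also have "\<dots> = - \<kappa> / 2"
      proof -
        define q where "q = 1 + (z t / \<kappa>)\<^sup>2"
        have q: "q > 0" by (simp add: q_def add_pos_nonneg)
        have "\<kappa>\<^sup>2 + (z t)\<^sup>2 = \<kappa> * \<kappa> * q" using \<kappa>0 by (simp add: q_def power_divide power2_eq_square field_simps)
        then show ?thesis unfolding q_def[symmetric] using \<kappa>0 q by simp
      qed
      finally show "(- \<mu> - (z t - A t)\<^sup>2) / \<kappa> / (1 + (z t / \<kappa>)\<^sup>2) + \<kappa> / 2 \<le> 0" by simp
    qed
    moreover have "\<kappa> / 2 * (S / 2) > pi" using \<kappa>(1) S by (simp add: field_simps)
    moreover have "\<kappa> / 2 * S = \<kappa> / 2 * (S / 2) + \<kappa> / 2 * (S / 2)" by simp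
    ultimately show False
      unfolding \<theta>_def using arctan_bounded[of "z S / \<kappa>"] arctan_bounded[of "z (S/2) / \<kappa>"] by linarith
  qed
qed

text \<open>The derivative of \<open>v / u\<close> is the constant Wronskian divided by \<open>u\<^sup>2\<close>, so \<open>v / u\<close> does not increase towards the
  right end, where it is positive.\<close>

lemma positive_by_ratio:
  assumes u: "reg_sol A \<Lambda> S u p" and v: "reg_sol A \<Lambda> S v r" and t: "t \<in> {0..S}"
    and pos: "\<And>s. s \<in> {t..S} \<Longrightarrow> u s > 0" and vS: "v S > 0" and W: "u S * r S - p S * v S \<le> 0"
  shows "v t > 0"
proof -
  have "v S / u S \<le> v t / u t"
  proof (rule nonpos_deriv_imp_le[where f = "\<lambda>s. v s / u s" and a = t and b = S])
    show "t \<le> S" using t by simp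
    fix s assume s: "s \<in> {t..S}"
    then have s': "s \<in> {0..S}" using t by auto
    have "((\<lambda>s. v s / u s) has_real_derivative
        ((r s - A s * v s) * u s - v s * (p s - A s * u s)) / (u s * u s)) (at s within {0..S})"
      using pos[OF s] by (intro DERIV_divide reg_solD(1)[OF u s'] reg_solD(1)[OF v s']) simp
    moreover have "(r s - A s * v s) * u s - v s * (p s - A s * u s) = u S * r S - p S * v S"
      using wronskian_constant[OF u v s', of S] t by (simp add: algebra_simps)
    ultimately show "((\<lambda>s. v s / u s) has_real_derivative (u S * r S - p S * v S) / (u s * u s)) (at s within {t..S})"
      using t by (auto intro: has_field_derivative_subset)
  next
    fix s assume "s \<in> {t<..<S}"
    then show "(u S * r S - p S * v S) / (u s * u s) \<le> 0"
      using W pos[of s] by (intro divide_nonpos_pos) auto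
  qed
  moreover have "v S / u S > 0" using vS pos[of S] t by simp
  ultimately have "v t / u t > 0" by linarith
  then show ?thesis using pos[of t] t by (simp add: zero_less_divide_iff)
qed

lemma nonneg_at_endpoints:
  fixes f :: "real \<Rightarrow> real"
  assumes "0 < S" "continuous_on {0..S} f" "\<And>t. t \<in> {0<..<S} \<Longrightarrow> f t > 0"
  shows "f S \<ge> 0" "f 0 \<ge> 0"
proof -
  have c: "continuous_on (closure {0<..<S}) f" using assms(1,2) by simp
  have "f x \<in> {0..}" if "x \<in> {0..S}" for x
    by (rule image_closure_subset[OF c, of "{0..}", THEN subsetD])
      (use assms that in \<open>auto intro: less_imp_le\<close>)
  then show "f S \<ge> 0" "f 0 \<ge> 0" using assms(1) by auto
qed

section \<open>First eigenvalues by shooting\<close>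

text \<open>For every \<open>\<mu>\<close>, \<open>(y \<mu>, z \<mu>)\<close> is the solution with fixed initial data \<open>(c0, c1)\<close>. The boundary condition at
  \<open>S\<close> is the vanishing of \<open>b0 y(S) + b1 z(S)\<close>: the case \<open>b1 = 0\<close> is a Dirichlet condition, and \<open>b1 = 1\<close> with
  \<open>b0 = - A(S)\<close> is a Neumann condition, since \<open>z - A y\<close> is the derivative of \<open>y\<close>. The sign conditions make
  \<open>y\<close> positive to the right of \<open>0\<close> and the end value positive for very negative \<open>\<mu>\<close>.\<close>

locale shooting =
  fixes A :: "real \<Rightarrow> real" and S c0 c1 b0 b1 :: real and y z :: "real \<Rightarrow> real \<Rightarrow> real"
  assumes S: "0 < S" and A: "continuous_on {0..S} A"
    and left: "c0 \<ge> 0" "c1 \<ge> 0" "c0 + c1 > 0" and right: "b1 > 0 \<or> b1 = 0 \<and> b0 > 0"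
    and sol: "\<And>\<mu>. reg_sol A (\<lambda>_. \<mu>) S (y \<mu>) (z \<mu>)"
    and init [simp]: "\<And>\<mu>. y \<mu> 0 = c0" "\<And>\<mu>. z \<mu> 0 = c1"
begin

definition end_value :: "real \<Rightarrow> real" where "end_value \<mu> = b0 * y \<mu> S + b1 * z \<mu> S"

definition subcritical :: "real set" where
  "subcritical = {\<mu>. (\<forall>t\<in>{0<..S}. y \<mu> t > 0) \<and> end_value \<mu> > 0}"

lemma left': "c0 > 0 \<or> c0 = 0 \<and> c1 > 0" using left by linarith

lemma nontrivial: "\<not> (y \<mu> t = 0 \<and> z \<mu> t = 0)" if "t \<in> {0..S}"
proof
  assume "y \<mu> t = 0 \<and> z \<mu> t = 0"
  moreover have "reg_sol A (\<lambda>_. \<mu>) S (\<lambda>_. 0) (\<lambda>_. 0)" by (simp add: reg_sol_def)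
  ultimately have "y \<mu> 0 = 0 \<and> z \<mu> 0 = 0"
    using reg_sol_unique[OF A sol[of \<mu>], where s = t and t = 0 and v = "\<lambda>_. 0" and q = "\<lambda>_. 0"] that S by auto
  then show False using left by simp
qed

lemma subcritical_downward:
  assumes "\<mu> \<in> subcritical" "\<nu> < \<mu>"
  shows "\<nu> \<in> subcritical"
proof -
  have pos: "\<And>t. t \<in> {0<..S} \<Longrightarrow> y \<mu> t > 0" and l: "end_value \<mu> > 0" using assms(1) by (auto simp: subcritical_def)
  have cmp: "\<forall>t\<in>{0<..S}. y \<nu> t > 0" "y \<nu> S * z \<mu> S - z \<nu> S * y \<mu> S < 0"
    using sturm_comparison[OF S sol[of \<nu>] sol[of \<mu>] _ pos] assms(2) left' by auto
  have "end_value \<nu> * y \<mu> S = end_value \<mu> * y \<nu> S - b1 * (y \<nu> S * z \<mu> S - z \<nu> S * y \<mu> S)"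
    by (simp add: end_value_def algebra_simps)
  moreover have "b1 * (y \<nu> S * z \<mu> S - z \<nu> S * y \<mu> S) \<le> 0"
    using right cmp(2) by (auto simp: mult_nonneg_nonpos)
  moreover have "end_value \<mu> * y \<nu> S > 0" using l cmp(1) S by auto
  ultimately have "end_value \<nu> * y \<mu> S > 0" by linarith
  then have "end_value \<nu> > 0" using pos[of S] S by (simp add: zero_less_mult_iff)
  then show ?thesis using cmp(1) by (simp add: subcritical_def)
qed

text \<open>An explicit positive comparison function: \<open>w = exp (\<integral> (C t - A))\<close> has quasi-derivative \<open>C t w\<close> and solves the system
  with the variable parameter \<open>- C - (C t - A)\<^sup>2\<close>, which is bounded below. The constant \<open>C\<close> is chosen so that
  \<open>w\<close> has a positive end value; any constant parameter below that bound inherits this by comparison.\<close>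

lemma subcritical_nonempty: "subcritical \<noteq> {}"
proof -
  obtain M where M: "M > 0" "\<And>t. t \<in> {0..S} \<Longrightarrow> \<bar>A t\<bar> \<le> M"
    using continuous_on_Icc_bounded[OF A] by blast
  obtain C where C: "C \<ge> 0" "b0 + b1 * (C * S) > 0"
  proof (cases "b1 > 0")
    case True
    then have "b1 * ((\<bar>b0\<bar> + 1) / (b1 * S) * S) = \<bar>b0\<bar> + 1" using S by simp
    then have "b0 + b1 * ((\<bar>b0\<bar> + 1) / (b1 * S) * S) > 0" by simp
    then show thesis using True S by (intro that[of "(\<bar>b0\<bar> + 1) / (b1 * S)"]) auto
  next
    case False then show thesis using right by (intro that[of 0]) auto
  qed
  define w where "w t = exp (integral {0..t} (\<lambda>s. C * s - A s))" for t
  define \<kappa> where "\<kappa> t = - C - (C * t - A t)\<^sup>2" for t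
  define \<mu> where "\<mu> = - C - (C * S + M)\<^sup>2 - 1"
  have W: "reg_sol A \<kappa> S w (\<lambda>t. C * t * w t)"
    unfolding reg_sol_def
  proof (intro ballI conjI)
    fix t assume t: "t \<in> {0..S}"
    have "((\<lambda>t. integral {0..t} (\<lambda>s. C * s - A s)) has_real_derivative C * t - A t) (at t within {0..S})"
      by (intro integral_has_real_derivative[OF _ t] continuous_intros A)
    then have dw: "(w has_real_derivative w t * (C * t - A t)) (at t within {0..S})"
      unfolding w_def by (auto intro!: derivative_eq_intros)
    then show "((\<lambda>t. C * t * w t) has_real_derivative A t * (C * t * w t) - (\<kappa> t + (A t)\<^sup>2) * w t) (at t within {0..S})"
      by (auto intro!: derivative_eq_intros simp: \<kappa>_def power2_eq_square algebra_simps)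
    show "(w has_real_derivative C * t * w t - A t * w t) (at t within {0..S})"
      using dw by (simp add: algebra_simps)
  qed
  have lt: "\<mu> < \<kappa> t" if "t \<in> {0..S}" for t
  proof -
    have "\<bar>C * t\<bar> \<le> C * S" using C(1) that by (simp add: abs_mult mult_left_mono)
    then have "\<bar>C * t - A t\<bar> \<le> C * S + M" using M(2)[OF that] by linarith
    then have "(C * t - A t)\<^sup>2 \<le> (C * S + M)\<^sup>2" by (metis abs_ge_zero power2_abs power_mono)
    then show ?thesis by (simp add: \<mu>_def \<kappa>_def)
  qed
  have wpos: "w t > 0" for t by (simp add: w_def)
  have cmp: "\<forall>t\<in>{0<..S}. y \<mu> t > 0" "y \<mu> S * (C * S * w S) - z \<mu> S * w S < 0"
    using sturm_comparison[OF S sol[of \<mu>] W lt wpos] left left' wpos[of 0] by auto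
  have "end_value \<mu> * w S = (b0 + b1 * (C * S)) * (y \<mu> S * w S) - b1 * (y \<mu> S * (C * S * w S) - z \<mu> S * w S)"
    by (simp add: end_value_def algebra_simps)
  moreover have "b1 * (y \<mu> S * (C * S * w S) - z \<mu> S * w S) \<le> 0"
    using right cmp(2) by (auto simp: mult_nonneg_nonpos)
  moreover have "(b0 + b1 * (C * S)) * (y \<mu> S * w S) > 0"
    using cmp(1) C(2) wpos[of S] S by simp
  ultimately have "end_value \<mu> * w S > 0" by linarith
  then have "end_value \<mu> > 0" using wpos[of S] by (simp add: zero_less_mult_iff)
  then have "\<mu> \<in> subcritical" using cmp(1) by (simp add: subcritical_def)
  then show ?thesis by blast
qed

lemma subcritical_bdd_above: "bdd_above subcritical"
proof -
  obtain B where B: "\<And>\<mu> u p. reg_sol A (\<lambda>_. \<mu>) S u p \<Longrightarrow> (\<And>t. t \<in> {0<..S} \<Longrightarrow> u t > 0) \<Longrightarrow> \<mu> \<le> B"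
    using positive_solution_bound[OF S A] by blast
  show ?thesis
    by (rule bdd_aboveI[of _ B]) (use B[OF sol] in \<open>auto simp: subcritical_def\<close>)
qed

abbreviation near :: "real \<Rightarrow> real \<Rightarrow> real \<Rightarrow> real \<Rightarrow> bool" where
  "near \<nu> \<mu> e t \<equiv> \<bar>y \<nu> t - y \<mu> t\<bar> < e \<and> \<bar>z \<nu> t - z \<mu> t\<bar> < e"

lemma close_parameter:
  assumes "e > 0"
  obtains \<delta> where "\<delta> > 0" "\<And>\<nu> t. \<bar>\<nu> - \<mu>\<bar> < \<delta> \<Longrightarrow> t \<in> {0..S} \<Longrightarrow> near \<nu> \<mu> e t"
proof (rule reg_sol_continuous_parameter[OF _ A assms sol[of \<mu>]])
  show "0 \<le> S" using S by simp
  fix \<delta> assume "\<delta> > 0" "\<And>\<nu> v q t. \<bar>\<nu> - \<mu>\<bar> < \<delta> \<Longrightarrow> reg_sol A (\<lambda>_. \<nu>) S v q \<Longrightarrow> v 0 = y \<mu> 0 \<Longrightarrow> q 0 = z \<mu> 0 \<Longrightarrow> t \<in> {0..S} \<Longrightarrow>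
       \<bar>v t - y \<mu> t\<bar> < e \<and> \<bar>q t - z \<mu> t\<bar> < e"
  then show thesis using sol init by (intro that[of \<delta>]) (assumption, metis)
qed

lemma end_value_close:
  assumes "\<bar>y \<nu> S - y \<mu> S\<bar> < e / (\<bar>b0\<bar> + \<bar>b1\<bar>)" "\<bar>z \<nu> S - z \<mu> S\<bar> < e / (\<bar>b0\<bar> + \<bar>b1\<bar>)"
  shows "\<bar>end_value \<nu> - end_value \<mu>\<bar> \<le> e"
proof -
  have b: "\<bar>b0\<bar> + \<bar>b1\<bar> > 0" using right by auto
  have "end_value \<nu> - end_value \<mu> = b0 * (y \<nu> S - y \<mu> S) + b1 * (z \<nu> S - z \<mu> S)" by (simp add: end_value_def algebra_simps)
  also have "\<bar>\<dots>\<bar> \<le> \<bar>b0\<bar> * \<bar>y \<nu> S - y \<mu> S\<bar> + \<bar>b1\<bar> * \<bar>z \<nu> S - z \<mu> S\<bar>"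
    by (metis abs_mult abs_triangle_ineq)
  also have "\<dots> \<le> \<bar>b0\<bar> * (e / (\<bar>b0\<bar> + \<bar>b1\<bar>)) + \<bar>b1\<bar> * (e / (\<bar>b0\<bar> + \<bar>b1\<bar>))"
    using assms by (intro add_mono mult_left_mono) auto
  also have "\<dots> = (\<bar>b0\<bar> + \<bar>b1\<bar>) * (e / (\<bar>b0\<bar> + \<bar>b1\<bar>))" by (simp only: distrib_right)
  also have "\<dots> = e" using b by simp
  finally show ?thesis .
qed

text \<open>Uniform closeness alone does not preserve positivity near \<open>0\<close> when \<open>y(0) = 0\<close>; there closeness of the derivatives
  is used.\<close>

lemma positive_near_zero_stable:
  obtains d e where "0 < d" "d \<le> S" "0 < e"
    "\<And>\<nu> t. (\<And>t. t \<in> {0..S} \<Longrightarrow> near \<nu> \<mu> e t) \<Longrightarrow> t \<in> {0<..<d} \<Longrightarrow> y \<nu> t > 0"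
proof -
  note cy = reg_sol_continuous(1)[OF sol] and cz = reg_sol_continuous(2)[OF sol]
  have near: "\<exists>d>0. d \<le> S \<and> (\<forall>t\<in>{0<..<d}. g t > g 0 / 2)" if "continuous_on {0..S} g" "g 0 > 0" for g :: "real \<Rightarrow> real"
  proof -
    have "(g \<longlongrightarrow> g 0) (at 0 within {0..S})"
      using that(1) S by (simp add: continuous_on_def)
    then have "\<forall>\<^sub>F t in at 0 within {0..S}. g t > g 0 / 2" using that(2) by (intro order_tendstoD) auto
    then obtain d where "d > 0" "\<And>t. t \<in> {0..S} \<Longrightarrow> t \<noteq> 0 \<Longrightarrow> dist t 0 < d \<Longrightarrow> g t > g 0 / 2"
      unfolding eventually_at by auto
    then show ?thesis using S by (intro exI[of _ "min d S"]) (auto simp: dist_real_def)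
  qed
  show thesis
  proof (cases "c0 > 0")
    case True
    then obtain d where d: "d > 0" "d \<le> S" "\<And>t. t \<in> {0<..<d} \<Longrightarrow> y \<mu> t > c0 / 2"
      using near[OF cy[of \<mu>]] by auto
    show thesis
    proof (rule that[of d "c0 / 2"])
      fix \<nu> t assume close: "\<And>t. t \<in> {0..S} \<Longrightarrow> near \<nu> \<mu> (c0 / 2) t" and t: "t \<in> {0<..<d}"
      have "\<bar>y \<nu> t - y \<mu> t\<bar> < c0 / 2" using close[of t] t d(2) by auto
      then show "y \<nu> t > 0" using d(3)[OF t] by linarith
    qed (use d True in auto)
  next
    case False
    then have c: "c0 = 0" "c1 > 0" using left by auto
    obtain M where M: "M > 0" "\<And>t. t \<in> {0..S} \<Longrightarrow> \<bar>A t\<bar> \<le> M"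
      using continuous_on_Icc_bounded[OF A] by blast
    have "continuous_on {0..S} (\<lambda>t. z \<mu> t - A t * y \<mu> t)" by (intro continuous_intros A cy cz)
    from near[OF this] obtain d where d: "d > 0" "d \<le> S" "\<And>t. t \<in> {0<..<d} \<Longrightarrow> z \<mu> t - A t * y \<mu> t > c1 / 2"
      using c by auto
    define e where "e = c1 / (2 * (1 + M))"
    have e: "e > 0" using c M by (simp add: e_def)
    have "k * (c1 / (2 * k)) = c1 / 2" if "k > 0" for k using that by simp
    from this[of "1 + M"] M have "(1 + M) * e = c1 / 2" by (simp add: e_def del: distrib_left_numeral)
    then have e: "e > 0" "e + M * e = c1 / 2" using e by (simp_all add: distrib_right)
    show thesis
    proof (rule that[of d e])
      fix \<nu> t assume close: "\<And>t. t \<in> {0..S} \<Longrightarrow> near \<nu> \<mu> e t" and t: "t \<in> {0<..<d}"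
      have "- y \<nu> t < - y \<nu> 0"
      proof (rule neg_deriv_imp_less[where f = "\<lambda>s. - y \<nu> s" and a = 0 and b = t])
        show "0 < t" using t by simp
        fix s assume s: "s \<in> {0..t}"
        have "((\<lambda>s. - y \<nu> s) has_real_derivative - (z \<nu> s - A s * y \<nu> s)) (at s within {0..S})"
          using DERIV_minus[OF reg_solD(1)[OF sol, of s]] s t d(2) by auto
        then show "((\<lambda>s. - y \<nu> s) has_real_derivative - (z \<nu> s - A s * y \<nu> s)) (at s within {0..t})"
          using t d(2) by (auto intro: has_field_derivative_subset)
      next
        fix s assume s: "s \<in> {0<..<t}"
        then have s': "s \<in> {0..S}" "s \<in> {0<..<d}" using t d(2) by auto
        have "\<bar>A s * (y \<nu> s - y \<mu> s)\<bar> \<le> M * e"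
          unfolding abs_mult using M s' close[of s] by (intro mult_mono) auto
        moreover have "A s * (y \<nu> s - y \<mu> s) = A s * y \<nu> s - A s * y \<mu> s" by (simp add: algebra_simps)
        ultimately show "- (z \<nu> s - A s * y \<nu> s) < 0"
          using d(3)[OF s'(2)] close[OF s'(1)] e(2) by linarith
      qed
      then show "y \<nu> t > 0" using c by simp
    qed (use d e in auto)
  qed
qed

lemma subcritical_open:
  assumes "\<mu> \<in> subcritical"
  obtains \<delta> where "\<delta> > 0" "\<And>\<nu>. \<bar>\<nu> - \<mu>\<bar> < \<delta> \<Longrightarrow> \<nu> \<in> subcritical"
proof -
  have pos: "\<And>t. t \<in> {0<..S} \<Longrightarrow> y \<mu> t > 0" and l: "end_value \<mu> > 0" using assms by (auto simp: subcritical_def)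
  obtain d e where d: "0 < d" "d \<le> S" and e: "0 < e"
    and near: "\<And>\<nu> t. (\<And>t. t \<in> {0..S} \<Longrightarrow> near \<nu> \<mu> e t) \<Longrightarrow> t \<in> {0<..<d} \<Longrightarrow> y \<nu> t > 0"
    using positive_near_zero_stable[of \<mu>] by metis
  have "continuous_on {d/2..S} (y \<mu>)"
    using d by (intro continuous_on_subset[OF reg_sol_continuous(1)[OF sol]]) auto
  then obtain x where x: "x \<in> {d/2..S}" "\<And>t. t \<in> {d/2..S} \<Longrightarrow> y \<mu> x \<le> y \<mu> t"
    using continuous_attains_inf[of "{d/2..S}" "y \<mu>"] d by auto
  have m: "y \<mu> x > 0" using x(1) d by (intro pos) auto
  have b: "\<bar>b0\<bar> + \<bar>b1\<bar> > 0" using right by auto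
  define \<epsilon> where "\<epsilon> = min e (min (y \<mu> x) (end_value \<mu> / 2 / (\<bar>b0\<bar> + \<bar>b1\<bar>)))"
  have "\<epsilon> > 0" using e m l b by (simp add: \<epsilon>_def)
  then obtain \<delta> where \<delta>: "\<delta> > 0" "\<And>\<nu> t. \<bar>\<nu> - \<mu>\<bar> < \<delta> \<Longrightarrow> t \<in> {0..S} \<Longrightarrow> near \<nu> \<mu> \<epsilon> t"
    using close_parameter[of \<epsilon> \<mu>] by blast
  show thesis
  proof (rule that[OF \<delta>(1)])
    fix \<nu> assume \<nu>: "\<bar>\<nu> - \<mu>\<bar> < \<delta>"
    note c = \<delta>(2)[OF \<nu>]
    have "y \<nu> t > 0" if t: "t \<in> {0<..S}" for t
    proof (cases "t < d")
      case True
      show ?thesis by (rule near) (use c t True in \<open>auto simp: \<epsilon>_def\<close>)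
    next
      case False
      then have "y \<mu> x \<le> y \<mu> t" using t d by (intro x) auto
      moreover have "\<bar>y \<nu> t - y \<mu> t\<bar> < y \<mu> x" using c[of t] t by (simp add: \<epsilon>_def)
      ultimately show ?thesis by linarith
    qed
    moreover have "\<bar>end_value \<nu> - end_value \<mu>\<bar> \<le> end_value \<mu> / 2"
      using c[of S] S by (intro end_value_close) (auto simp: \<epsilon>_def)
    then have "end_value \<nu> > 0" using l by linarith
    ultimately show "\<nu> \<in> subcritical" by (simp add: subcritical_def)
  qed
qed

text \<open>The end point of the half-line of subcritical parameters, which turns out to be the first eigenvalue.\<close>

definition critical :: real where "critical = Sup subcritical"

lemma less_critical: "\<mu> < critical \<Longrightarrow> \<mu> \<in> subcritical"
  unfolding critical_def
  using less_cSup_iff[OF subcritical_nonempty subcritical_bdd_above] subcritical_downward by blast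

lemma critical_not_subcritical: "critical \<notin> subcritical"
proof
  assume "critical \<in> subcritical"
  then obtain \<delta> where "\<delta> > 0" "\<And>\<nu>. \<bar>\<nu> - critical\<bar> < \<delta> \<Longrightarrow> \<nu> \<in> subcritical"
    using subcritical_open by blast
  then have "critical + \<delta> / 2 \<in> subcritical" "\<delta> > 0" by auto
  then show False using cSup_upper[OF _ subcritical_bdd_above] unfolding critical_def by force
qed

lemma subcritical_iff: "\<mu> \<in> subcritical \<longleftrightarrow> \<mu> < critical"
  using less_critical[of \<mu>] critical_not_subcritical subcritical_downward[of \<mu> critical]
  by (cases \<mu> critical rule: linorder_cases) auto

lemma critical_nonneg:
  shows "t \<in> {0..S} \<Longrightarrow> y critical t \<ge> 0" "end_value critical \<ge> 0"
proof -
  show "y critical t \<ge> 0" if t: "t \<in> {0..S}" for t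
  proof (rule ccontr)
    assume n: "\<not> ?thesis"
    then have "t \<noteq> 0" using left by auto
    obtain \<delta> where \<delta>: "\<delta> > 0" "\<And>\<nu> s. \<bar>\<nu> - critical\<bar> < \<delta> \<Longrightarrow> s \<in> {0..S} \<Longrightarrow> near \<nu> critical (- y critical t) s"
      using close_parameter[of "- y critical t" critical] n by auto
    have "critical - \<delta> / 2 \<in> subcritical" using \<delta>(1) by (intro less_critical) simp
    then have "y (critical - \<delta> / 2) t > 0" using t \<open>t \<noteq> 0\<close> by (simp add: subcritical_def)
    then show False using \<delta>(2)[of "critical - \<delta> / 2" t] \<delta>(1) t by auto
  qed
  show "end_value critical \<ge> 0"
  proof (rule ccontr)
    assume n: "\<not> ?thesis"
    have b: "\<bar>b0\<bar> + \<bar>b1\<bar> > 0" using right by auto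
    define \<epsilon> where "\<epsilon> = (- end_value critical) / (\<bar>b0\<bar> + \<bar>b1\<bar>)"
    have "\<epsilon> > 0" using n b unfolding \<epsilon>_def by (intro divide_pos_pos) auto
    then obtain \<delta> where \<delta>: "\<delta> > 0" "\<And>\<nu> s. \<bar>\<nu> - critical\<bar> < \<delta> \<Longrightarrow> s \<in> {0..S} \<Longrightarrow> near \<nu> critical \<epsilon> s"
      using close_parameter[of \<epsilon> critical] by auto
    have "critical - \<delta> / 2 \<in> subcritical" using \<delta>(1) by (intro less_critical) simp
    then have "end_value (critical - \<delta> / 2) > 0" by (simp add: subcritical_def)
    moreover have "\<bar>end_value (critical - \<delta> / 2) - end_value critical\<bar> \<le> - end_value critical"
      using \<delta>(2)[of "critical - \<delta> / 2" S] \<delta>(1) S by (intro end_value_close) (auto simp: \<epsilon>_def)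
    ultimately show False by linarith
  qed
qed

text \<open>At an end point with \<open>y = 0\<close> the quasi-derivative \<open>z\<close> is the derivative of \<open>y\<close>, which cannot vanish for a nontrivial
  solution.\<close>

lemma endpoint_slope:
  assumes "\<And>t. t \<in> {0<..<S} \<Longrightarrow> y \<mu> t \<ge> 0" "y \<mu> S = 0"
  shows "z \<mu> S < 0"
proof -
  have "(y \<mu> has_real_derivative z \<mu> S) (at S within {0..S})"
    using reg_solD(1)[OF sol, of S \<mu>] assms(2) S by simp
  then have "z \<mu> S \<le> 0" using nonpos_deriv_at_zero[where c = S and S = S and u = "y \<mu>"] assms S by blast
  then show ?thesis using nontrivial[of S \<mu>] assms(2) S by force
qed

text \<open>An interior zero of a nonnegative solution would be a double zero.\<close>

lemma critical_pos: "t \<in> {0<..<S} \<Longrightarrow> y critical t > 0"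
proof (rule ccontr)
  assume t: "t \<in> {0<..<S}" and "\<not> y critical t > 0"
  then have 0: "y critical t = 0" using critical_nonneg(1)[of t] by auto
  have der: "(y critical has_real_derivative z critical t) (at t within {0..S})"
    using reg_solD(1)[OF sol, of t critical] 0 t by simp
  have "z critical t \<le> 0"
    using nonpos_deriv_at_zero[OF _ _ der 0] critical_nonneg(1) t by auto
  moreover have "\<not> z critical t < 0"
  proof
    assume "z critical t < 0"
    from has_real_derivative_neg_dec_right[OF der this]
    obtain d where d: "d > 0" "\<And>h. h > 0 \<Longrightarrow> t + h \<in> {0..S} \<Longrightarrow> h < d \<Longrightarrow> y critical t > y critical (t + h)" by auto
    define h where "h = min (d / 2) (S - t)"
    have "h > 0" "t + h \<in> {0..S}" "h < d" using d t by (auto simp: h_def)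
    then show False using d(2)[of h] critical_nonneg(1)[of "t + h"] 0 by simp
  qed
  ultimately show False using nontrivial[of t critical] 0 t by auto
qed

text \<open>A positive end value would make \<open>critical\<close> itself subcritical, contradicting openness.\<close>

lemma end_value_critical: "end_value critical = 0"
proof (rule ccontr)
  assume "end_value critical \<noteq> 0"
  then have l: "end_value critical > 0" using critical_nonneg(2) by simp
  have "y critical S \<noteq> 0"
  proof
    assume 0: "y critical S = 0"
    then have "z critical S < 0" using endpoint_slope critical_pos by (meson less_imp_le)
    then have "end_value critical \<le> 0" using 0 right by (auto simp: end_value_def mult_nonneg_nonpos)
    then show False using l by simp
  qed
  then have "y critical S > 0" using critical_nonneg(1)[of S] S by auto
  then have "y critical t > 0" if "t \<in> {0<..S}" for t
    using critical_pos[of t] that by (cases "t = S") auto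
  then show False using l critical_not_subcritical by (simp add: subcritical_def)
qed

lemma critical_endpoint_pos: "b1 > 0 \<Longrightarrow> y critical S > 0"
  using critical_nonneg(1)[of S] end_value_critical nontrivial[of S critical] S
  by (cases "y critical S = 0") (auto simp: end_value_def)

text \<open>The Wronskian of the critical solution and \<open>y \<mu>\<close> starts at \<open>0\<close> and decreases strictly as long as both are
  positive; its value at \<open>S\<close> is the end value of \<open>y \<mu>\<close> up to a positive factor.\<close>

lemma supercritical_end_value:
  assumes "\<mu> > critical" and pos: "\<And>t. t \<in> {0<..<S} \<Longrightarrow> y \<mu> t > 0"
  shows "end_value \<mu> < 0"
proof -
  have W: "y critical S * z \<mu> S - z critical S * y \<mu> S < 0"
    using wronskian_less[OF sol[of critical] sol[of \<mu>] S order_refl] assms critical_pos by simp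
  show ?thesis
  proof (cases "b1 > 0")
    case True
    have "end_value \<mu> * y critical S - end_value critical * y \<mu> S = b1 * (y critical S * z \<mu> S - z critical S * y \<mu> S)"
      by (simp add: end_value_def algebra_simps)
    then have "end_value \<mu> * y critical S < 0" using W True end_value_critical by (simp add: mult_pos_neg)
    then show ?thesis using critical_endpoint_pos[OF True] by (simp add: mult_less_0_iff)
  next
    case False
    then have b: "b1 = 0" "b0 > 0" using right by auto
    have "b0 * y critical S + b1 * z critical S = 0" using end_value_critical by (simp add: end_value_def)
    moreover have "b1 * z critical S = 0" using b(1) mult_eq_0_iff by blast
    ultimately have 0: "y critical S = 0" using b(2) by simp
    then have "z critical S < 0" using endpoint_slope critical_pos by (meson less_imp_le)
    moreover have "z critical S * y \<mu> S > 0" using W 0 by simp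
    ultimately have "y \<mu> S < 0" by (simp add: zero_less_mult_iff)
    then have "b0 * y \<mu> S < 0" using b(2) by (simp add: mult_pos_neg)
    moreover have "b1 * z \<mu> S = 0" using b(1) mult_eq_0_iff by blast
    ultimately show ?thesis unfolding end_value_def by linarith
  qed
qed

lemma critical_least: "end_value \<mu> = 0 \<Longrightarrow> critical \<le> \<mu>"
  using less_critical[of \<mu>] by (cases "critical \<le> \<mu>") (auto simp: subcritical_def)

end

section \<open>Weak solutions and the regularized equation\<close>

lemma deriv_on_eq:
  assumes "c < d" "t \<in> {c..d}" "(u has_real_derivative l) (at t within {c..d})"
  shows "deriv_on c d u t = l"
  unfolding deriv_on_def
  by (rule vector_derivative_within_closed_interval[OF assms(1,2)])
     (use assms(3) in \<open>simp add: has_real_derivative_iff_has_vector_derivative\<close>)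

text \<open>The pair of a solution and its derivative, without boundary conditions. Carrying the derivative \<open>v\<close> as an explicit
  function avoids one-sided derivative operators.\<close>

definition weak_sol :: "(real \<Rightarrow> real) \<Rightarrow> real \<Rightarrow> (real \<Rightarrow> real) \<Rightarrow> (real \<Rightarrow> real) \<Rightarrow> (real \<Rightarrow> real) \<Rightarrow> bool" where
  "weak_sol q S \<sigma> u v \<longleftrightarrow>
     (\<forall>t\<in>{0..S}. (u has_real_derivative v t) (at t within {0..S})) \<and>
     continuous_on {0..S} v \<and> abs_continuous_on 0 S v \<and>
     (\<exists>N. negligible N \<and> (\<forall>t\<in>{0..S} - N. (v has_real_derivative \<sigma> t - q t * u t) (at t within {0..S})))"

lemma weak_solD:
  assumes "weak_sol q S \<sigma> u v"
  shows "t \<in> {0..S} \<Longrightarrow> (u has_real_derivative v t) (at t within {0..S})"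
    and "continuous_on {0..S} v" "abs_continuous_on 0 S v" "continuous_on {0..S} u" "abs_continuous_on 0 S u"
    and "\<exists>N. negligible N \<and> (\<forall>t\<in>{0..S} - N. (v has_real_derivative \<sigma> t - q t * u t) (at t within {0..S}))"
proof -
  show 1: "t \<in> {0..S} \<Longrightarrow> (u has_real_derivative v t) (at t within {0..S})"
    and 2: "continuous_on {0..S} v" "abs_continuous_on 0 S v"
    and "\<exists>N. negligible N \<and> (\<forall>t\<in>{0..S} - N. (v has_real_derivative \<sigma> t - q t * u t) (at t within {0..S}))" for t
    using assms unfolding weak_sol_def by simp_all
  show "continuous_on {0..S} u" by (rule DERIV_continuous_on[OF 1])
  show "abs_continuous_on 0 S u" by (rule abs_continuous_on_C1[OF 1 2(1)])
qed

lemma weak_sol_cong: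
  assumes "weak_sol q S \<sigma> u v" "\<And>t. t \<in> {0..S} \<Longrightarrow> u t = u' t"
  shows "weak_sol q S \<sigma> u' v"
proof -
  have *: "(u' has_real_derivative l) (at t within {0..S})" if "(u has_real_derivative l) (at t within {0..S})" "t \<in> {0..S}" for t l
    using that(1) unfolding has_field_derivative_def
    by (rule has_derivative_transform[OF that(2), rotated]) (use assms(2) in auto)
  obtain N where N: "negligible N" "\<And>t. t \<in> {0..S} - N \<Longrightarrow> (v has_real_derivative \<sigma> t - q t * u t) (at t within {0..S})"
    using assms(1) unfolding weak_sol_def by blast
  show ?thesis
    unfolding weak_sol_def
  proof (intro conjI ballI exI[of _ N])
    show "(u' has_real_derivative v t) (at t within {0..S})" if "t \<in> {0..S}" for t
      using *[OF _ that] assms(1) that unfolding weak_sol_def by blast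
    show "(v has_real_derivative \<sigma> t - q t * u' t) (at t within {0..S})" if "t \<in> {0..S} - N" for t
      using N(2)[OF that] assms(2)[of t] that by simp
  qed (use assms(1) N in \<open>simp_all add: weak_sol_def\<close>)
qed

lemma weak_sol_lincomb:
  assumes 1: "weak_sol q S \<sigma> u v" and 2: "weak_sol q S \<tau> u' v'"
  shows "weak_sol q S (\<lambda>t. a * \<sigma> t + b * \<tau> t) (\<lambda>t. a * u t + b * u' t) (\<lambda>t. a * v t + b * v' t)"
proof -
  obtain N1 N2 where N1: "negligible N1" "\<And>t. t \<in> {0..S} - N1 \<Longrightarrow> (v has_real_derivative \<sigma> t - q t * u t) (at t within {0..S})"
    and N2: "negligible N2" "\<And>t. t \<in> {0..S} - N2 \<Longrightarrow> (v' has_real_derivative \<tau> t - q t * u' t) (at t within {0..S})"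
    using weak_solD(6)[OF 1] weak_solD(6)[OF 2] by blast
  show ?thesis
    unfolding weak_sol_def
  proof (intro conjI ballI exI[of _ "N1 \<union> N2"])
    show "((\<lambda>t. a * u t + b * u' t) has_real_derivative a * v t + b * v' t) (at t within {0..S})" if "t \<in> {0..S}" for t
      by (intro DERIV_add DERIV_cmult weak_solD(1)[OF 1 that] weak_solD(1)[OF 2 that])
    show "continuous_on {0..S} (\<lambda>t. a * v t + b * v' t)"
      by (intro continuous_intros weak_solD(2)[OF 1] weak_solD(2)[OF 2])
    show "abs_continuous_on 0 S (\<lambda>t. a * v t + b * v' t)"
      by (intro abs_continuous_on_add abs_continuous_on_cmult weak_solD(3)[OF 1] weak_solD(3)[OF 2])
    show "negligible (N1 \<union> N2)" using N1 N2 by auto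
    fix t assume t: "t \<in> {0..S} - (N1 \<union> N2)"
    then have "((\<lambda>t. a * v t + b * v' t) has_real_derivative a * (\<sigma> t - q t * u t) + b * (\<tau> t - q t * u' t)) (at t within {0..S})"
      by (intro DERIV_add DERIV_cmult N1(2) N2(2)) auto
    then show "((\<lambda>t. a * v t + b * v' t) has_real_derivative a * \<sigma> t + b * \<tau> t - q t * (a * u t + b * u' t)) (at t within {0..S})"
      by (simp add: algebra_simps)
  qed
qed

lemma weak_sol_deriv_on:
  assumes "0 < S" "weak_sol q S \<sigma> u v" "t \<in> {0..S}"
  shows "deriv_on 0 S u t = v t"
  using deriv_on_eq[OF assms(1,3) weak_solD(1)[OF assms(2,3)]] .

lemma solves_iff_weak_sol:
  assumes S: "0 < S"
  shows "solves B q S \<sigma> u \<longleftrightarrow> (\<exists>v. weak_sol q S \<sigma> u v) \<and> satisfies_bc B S u"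
proof
  assume sol: "solves B q S \<sigma> u"
  define v where "v = deriv_on 0 S u"
  let ?eq = "\<lambda>t. \<exists>w. (v has_real_derivative w) (at t within {0..S}) \<and> w + q t * u t = \<sigma> t"
  have W: "u \<in> W21 0 S" and bc: "satisfies_bc B S u"
    and ae: "AE t\<in>{0..S} in lebesgue. ?eq t"
    using sol unfolding solves_def v_def by blast+
  obtain N where N: "N \<in> null_sets lebesgue"
    "{t \<in> space lebesgue. \<not> (t \<in> {0..S} \<longrightarrow> ?eq t)} \<subseteq> N"
    by (rule AE_E[OF ae]) (blast intro: null_setsI)
  have "weak_sol q S \<sigma> u v"
    unfolding weak_sol_def
  proof (intro conjI ballI exI[of _ N])
    show "(u has_real_derivative v t) (at t within {0..S})" if "t \<in> {0..S}" for t
    proof -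
      have "u differentiable (at t within {0..S})"
        using W that by (simp add: W21_def differentiable_on_def)
      then show ?thesis
        unfolding v_def deriv_on_def has_real_derivative_iff_has_vector_derivative
        by (rule vector_derivative_works[THEN iffD1])
    qed
    show "continuous_on {0..S} v" "abs_continuous_on 0 S v" using W unfolding W21_def v_def by blast+
    show "negligible N" using N(1) by (simp add: negligible_iff_null_sets)
    fix t assume t: "t \<in> {0..S} - N"
    then have "?eq t"
      using N(2) by auto
    then obtain w where w: "(v has_real_derivative w) (at t within {0..S})" "w + q t * u t = \<sigma> t"
      by blast
    from w(2) have "w = \<sigma> t - q t * u t" by linarith
    with w(1) show "(v has_real_derivative \<sigma> t - q t * u t) (at t within {0..S})" by simp
  qed
  then show "(\<exists>v. weak_sol q S \<sigma> u v) \<and> satisfies_bc B S u" using bc by blast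
next
  assume "(\<exists>v. weak_sol q S \<sigma> u v) \<and> satisfies_bc B S u"
  then obtain v where v: "weak_sol q S \<sigma> u v" and bc: "satisfies_bc B S u" by blast
  have eq: "deriv_on 0 S u t = v t" if "t \<in> {0..S}" for t by (rule weak_sol_deriv_on[OF S v that])
  have 1: "u differentiable_on {0..S}"
    unfolding differentiable_on_def
  proof
    fix t assume "t \<in> {0..S}"
    then have "(u has_derivative (*) (v t)) (at t within {0..S})"
      using weak_solD(1)[OF v] by (simp add: has_field_derivative_def)
    then show "u differentiable (at t within {0..S})" by (rule differentiableI)
  qed
  have 2: "continuous_on {0..S} (deriv_on 0 S u)"
    by (rule continuous_on_cong[OF refl eq, THEN iffD2, OF _ weak_solD(2)[OF v]])
  have 3: "abs_continuous_on 0 S (deriv_on 0 S u)"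
    by (rule abs_continuous_on_cong[OF eq, THEN iffD2, OF _ weak_solD(3)[OF v]])
  have W: "u \<in> W21 0 S" unfolding W21_def by (intro CollectI conjI 1 2 3)
  obtain N where N: "negligible N" "\<And>t. t \<in> {0..S} - N \<Longrightarrow> (v has_real_derivative \<sigma> t - q t * u t) (at t within {0..S})"
    using weak_solD(6)[OF v] by blast
  let ?eq = "\<lambda>t. \<exists>w. (deriv_on 0 S u has_real_derivative w) (at t within {0..S}) \<and> w + q t * u t = \<sigma> t"
  have ex: "?eq t"
    if "t \<notin> N" "t \<in> {0..S}" for t
  proof -
    have "(v has_real_derivative \<sigma> t - q t * u t) (at t within {0..S})" using N(2)[of t] that by blast
    then have "(deriv_on 0 S u has_real_derivative \<sigma> t - q t * u t) (at t within {0..S})"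
      unfolding has_field_derivative_def
      by (rule has_derivative_transform[OF \<open>t \<in> {0..S}\<close> eq, rotated])
    then show "?eq t"
      by (intro exI conjI) (assumption, simp)
  qed
  have "N \<in> null_sets lebesgue" using N(1) by (simp add: negligible_iff_null_sets)
  then have ae: "AE t\<in>{0..S} in lebesgue. ?eq t"
    by (rule AE_I') (use ex in blast)
  show "solves B q S \<sigma> u" unfolding solves_def by (intro conjI W bc ae)
qed

text \<open>From the almost everywhere equation, \<open>p = v + A u\<close> is absolutely continuous with almost everywhere derivative
  \<open>A v - \<mu> u\<close>: the rough terms \<open>q u\<close> cancel. This function is continuous, so \<open>p\<close> is continuously differentiable.\<close>

lemma weak_sol_reg_sol:
  assumes q: "q absolutely_integrable_on {0..S}" and A: "\<And>t. A t = integral {0..t} q"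
  shows "weak_sol (\<lambda>t. q t + \<mu>) S (\<lambda>_. 0) u v \<Longrightarrow> reg_sol A (\<lambda>_. \<mu>) S u (\<lambda>t. v t + A t * u t)"
    and "reg_sol A (\<lambda>_. \<mu>) S u p \<Longrightarrow> weak_sol (\<lambda>t. q t + \<mu>) S (\<lambda>_. 0) u (\<lambda>t. p t - A t * u t)"
proof -
  have qi: "q integrable_on {0..S}" using q by (simp add: absolutely_integrable_on_def)
  have Aeq: "A = (\<lambda>t. integral {0..t} q)" using A by auto
  have cA: "continuous_on {0..S} A" unfolding Aeq by (rule indefinite_integral_continuous_1[OF qi])
  have acA: "abs_continuous_on 0 S A" unfolding Aeq by (rule abs_continuous_on_integral[OF q])
  obtain N where N: "negligible N" "\<And>t. t \<in> {0..S} - N \<Longrightarrow> (A has_real_derivative q t) (at t within {0..S})"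
    using indefinite_integral_has_derivative_ae[OF qi] unfolding Aeq by blast
  show "reg_sol A (\<lambda>_. \<mu>) S u (\<lambda>t. v t + A t * u t)" if w: "weak_sol (\<lambda>t. q t + \<mu>) S (\<lambda>_. 0) u v"
  proof -
    obtain N' where N': "negligible N'" "\<And>t. t \<in> {0..S} - N' \<Longrightarrow> (v has_real_derivative 0 - (q t + \<mu>) * u t) (at t within {0..S})"
      using weak_solD(6)[OF w] by blast
    have "((\<lambda>t. v t + A t * u t) has_real_derivative A t * v t - \<mu> * u t) (at t within {0..S})" if t: "t \<in> {0..S}" for t
    proof (rule abs_continuous_on_imp_C1[OF _ _ _ _ t, of _ "N \<union> N'"])
      show "abs_continuous_on 0 S (\<lambda>t. v t + A t * u t)"
        by (intro abs_continuous_on_add abs_continuous_on_mult acA cA weak_solD[OF w])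
      show "negligible (N \<union> N')" using N N' by auto
      show "continuous_on {0..S} (\<lambda>t. A t * v t - \<mu> * u t)" by (intro continuous_intros cA weak_solD[OF w])
      fix t assume t: "t \<in> {0..S} - (N \<union> N')"
      have "((\<lambda>t. v t + A t * u t) has_real_derivative (0 - (q t + \<mu>) * u t) + (q t * u t + v t * A t)) (at t within {0..S})"
        using t by (intro DERIV_add DERIV_mult N(2) N'(2) weak_solD(1)[OF w]) auto
      then show "((\<lambda>t. v t + A t * u t) has_real_derivative A t * v t - \<mu> * u t) (at t within {0..S})"
        by (simp add: algebra_simps)
    qed
    then show ?thesis
      using weak_solD(1)[OF w] by (auto simp: reg_sol_def algebra_simps power2_eq_square)
  qed
  show "weak_sol (\<lambda>t. q t + \<mu>) S (\<lambda>_. 0) u (\<lambda>t. p t - A t * u t)" if r: "reg_sol A (\<lambda>_. \<mu>) S u p"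
    unfolding weak_sol_def
  proof (intro conjI ballI exI[of _ N])
    note cu = reg_sol_continuous[OF r]
    show "(u has_real_derivative p t - A t * u t) (at t within {0..S})" if "t \<in> {0..S}" for t
      using reg_solD(1)[OF r that] .
    show "continuous_on {0..S} (\<lambda>t. p t - A t * u t)" by (intro continuous_intros cA cu)
    have "abs_continuous_on 0 S p"
      by (rule abs_continuous_on_C1[OF reg_solD(2)[OF r]]) (auto intro!: continuous_intros cA cu)
    moreover have "abs_continuous_on 0 S u"
      by (rule abs_continuous_on_C1[OF reg_solD(1)[OF r]]) (auto intro!: continuous_intros cA cu)
    ultimately show "abs_continuous_on 0 S (\<lambda>t. p t - A t * u t)"
      by (intro abs_continuous_on_diff abs_continuous_on_mult acA cA cu)
    show "negligible N" by (rule N)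
    fix t assume t: "t \<in> {0..S} - N"
    then have "((\<lambda>t. p t - A t * u t) has_real_derivative (A t * p t - (\<mu> + (A t)\<^sup>2) * u t) - (q t * u t + (p t - A t * u t) * A t)) (at t within {0..S})"
      by (intro DERIV_diff DERIV_mult N(2) reg_solD[OF r]) auto
    then show "((\<lambda>t. p t - A t * u t) has_real_derivative 0 - (q t + \<mu>) * u t) (at t within {0..S})"
      by (simp add: algebra_simps power2_eq_square)
  qed
qed

section \<open>Green's functions\<close>

lemma absolutely_integrable_continuous_mult:
  fixes f g :: "real \<Rightarrow> real"
  assumes "continuous_on {c..d} f" "g absolutely_integrable_on {c..d}"
  shows "(\<lambda>x. f x * g x) absolutely_integrable_on {c..d}"
proof (rule absolutely_integrable_bounded_measurable_product_real[OF _ _ _ assms(2)])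
  show "f \<in> borel_measurable (lebesgue_on {c..d})"
    using assms(1) by (rule continuous_imp_measurable_on_sets_lebesgue) simp
  show "bounded (f ` {c..d})" using assms(1) by (intro compact_imp_bounded compact_continuous_image) auto
qed simp

text \<open>The particular solution with zero initial data.\<close>

lemma variation_of_constants:
  assumes 1: "weak_sol q S (\<lambda>_. 0) \<phi> \<phi>'" and 2: "weak_sol q S (\<lambda>_. 0) \<psi> \<psi>'"
    and W: "\<And>t. t \<in> {0..S} \<Longrightarrow> \<phi> t * \<psi>' t - \<phi>' t * \<psi> t = 1"
    and \<sigma>: "\<sigma> absolutely_integrable_on {0..S}"
    and F: "\<And>t. F t = integral {0..t} (\<lambda>s. \<phi> s * \<sigma> s)" and H: "\<And>t. H t = integral {0..t} (\<lambda>s. \<psi> s * \<sigma> s)"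
  shows "weak_sol q S \<sigma> (\<lambda>t. \<psi> t * F t - \<phi> t * H t) (\<lambda>t. \<psi>' t * F t - \<phi>' t * H t)"
proof -
  have fs: "(\<lambda>s. \<phi> s * \<sigma> s) absolutely_integrable_on {0..S}" and hs: "(\<lambda>s. \<psi> s * \<sigma> s) absolutely_integrable_on {0..S}"
    using absolutely_integrable_continuous_mult[OF _ \<sigma>] weak_solD(4)[OF 1] weak_solD(4)[OF 2] by auto
  have Feq: "F = (\<lambda>t. integral {0..t} (\<lambda>s. \<phi> s * \<sigma> s))" and Heq: "H = (\<lambda>t. integral {0..t} (\<lambda>s. \<psi> s * \<sigma> s))" using F H by auto
  note fi = absolutely_integrable_on_def[THEN iffD1, OF fs, THEN conjunct1]
    and hi = absolutely_integrable_on_def[THEN iffD1, OF hs, THEN conjunct1]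
  have c: "continuous_on {0..S} F" "continuous_on {0..S} H"
    unfolding Feq Heq by (intro indefinite_integral_continuous_1 fi hi)+
  have ac: "abs_continuous_on 0 S F" "abs_continuous_on 0 S H"
    unfolding Feq Heq by (intro abs_continuous_on_integral fs hs)+
  obtain N1 where N1: "negligible N1" "\<And>t. t \<in> {0..S} - N1 \<Longrightarrow> (F has_real_derivative \<phi> t * \<sigma> t) (at t within {0..S})"
    using indefinite_integral_has_derivative_ae[OF fi] unfolding Feq by blast
  obtain N2 where N2: "negligible N2" "\<And>t. t \<in> {0..S} - N2 \<Longrightarrow> (H has_real_derivative \<psi> t * \<sigma> t) (at t within {0..S})"
    using indefinite_integral_has_derivative_ae[OF hi] unfolding Heq by blast
  obtain N3 where N3: "negligible N3" "\<And>t. t \<in> {0..S} - N3 \<Longrightarrow> (\<phi>' has_real_derivative 0 - q t * \<phi> t) (at t within {0..S})"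
    using weak_solD(6)[OF 1] by blast
  obtain N4 where N4: "negligible N4" "\<And>t. t \<in> {0..S} - N4 \<Longrightarrow> (\<psi>' has_real_derivative 0 - q t * \<psi> t) (at t within {0..S})"
    using weak_solD(6)[OF 2] by blast
  define N where "N = N1 \<union> N2 \<union> N3 \<union> N4"
  show ?thesis
    unfolding weak_sol_def
  proof (intro conjI ballI exI[of _ N])
    show neg: "negligible N" using N1 N2 N3 N4 by (auto simp: N_def)
    show cv: "continuous_on {0..S} (\<lambda>t. \<psi>' t * F t - \<phi>' t * H t)"
      by (intro continuous_intros c weak_solD[OF 1] weak_solD[OF 2])
    show "abs_continuous_on 0 S (\<lambda>t. \<psi>' t * F t - \<phi>' t * H t)"
      by (intro abs_continuous_on_diff abs_continuous_on_mult c ac weak_solD[OF 1] weak_solD[OF 2])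
    show "((\<lambda>t. \<psi> t * F t - \<phi> t * H t) has_real_derivative \<psi>' t * F t - \<phi>' t * H t) (at t within {0..S})" if t: "t \<in> {0..S}" for t
    proof (rule abs_continuous_on_imp_C1[OF _ neg _ cv t])
      show "abs_continuous_on 0 S (\<lambda>t. \<psi> t * F t - \<phi> t * H t)"
        by (intro abs_continuous_on_diff abs_continuous_on_mult c ac weak_solD[OF 1] weak_solD[OF 2])
      fix t assume t: "t \<in> {0..S} - N"
      then have "((\<lambda>t. \<psi> t * F t - \<phi> t * H t) has_real_derivative
          (\<psi>' t * F t + (\<phi> t * \<sigma> t) * \<psi> t) - (\<phi>' t * H t + (\<psi> t * \<sigma> t) * \<phi> t)) (at t within {0..S})"
        by (intro DERIV_diff DERIV_mult N1(2) N2(2) weak_solD(1)[OF 1] weak_solD(1)[OF 2]) (auto simp: N_def)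
      then show "((\<lambda>t. \<psi> t * F t - \<phi> t * H t) has_real_derivative \<psi>' t * F t - \<phi>' t * H t) (at t within {0..S})"
        by (simp add: algebra_simps)
    qed
    fix t assume t: "t \<in> {0..S} - N"
    then have "((\<lambda>t. \<psi>' t * F t - \<phi>' t * H t) has_real_derivative
          ((0 - q t * \<psi> t) * F t + (\<phi> t * \<sigma> t) * \<psi>' t) - ((0 - q t * \<phi> t) * H t + (\<psi> t * \<sigma> t) * \<phi>' t)) (at t within {0..S})"
      by (intro DERIV_diff DERIV_mult N1(2) N2(2) N3(2) N4(2)) (auto simp: N_def)
    moreover have "((0 - q t * \<psi> t) * F t + (\<phi> t * \<sigma> t) * \<psi>' t) - ((0 - q t * \<phi> t) * H t + (\<psi> t * \<sigma> t) * \<phi>' t)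
        = (\<phi> t * \<psi>' t - \<phi>' t * \<psi> t) * \<sigma> t - q t * (\<psi> t * F t - \<phi> t * H t)"
      by (simp add: algebra_simps)
    ultimately show "((\<lambda>t. \<psi>' t * F t - \<phi>' t * H t) has_real_derivative \<sigma> t - q t * (\<psi> t * F t - \<phi> t * H t)) (at t within {0..S})"
      using W[of t] t by simp
  qed
qed

text \<open>The Green's function of any nonresonant two-point problem has this form. The first part vanishes for \<open>s \<ge> t\<close> and is the
  kernel of the initial value problem; writing it with \<open>min s t\<close> instead of a case distinction makes continuity evident.\<close>

definition kernel :: "(real \<Rightarrow> real) \<Rightarrow> (real \<Rightarrow> real) \<Rightarrow> real \<Rightarrow> real \<Rightarrow> real \<Rightarrow> real \<Rightarrow> real \<Rightarrow> real \<Rightarrow> real" where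
  "kernel \<phi> \<psi> a11 a12 a21 a22 t s =
     (\<psi> t * \<phi> (min s t) - \<phi> t * \<psi> (min s t))
     + \<phi> t * (a11 * \<phi> s + a12 * \<psi> s) + \<psi> t * (a21 * \<phi> s + a22 * \<psi> s)"

lemma kernel_integral:
  assumes c: "continuous_on {0..S} \<phi>" "continuous_on {0..S} \<psi>"
    and \<sigma>: "\<sigma> absolutely_integrable_on {0..S}" and t: "t \<in> {0..S}"
    and F: "\<And>t. F t = integral {0..t} (\<lambda>s. \<phi> s * \<sigma> s)" and H: "\<And>t. H t = integral {0..t} (\<lambda>s. \<psi> s * \<sigma> s)"
  shows "(LINT s:{0..S}|lebesgue. kernel \<phi> \<psi> a11 a12 a21 a22 t s * \<sigma> s) =
    (\<psi> t * F t - \<phi> t * H t) + ((a11 * F S + a12 * H S) * \<phi> t + (a21 * F S + a22 * H S) * \<psi> t)"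
proof -
  have fs: "(\<lambda>s. \<phi> s * \<sigma> s) absolutely_integrable_on {0..S}" and hs: "(\<lambda>s. \<psi> s * \<sigma> s) absolutely_integrable_on {0..S}"
    using absolutely_integrable_continuous_mult[OF _ \<sigma>] c by auto
  note fi = absolutely_integrable_on_def[THEN iffD1, OF fs, THEN conjunct1]
    and hi = absolutely_integrable_on_def[THEN iffD1, OF hs, THEN conjunct1]
  have cm: "continuous_on {0..S} (\<lambda>s. f (min s t))" if "continuous_on {0..S} f" for f :: "real \<Rightarrow> real"
    by (rule continuous_on_compose2[OF that]) (use t in \<open>auto intro!: continuous_intros\<close>)
  have ai: "(\<lambda>s. kernel \<phi> \<psi> a11 a12 a21 a22 t s * \<sigma> s) absolutely_integrable_on {0..S}"
    unfolding kernel_def by (intro absolutely_integrable_continuous_mult[OF _ \<sigma>] continuous_intros c cm)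
  have 1: "((\<lambda>s. \<phi> s * \<sigma> s) has_integral F r) {0..r}" "((\<lambda>s. \<psi> s * \<sigma> s) has_integral H r) {0..r}" if "r \<in> {0..S}" for r
    using that integrable_on_subinterval[OF fi, of 0 r] integrable_on_subinterval[OF hi, of 0 r]
    unfolding F H by (auto simp: integrable_integral)
  have "((\<lambda>s. \<psi> t * (\<phi> s * \<sigma> s) - \<phi> t * (\<psi> s * \<sigma> s)) has_integral \<psi> t * F t - \<phi> t * H t) {0..t}"
    by (intro has_integral_diff has_integral_mult_right 1 t)
  then have a: "((\<lambda>s. (\<psi> t * \<phi> (min s t) - \<phi> t * \<psi> (min s t)) * \<sigma> s) has_integral \<psi> t * F t - \<phi> t * H t) {0..t}"
    by (rule has_integral_eq[rotated]) (auto simp: algebra_simps min_def)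
  have "((\<lambda>s. 0) has_integral 0) {t..S}" by simp
  then have b: "((\<lambda>s. (\<psi> t * \<phi> (min s t) - \<phi> t * \<psi> (min s t)) * \<sigma> s) has_integral 0) {t..S}"
    by (rule has_integral_eq[rotated]) (auto simp: min_def)
  have ab: "((\<lambda>s. (\<psi> t * \<phi> (min s t) - \<phi> t * \<psi> (min s t)) * \<sigma> s) has_integral \<psi> t * F t - \<phi> t * H t + 0) {0..S}"
    by (rule has_integral_combine[OF _ _ a b]) (use t in auto)
  have S: "S \<in> {0..S}" using t by auto
  have "((\<lambda>s. (a11 * \<phi> t + a21 * \<psi> t) * (\<phi> s * \<sigma> s) + (a12 * \<phi> t + a22 * \<psi> t) * (\<psi> s * \<sigma> s)) has_integral
      (a11 * \<phi> t + a21 * \<psi> t) * F S + (a12 * \<phi> t + a22 * \<psi> t) * H S) {0..S}"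
    by (intro has_integral_add has_integral_mult_right 1 S)
  from has_integral_add[OF ab this]
  have "((\<lambda>s. kernel \<phi> \<psi> a11 a12 a21 a22 t s * \<sigma> s) has_integral
      (\<psi> t * F t - \<phi> t * H t) + ((a11 * F S + a12 * H S) * \<phi> t + (a21 * F S + a22 * H S) * \<psi> t)) {0..S}"
    unfolding kernel_def by (simp add: algebra_simps)
  then show ?thesis
    using set_lebesgue_integral_eq_integral(2)[OF ai] by (simp add: integral_unique)
qed

lemma kernel_continuous:
  assumes c: "continuous_on {0..S} \<phi>" "continuous_on {0..S} \<psi>"
  shows "continuous_on ({0..S} \<times> {0..S}) (\<lambda>(t, s). kernel \<phi> \<psi> a11 a12 a21 a22 t s)"
proof -
  have 1: "continuous_on ({0..S} \<times> {0..S}) (\<lambda>x. f (fst x))" "continuous_on ({0..S} \<times> {0..S}) (\<lambda>x. f (snd x))"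
    "continuous_on ({0..S} \<times> {0..S}) (\<lambda>x. f (min (snd x) (fst x)))"
    if "continuous_on {0..S} f" for f :: "real \<Rightarrow> real"
    by (rule continuous_on_compose2[OF that]; force intro!: continuous_intros)+
  show ?thesis
    unfolding kernel_def split_beta by (intro continuous_intros 1 c)
qed

lemma kernel_diagonal:
  "kernel \<phi> \<psi> (a / D) (b / D) (c / D) (d / D) t t =
    (a * (\<phi> t)\<^sup>2 + (b + c) * (\<phi> t * \<psi> t) + d * (\<psi> t)\<^sup>2) / D"
  by (simp add: kernel_def divide_inverse power2_eq_square algebra_simps)

lemma satisfies_bc_cong:
  assumes S: "0 < S" and "weak_sol q S \<sigma> u v" "\<And>t. t \<in> {0..S} \<Longrightarrow> u t = u' t" "satisfies_bc B S u"
  shows "satisfies_bc B S u'"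
proof -
  have "deriv_on 0 S u t = deriv_on 0 S u' t" if "t \<in> {0..S}" for t
    using weak_sol_deriv_on[OF S assms(2) that] weak_sol_deriv_on[OF S weak_sol_cong[OF assms(2,3)] that] by simp
  from this[of 0] this[of S] assms(3)[of 0] assms(3)[of S] show ?thesis
    using assms(4) S by (cases B) auto
qed

lemma solves_cong:
  assumes S: "0 < S" and "solves B q S \<sigma> u" "\<And>t. t \<in> {0..S} \<Longrightarrow> u t = u' t"
  shows "solves B q S \<sigma> u'"
  using assms weak_sol_cong satisfies_bc_cong unfolding solves_iff_weak_sol[OF S] by metis

lemma solves_diff:
  assumes S: "0 < S" and "solves B q S \<sigma> u" "solves B q S \<sigma> u'"
  shows "solves B q S (\<lambda>_. 0) (\<lambda>t. u t - u' t)"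
proof -
  obtain v v' where v: "weak_sol q S \<sigma> u v" "weak_sol q S \<sigma> u' v'" and bc: "satisfies_bc B S u" "satisfies_bc B S u'"
    using assms(2,3) unfolding solves_iff_weak_sol[OF S] by blast
  have w: "weak_sol q S (\<lambda>_. 0) (\<lambda>t. u t - u' t) (\<lambda>t. v t - v' t)"
    using weak_sol_lincomb[OF v, of 1 "-1"] by simp
  have d: "deriv_on 0 S (\<lambda>t. u t - u' t) t = deriv_on 0 S u t - deriv_on 0 S u' t" if "t \<in> {0..S}" for t
    using weak_sol_deriv_on[OF S w that] weak_sol_deriv_on[OF S v(1) that] weak_sol_deriv_on[OF S v(2) that] by simp
  have "satisfies_bc B S (\<lambda>t. u t - u' t)"
    using bc S by (cases B) (auto simp: d)
  then show ?thesis unfolding solves_iff_weak_sol[OF S] using w by blast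
qed

text \<open>The boundary condition has to be checked only for the boundary values of the integral; these depend on \<open>\<sigma>\<close> through
  \<open>f = \<integral> \<phi> \<sigma>\<close> and \<open>h = \<integral> \<psi> \<sigma>\<close> over the whole interval.\<close>

lemma is_green_kernel:
  assumes S: "0 < S" and 1: "weak_sol q S (\<lambda>_. 0) \<phi> \<phi>'" and 2: "weak_sol q S (\<lambda>_. 0) \<psi> \<psi>'"
    and init: "\<phi> 0 = 1" "\<phi>' 0 = 0" "\<psi> 0 = 0" "\<psi>' 0 = 1"
    and W: "\<And>t. t \<in> {0..S} \<Longrightarrow> \<phi> t * \<psi>' t - \<phi>' t * \<psi> t = 1"
    and nr: "nonresonant B q S"
    and bc: "\<And>u f h. u 0 = a11 * f + a12 * h \<Longrightarrow> deriv_on 0 S u 0 = a21 * f + a22 * h \<Longrightarrow>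
       u S = (\<psi> S * f - \<phi> S * h) + (u 0 * \<phi> S + deriv_on 0 S u 0 * \<psi> S) \<Longrightarrow>
       deriv_on 0 S u S = (\<psi>' S * f - \<phi>' S * h) + (u 0 * \<phi>' S + deriv_on 0 S u 0 * \<psi>' S) \<Longrightarrow>
       satisfies_bc B S u"
  shows "is_green B q S (kernel \<phi> \<psi> a11 a12 a21 a22)"
  unfolding is_green_def
proof (intro conjI allI impI)
  note c = weak_solD(4)[OF 1] weak_solD(4)[OF 2]
  show "continuous_on ({0..S} \<times> {0..S}) (\<lambda>(t, s). kernel \<phi> \<psi> a11 a12 a21 a22 t s)"
    by (rule kernel_continuous[OF c])
  fix \<sigma> :: "real \<Rightarrow> real" and u assume \<sigma>: "\<sigma> absolutely_integrable_on {0..S}"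
  define F where "F t = integral {0..t} (\<lambda>s. \<phi> s * \<sigma> s)" for t
  define H where "H t = integral {0..t} (\<lambda>s. \<psi> s * \<sigma> s)" for t
  define c1 c2 where "c1 = a11 * F S + a12 * H S" and "c2 = a21 * F S + a22 * H S"
  define g where "g t = (\<psi> t * F t - \<phi> t * H t) + (c1 * \<phi> t + c2 * \<psi> t)" for t
  define g' where "g' t = (\<psi>' t * F t - \<phi>' t * H t) + (c1 * \<phi>' t + c2 * \<psi>' t)" for t
  have gw: "weak_sol q S \<sigma> g g'"
    using weak_sol_lincomb[OF variation_of_constants[OF 1 2 W \<sigma> F_def H_def] weak_sol_lincomb[OF 1 2, of c1 c2], of 1 1]
    by (simp add: g_def[abs_def] g'_def[abs_def])
  have int: "(LINT s:{0..S}|lebesgue. kernel \<phi> \<psi> a11 a12 a21 a22 t s * \<sigma> s) = g t" if "t \<in> {0..S}" for t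
    unfolding g_def c1_def c2_def by (rule kernel_integral[OF c \<sigma> that F_def H_def])
  have "satisfies_bc B S g"
  proof (rule bc[of g "F S" "H S"])
    have "F 0 = 0" "H 0 = 0" by (simp_all add: F_def H_def)
    then have 0: "g 0 = c1" "deriv_on 0 S g 0 = c2"
      using init S by (simp_all add: weak_sol_deriv_on[OF S gw] g_def g'_def)
    then show "g 0 = a11 * F S + a12 * H S" "deriv_on 0 S g 0 = a21 * F S + a22 * H S"
      by (simp_all add: c1_def c2_def)
    show "g S = \<psi> S * F S - \<phi> S * H S + (g 0 * \<phi> S + deriv_on 0 S g 0 * \<psi> S)"
      unfolding 0 by (simp add: g_def)
    show "deriv_on 0 S g S = \<psi>' S * F S - \<phi>' S * H S + (g 0 * \<phi>' S + deriv_on 0 S g 0 * \<psi>' S)"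
      unfolding 0 using S by (simp add: weak_sol_deriv_on[OF S gw] g'_def)
  qed
  then have g: "solves B q S \<sigma> g" unfolding solves_iff_weak_sol[OF S] using gw by blast
  show "solves B q S \<sigma> u \<longleftrightarrow> (\<forall>t\<in>{0..S}. u t = (LINT s:{0..S}|lebesgue. kernel \<phi> \<psi> a11 a12 a21 a22 t s * \<sigma> s))"
    (is "_ \<longleftrightarrow> ?R")
  proof
    assume "solves B q S \<sigma> u"
    then have "\<forall>t\<in>{0..S}. u t - g t = 0"
      using nr solves_diff[OF S _ g] unfolding nonresonant_def by blast
    then show ?R
      using int by simp
  next
    assume ?R
    then show "solves B q S \<sigma> u" using solves_cong[OF S g] int by simp
  qed
qed

text \<open>Test the difference of two Green's functions at a fixed \<open>t\<close> against itself.\<close>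

lemma is_green_unique:
  assumes S: "0 < S" and G: "is_green B q S G" "is_green B q S G'" and t: "t \<in> {0..S}" and s: "s \<in> {0..S}"
  shows "G t s = G' t s"
proof -
  have cont: "continuous_on {0..S} (G t)" if "is_green B q S G" for G
  proof -
    have "continuous_on ({0..S} \<times> {0..S}) (\<lambda>(t, s). G t s)" using that by (simp add: is_green_def)
    moreover have "continuous_on {0..S} (\<lambda>s. (t, s))" by (intro continuous_intros)
    ultimately have "continuous_on {0..S} (\<lambda>s. case (t, s) of (t, s) \<Rightarrow> G t s)"
      by (rule continuous_on_compose2) (use t in blast)
    then show ?thesis by simp
  qed
  define \<sigma> where "\<sigma> s = G t s - G' t s" for s
  have c\<sigma>: "continuous_on {0..S} \<sigma>" unfolding \<sigma>_def by (intro continuous_intros cont G)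
  then have \<sigma>: "\<sigma> absolutely_integrable_on {0..S}" by (rule absolutely_integrable_continuous_real)
  define u where "u t = (LINT s:{0..S}|lebesgue. G t s * \<sigma> s)" for t
  have "solves B q S \<sigma> u" using G(1) \<sigma> unfolding is_green_def u_def by blast
  then have "u t = (LINT s:{0..S}|lebesgue. G' t s * \<sigma> s)" using G(2) \<sigma> t unfolding is_green_def by blast
  then have "integral {0..S} (\<lambda>s. G t s * \<sigma> s) = integral {0..S} (\<lambda>s. G' t s * \<sigma> s)"
    unfolding u_def
    using set_lebesgue_integral_eq_integral(2)[OF absolutely_integrable_continuous_mult[OF cont[OF G(1)] \<sigma>]]
      set_lebesgue_integral_eq_integral(2)[OF absolutely_integrable_continuous_mult[OF cont[OF G(2)] \<sigma>]] by simp
  moreover have "(\<lambda>s. G t s * \<sigma> s) integrable_on {0..S}" "(\<lambda>s. G' t s * \<sigma> s) integrable_on {0..S}"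
    by (intro integrable_continuous_real continuous_on_mult cont G c\<sigma>)+
  ultimately have "integral {0..S} (\<lambda>s. G t s * \<sigma> s - G' t s * \<sigma> s) = 0"
    by (simp add: integral_diff)
  moreover have "(\<lambda>s. G t s * \<sigma> s - G' t s * \<sigma> s) = (\<lambda>s. (\<sigma> s)\<^sup>2)"
    by (simp add: \<sigma>_def power2_eq_square algebra_simps)
  ultimately have "integral {0..S} (\<lambda>s. (\<sigma> s)\<^sup>2) = 0" by simp
  moreover have "continuous_on {0..S} (\<lambda>s. (\<sigma> s)\<^sup>2)" by (intro continuous_on_power c\<sigma>)
  ultimately have "\<forall>s\<in>{0..S}. (\<sigma> s)\<^sup>2 = 0"
    using integral_eq_0_iff[of 0 S "\<lambda>s. (\<sigma> s)\<^sup>2"] S by simp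
  then show ?thesis using s by (simp add: \<sigma>_def)
qed

lemma green_eq:
  assumes "0 < S" "is_green B q S G" "t \<in> {0..S}" "s \<in> {0..S}"
  shows "green B q S t s = G t s"
  using is_green_unique[OF assms(1) someI[of "is_green B q S", OF assms(2)] assms(2-4)] unfolding green_def .

section \<open>Boundary value problems in terms of a fundamental system\<close>

lemma nonresonant_iff: "nonresonant B (\<lambda>t. q t + \<mu>) S \<longleftrightarrow> \<not> is_eigenvalue B q S \<mu>"
  by (auto simp: nonresonant_def is_eigenvalue_def)

lemma first_eigenvalue_eqI:
  assumes "is_eigenvalue B q S \<mu>" "\<And>\<nu>. is_eigenvalue B q S \<nu> \<Longrightarrow> \<mu> \<le> \<nu>"
  shows "first_eigenvalue B q S = \<mu>"
  unfolding first_eigenvalue_def by (rule Least_equality) (fact assms)+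

lemma nontrivial_kernel_iff_det_zero:
  fixes a b c d :: real
  shows "(\<exists>\<alpha> \<beta>. (\<alpha> \<noteq> 0 \<or> \<beta> \<noteq> 0) \<and> a * \<alpha> + b * \<beta> = 0 \<and> c * \<alpha> + d * \<beta> = 0) \<longleftrightarrow> a * d - b * c = 0"
  (is "?L \<longleftrightarrow> ?R")
proof
  assume ?L
  then obtain \<alpha> \<beta> where *: "\<alpha> \<noteq> 0 \<or> \<beta> \<noteq> 0" "a * \<alpha> + b * \<beta> = 0" "c * \<alpha> + d * \<beta> = 0" by blast
  have "(a * d - b * c) * \<alpha> = d * (a * \<alpha> + b * \<beta>) - b * (c * \<alpha> + d * \<beta>)"
    "(a * d - b * c) * \<beta> = a * (c * \<alpha> + d * \<beta>) - c * (a * \<alpha> + b * \<beta>)"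
    by (simp_all add: algebra_simps)
  then have "(a * d - b * c) * \<alpha> = 0" "(a * d - b * c) * \<beta> = 0" unfolding * by simp_all
  then show "a * d - b * c = 0" using *(1) by (metis mult_eq_0_iff)
next
  assume det: "a * d - b * c = 0"
  show ?L
  proof (cases "a = 0 \<and> b = 0")
    case True
    show ?thesis
    proof (cases "c = 0 \<and> d = 0")
      case True
      then show ?thesis using \<open>a = 0 \<and> b = 0\<close> by (intro exI[of _ 1]) auto
    next
      case False
      then show ?thesis using \<open>a = 0 \<and> b = 0\<close> by (intro exI[of _ d] exI[of _ "- c"]) (auto simp: algebra_simps)
    qed
  next
    case False
    then show ?thesis using det by (intro exI[of _ b] exI[of _ "- a"]) (auto simp: algebra_simps)
  qed
qed

text \<open>A basis of solutions for a single parameter. The derivatives \<open>d\<phi>\<close>, \<open>d\<psi>\<close> are recorded rather than the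
  quasi-derivatives, since the boundary conditions refer to derivatives.\<close>

locale fundamental_system =
  fixes q :: "real \<Rightarrow> real" and S :: real and A :: "real \<Rightarrow> real" and \<mu> :: real
    and \<phi> d\<phi> \<psi> d\<psi> :: "real \<Rightarrow> real"
  assumes S: "0 < S" and q: "q absolutely_integrable_on {0..S}"
    and A: "\<And>t. t \<in> {0..S} \<Longrightarrow> A t = integral {0..t} q"
    and sol\<phi>: "reg_sol A (\<lambda>_. \<mu>) S \<phi> (\<lambda>t. d\<phi> t + A t * \<phi> t)"
    and sol\<psi>: "reg_sol A (\<lambda>_. \<mu>) S \<psi> (\<lambda>t. d\<psi> t + A t * \<psi> t)"
    and init [simp]: "\<phi> 0 = 1" "d\<phi> 0 = 0" "\<psi> 0 = 0" "d\<psi> 0 = 1"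
begin

abbreviation hom_sol :: "(real \<Rightarrow> real) \<Rightarrow> (real \<Rightarrow> real) \<Rightarrow> bool" where
  "hom_sol \<equiv> weak_sol (\<lambda>t. q t + \<mu>) S (\<lambda>_. 0)"

lemma A0 [simp]: "A 0 = 0" using A[of 0] S by simp

lemma weak_sol_reg: "reg_sol A (\<lambda>_. \<mu>) S u p \<Longrightarrow> hom_sol u (\<lambda>t. p t - integral {0..t} q * u t)"
  by (rule weak_sol_reg_sol(2)[OF q refl]) (rule reg_sol_cong, assumption, simp_all add: A)

lemma weak_sol_imp_reg_sol:
  assumes "hom_sol u v"
  shows "reg_sol A (\<lambda>_. \<mu>) S u (\<lambda>t. v t + integral {0..t} q * u t)"
  using weak_sol_reg_sol(1)[OF q refl assms] by (rule reg_sol_cong) (auto simp: A)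

lemma reg_sol_imp_weak_sol: "reg_sol A (\<lambda>_. \<mu>) S u p \<Longrightarrow> \<exists>v. hom_sol u v \<and> (\<forall>t\<in>{0..S}. v t = p t - A t * u t)"
  using weak_sol_reg A by (intro exI[of _ "\<lambda>t. p t - integral {0..t} q * u t"]) auto

lemma wronskian: "t \<in> {0..S} \<Longrightarrow> \<phi> t * d\<psi> t - d\<phi> t * \<psi> t = 1"
  using wronskian_constant[OF sol\<phi> sol\<psi>, of t 0] S by (simp add: algebra_simps)

lemma expand:
  assumes w: "hom_sol u v" and t: "t \<in> {0..S}"
  shows "u t = u 0 * \<phi> t + v 0 * \<psi> t" "v t = u 0 * d\<phi> t + v 0 * d\<psi> t"
proof -
  note e = reg_sol_expand[OF weak_sol_imp_reg_sol[OF w] sol\<phi> sol\<psi> _ _ _ _ t]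
  show "u t = u 0 * \<phi> t + v 0 * \<psi> t" using e(1) by simp
  moreover have "v t + A t * u t = u 0 * (d\<phi> t + A t * \<phi> t) + v 0 * (d\<psi> t + A t * \<psi> t)"
    using e(2) A[OF t] by simp
  ultimately show "v t = u 0 * d\<phi> t + v 0 * d\<psi> t" by (simp add: algebra_simps)
qed

lemma lincomb_weak_sol:
  obtains v where "hom_sol (\<lambda>t. \<alpha> * \<phi> t + \<beta> * \<psi> t) v"
    "\<And>t. t \<in> {0..S} \<Longrightarrow> v t = \<alpha> * d\<phi> t + \<beta> * d\<psi> t"
  using reg_sol_imp_weak_sol[OF reg_sol_lincomb[OF sol\<phi> sol\<psi>, of \<alpha> \<beta>]] that by (auto simp: algebra_simps)

text \<open>Solutions are parametrized by their initial values \<open>(\<alpha>, \<beta>)\<close>, so a boundary condition is a linear condition on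
  them; \<open>b\<close> is the condition as a relation between the four boundary values.\<close>

lemma eigenvalue_iff_initial_values:
  assumes bc: "\<And>u. satisfies_bc B S u \<longleftrightarrow> b (u 0) (deriv_on 0 S u 0) (u S) (deriv_on 0 S u S)"
  shows "is_eigenvalue B q S \<mu> \<longleftrightarrow>
    (\<exists>\<alpha> \<beta>. (\<alpha> \<noteq> 0 \<or> \<beta> \<noteq> 0) \<and> b \<alpha> \<beta> (\<alpha> * \<phi> S + \<beta> * \<psi> S) (\<alpha> * d\<phi> S + \<beta> * d\<psi> S))"
  (is "_ \<longleftrightarrow> ?R")
proof
  have 0: "0 \<in> {0..S}" and SS: "S \<in> {0..S}" using S by auto
  assume "is_eigenvalue B q S \<mu>"
  then obtain u v t where w: "hom_sol u v" and "satisfies_bc B S u"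
    and t: "t \<in> {0..S}" "u t \<noteq> 0"
    unfolding is_eigenvalue_def solves_iff_weak_sol[OF S] by blast
  then have "b (u 0) (v 0) (u S) (v S)"
    by (simp add: bc weak_sol_deriv_on[OF S w 0] weak_sol_deriv_on[OF S w SS])
  moreover have "u 0 \<noteq> 0 \<or> v 0 \<noteq> 0" using expand(1)[OF w t(1)] t(2) by auto
  ultimately show ?R
    using expand[OF w SS] by auto
next
  have 0: "0 \<in> {0..S}" and SS: "S \<in> {0..S}" using S by auto
  assume ?R
  then obtain \<alpha> \<beta> where ab: "\<alpha> \<noteq> 0 \<or> \<beta> \<noteq> 0" "b \<alpha> \<beta> (\<alpha> * \<phi> S + \<beta> * \<psi> S) (\<alpha> * d\<phi> S + \<beta> * d\<psi> S)" by blast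
  define u where "u t = \<alpha> * \<phi> t + \<beta> * \<psi> t" for t
  obtain v where w: "hom_sol u v" and v: "\<And>t. t \<in> {0..S} \<Longrightarrow> v t = \<alpha> * d\<phi> t + \<beta> * d\<psi> t"
    unfolding u_def using lincomb_weak_sol[of \<alpha> \<beta>] by blast
  have "satisfies_bc B S u"
    unfolding bc weak_sol_deriv_on[OF S w 0] weak_sol_deriv_on[OF S w SS] using ab(2) v[OF 0] v[OF SS]
    by (simp add: u_def)
  moreover have "\<exists>t\<in>{0..S}. u t \<noteq> 0"
  proof (rule ccontr)
    assume "\<not> ?thesis"
    then have z: "\<And>t. t \<in> {0..S} \<Longrightarrow> u t = 0" by blast
    then have "u 0 = 0" using 0 by blast
    have "deriv_on 0 S u 0 = 0"
    proof (rule deriv_on_eq[OF S 0])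
      show "(u has_real_derivative 0) (at 0 within {0..S})"
        using DERIV_const[of 0] unfolding has_field_derivative_def
        by (rule has_derivative_transform[OF 0 z, rotated])
    qed
    then have "v 0 = 0" using weak_sol_deriv_on[OF S w 0] by simp
    then show False using ab(1) \<open>u 0 = 0\<close> v[OF 0] by (simp add: u_def)
  qed
  ultimately show "is_eigenvalue B q S \<mu>"
    unfolding is_eigenvalue_def solves_iff_weak_sol[OF S] using w by blast
qed

lemma eigenvalue_Neumann: "is_eigenvalue Neumann q S \<mu> \<longleftrightarrow> d\<phi> S = 0"
  by (subst eigenvalue_iff_initial_values[where b = "\<lambda>x y x' y'. y = 0 \<and> y' = 0"]) auto

lemma eigenvalue_Mixed1: "is_eigenvalue Mixed1 q S \<mu> \<longleftrightarrow> \<phi> S = 0"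
  by (subst eigenvalue_iff_initial_values[where b = "\<lambda>x y x' y'. y = 0 \<and> x' = 0"]) auto

lemma eigenvalue_Dirichlet: "is_eigenvalue Dirichlet q S \<mu> \<longleftrightarrow> \<psi> S = 0"
  by (subst eigenvalue_iff_initial_values[where b = "\<lambda>x y x' y'. x = 0 \<and> x' = 0"]) auto

lemma eigenvalue_Mixed2: "is_eigenvalue Mixed2 q S \<mu> \<longleftrightarrow> d\<psi> S = 0"
  by (subst eigenvalue_iff_initial_values[where b = "\<lambda>x y x' y'. x = 0 \<and> y' = 0"]) auto

text \<open>Periodic and antiperiodic conditions together: \<open>\<epsilon>\<close> is the multiplier, so the condition says that \<open>\<epsilon>\<close> is an
  eigenvalue of the monodromy matrix, which has determinant \<open>1\<close>.\<close>

lemma eigenvalue_quasiperiodic: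
  assumes bc: "\<And>u. satisfies_bc B S u \<longleftrightarrow> u 0 = \<epsilon> * u S \<and> deriv_on 0 S u 0 = \<epsilon> * deriv_on 0 S u S"
    and \<epsilon>: "\<epsilon> = 1 \<or> \<epsilon> = - 1"
  shows "is_eigenvalue B q S \<mu> \<longleftrightarrow> \<phi> S + d\<psi> S = 2 * \<epsilon>"
proof -
  have *: "(\<alpha> = \<epsilon> * (\<alpha> * \<phi> S + \<beta> * \<psi> S) \<and> \<beta> = \<epsilon> * (\<alpha> * d\<phi> S + \<beta> * d\<psi> S)) \<longleftrightarrow>
      ((\<phi> S - \<epsilon>) * \<alpha> + \<psi> S * \<beta> = 0 \<and> d\<phi> S * \<alpha> + (d\<psi> S - \<epsilon>) * \<beta> = 0)" for \<alpha> \<beta>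
    using \<epsilon> by (auto simp: algebra_simps)
  have "is_eigenvalue B q S \<mu> \<longleftrightarrow> (\<exists>\<alpha> \<beta>. (\<alpha> \<noteq> 0 \<or> \<beta> \<noteq> 0) \<and>
      \<alpha> = \<epsilon> * (\<alpha> * \<phi> S + \<beta> * \<psi> S) \<and> \<beta> = \<epsilon> * (\<alpha> * d\<phi> S + \<beta> * d\<psi> S))"
    by (rule eigenvalue_iff_initial_values[where b = "\<lambda>x y x' y'. x = \<epsilon> * x' \<and> y = \<epsilon> * y'"]) (simp add: bc)
  also have "\<dots> \<longleftrightarrow> (\<phi> S - \<epsilon>) * (d\<psi> S - \<epsilon>) - \<psi> S * d\<phi> S = 0"
    unfolding * by (rule nontrivial_kernel_iff_det_zero)
  also have "(\<phi> S - \<epsilon>) * (d\<psi> S - \<epsilon>) - \<psi> S * d\<phi> S = 2 - \<epsilon> * (\<phi> S + d\<psi> S)"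
    using wronskian[of S] S \<epsilon> by (auto simp: algebra_simps)
  finally show ?thesis using \<epsilon> by auto
qed

lemma eigenvalue_Periodic: "is_eigenvalue Periodic q S \<mu> \<longleftrightarrow> \<phi> S + d\<psi> S = 2"
  using eigenvalue_quasiperiodic[of Periodic 1] by simp

lemma eigenvalue_Antiperiodic: "is_eigenvalue Antiperiodic q S \<mu> \<longleftrightarrow> \<phi> S + d\<psi> S = - 2"
  using eigenvalue_quasiperiodic[of Antiperiodic "- 1"] by simp

lemma green_kernel:
  assumes nr: "nonresonant B (\<lambda>t. q t + \<mu>) S"
    and bc: "\<And>u f h. u 0 = a11 * f + a12 * h \<Longrightarrow> deriv_on 0 S u 0 = a21 * f + a22 * h \<Longrightarrow>
       u S = (\<psi> S * f - \<phi> S * h) + (u 0 * \<phi> S + deriv_on 0 S u 0 * \<psi> S) \<Longrightarrow>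
       deriv_on 0 S u S = (d\<psi> S * f - d\<phi> S * h) + (u 0 * d\<phi> S + deriv_on 0 S u 0 * d\<psi> S) \<Longrightarrow>
       satisfies_bc B S u"
    and t: "t \<in> {0..S}" and s: "s \<in> {0..S}"
  shows "green B (\<lambda>t. q t + \<mu>) S t s = kernel \<phi> \<psi> a11 a12 a21 a22 t s"
proof -
  obtain v1 where v1: "hom_sol \<phi> v1" "\<And>t. t \<in> {0..S} \<Longrightarrow> v1 t = d\<phi> t"
    using reg_sol_imp_weak_sol[OF sol\<phi>] by auto
  obtain v2 where v2: "hom_sol \<psi> v2" "\<And>t. t \<in> {0..S} \<Longrightarrow> v2 t = d\<psi> t"
    using reg_sol_imp_weak_sol[OF sol\<psi>] by auto
  have 0: "0 \<in> {0..S}" "S \<in> {0..S}" using S by auto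
  have "is_green B (\<lambda>t. q t + \<mu>) S (kernel \<phi> \<psi> a11 a12 a21 a22)"
    using wronskian v1(2) v2(2) by (intro is_green_kernel[OF S v1(1) v2(1) _ _ _ _ _ nr bc]) (simp_all add: v1(2)[OF 0(1)] v2(2)[OF 0(1)] v1(2)[OF 0(2)] v2(2)[OF 0(2)])
  then show ?thesis by (rule green_eq[OF S _ t s])
qed

lemma green_Neumann:
  assumes nr: "d\<phi> S \<noteq> 0" and t: "t \<in> {0..S}" and s: "s \<in> {0..S}"
  shows "green Neumann (\<lambda>t. q t + \<mu>) S t s =
    - (\<phi> (min s t) * (d\<psi> S * \<phi> (max s t) - d\<phi> S * \<psi> (max s t))) / d\<phi> S"
proof -
  have "green Neumann (\<lambda>t. q t + \<mu>) S t s = kernel \<phi> \<psi> (- d\<psi> S / d\<phi> S) 1 0 0 t s"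
  proof (rule green_kernel[OF _ _ t s])
    show "nonresonant Neumann (\<lambda>t. q t + \<mu>) S" using nr by (simp add: nonresonant_iff eigenvalue_Neumann)
  next
    fix u f h
    assume "u 0 = - d\<psi> S / d\<phi> S * f + 1 * h" "deriv_on 0 S u 0 = 0 * f + 0 * h"
      "deriv_on 0 S u S = (d\<psi> S * f - d\<phi> S * h) + (u 0 * d\<phi> S + deriv_on 0 S u 0 * d\<psi> S)"
    then show "satisfies_bc Neumann S u" using nr by (simp add: field_simps)
  qed
  then show ?thesis using nr by (cases "s \<le> t") (simp_all add: kernel_def min_def max_def field_simps)
qed

text \<open>The coefficients solve the \<open>2 \<times> 2\<close> linear system for the initial values of the periodic solution; its determinant is
  \<open>2\<close> minus the trace of the monodromy matrix, by the Wronskian identity.\<close>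

lemma green_Periodic:
  assumes nr: "\<phi> S + d\<psi> S \<noteq> 2" and t: "t \<in> {0..S}" and s: "s \<in> {0..S}"
  shows "green Periodic (\<lambda>t. q t + \<mu>) S t s =
    kernel \<phi> \<psi> (\<psi> S / (2 - (\<phi> S + d\<psi> S))) ((1 - \<phi> S) / (2 - (\<phi> S + d\<psi> S)))
      ((d\<psi> S - 1) / (2 - (\<phi> S + d\<psi> S))) (- d\<phi> S / (2 - (\<phi> S + d\<psi> S))) t s"
proof (rule green_kernel[OF _ _ t s])
  show "nonresonant Periodic (\<lambda>t. q t + \<mu>) S" using nr by (simp add: nonresonant_iff eigenvalue_Periodic)
  define D where "D = 2 - (\<phi> S + d\<psi> S)"
  have D: "D \<noteq> 0" using nr by (simp add: D_def)
  have W: "\<phi> S * d\<psi> S - d\<phi> S * \<psi> S = 1" using wronskian[of S] S by simp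
  fix u f h
  assume u: "u 0 = \<psi> S / (2 - (\<phi> S + d\<psi> S)) * f + (1 - \<phi> S) / (2 - (\<phi> S + d\<psi> S)) * h"
    "deriv_on 0 S u 0 = (d\<psi> S - 1) / (2 - (\<phi> S + d\<psi> S)) * f + - d\<phi> S / (2 - (\<phi> S + d\<psi> S)) * h"
    and eS: "u S = (\<psi> S * f - \<phi> S * h) + (u 0 * \<phi> S + deriv_on 0 S u 0 * \<psi> S)"
    and dS: "deriv_on 0 S u S = (d\<psi> S * f - d\<phi> S * h) + (u 0 * d\<phi> S + deriv_on 0 S u 0 * d\<psi> S)"
  have v0: "u 0 * D = \<psi> S * f + (1 - \<phi> S) * h" "deriv_on 0 S u 0 * D = (d\<psi> S - 1) * f - d\<phi> S * h"
    using D unfolding u(1,2) D_def[symmetric] by (simp_all add: field_simps)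
  have "u S * D = ((\<psi> S * f - \<phi> S * h) + (u 0 * \<phi> S + deriv_on 0 S u 0 * \<psi> S)) * D" by (subst eS) simp
  also have "\<dots> = (\<psi> S * f - \<phi> S * h) * D + ((u 0 * D) * \<phi> S + (deriv_on 0 S u 0 * D) * \<psi> S)"
    by (simp add: algebra_simps)
  also have "\<dots> = \<psi> S * f + (1 - \<phi> S) * h + (\<phi> S * d\<psi> S - d\<phi> S * \<psi> S - 1) * h"
    unfolding v0 by (simp add: D_def algebra_simps)
  finally have "u S * D = u 0 * D" using W v0(1) by (simp del: mult_cancel_right)
  then have uS: "u S = u 0" using D by simp
  have "deriv_on 0 S u S * D = ((d\<psi> S * f - d\<phi> S * h) + (u 0 * d\<phi> S + deriv_on 0 S u 0 * d\<psi> S)) * D" by (subst dS) simp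
  also have "\<dots> = (d\<psi> S * f - d\<phi> S * h) * D + ((u 0 * D) * d\<phi> S + (deriv_on 0 S u 0 * D) * d\<psi> S)"
    by (simp add: algebra_simps)
  also have "\<dots> = (d\<psi> S - 1) * f - d\<phi> S * h + (1 - (\<phi> S * d\<psi> S - d\<phi> S * \<psi> S)) * f"
    unfolding v0 by (simp add: D_def algebra_simps)
  finally have "deriv_on 0 S u S * D = deriv_on 0 S u 0 * D" using W v0(2) by (simp del: mult_cancel_right)
  then have "deriv_on 0 S u S = deriv_on 0 S u 0" using D by simp
  then show "satisfies_bc Periodic S u" using uS by simp
qed

end

section \<open>Even extension\<close>

lemma has_integral_reflect_shift:
  fixes f :: "real \<Rightarrow> real"
  assumes "(f has_integral i) {a..b}"
  shows "((\<lambda>x. f (c - x)) has_integral i) {c - b..c - a}"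
proof -
  have "((\<lambda>x. f (- 1 *\<^sub>R x + c)) has_integral (1 / \<bar>- 1\<bar> ^ DIM(real)) *\<^sub>R i) ((\<lambda>x. (1 / - 1) *\<^sub>R x + - ((1 / - 1) *\<^sub>R c)) ` cbox a b)"
    using has_integral_affinity[of f i a b "-1" c] assms by simp
  moreover have "(\<lambda>x. (1 / - 1) *\<^sub>R x + - ((1 / - 1) *\<^sub>R c)) ` cbox a b = {c - b..c - a}"
    by (force simp: image_iff intro!: bexI[of _ "c - _"])
  ultimately show ?thesis by simp
qed

lemma even_ext_symmetric: "even_ext T a (2 * T - t) = even_ext T a t"
  by (auto simp: even_ext_def)

lemma even_ext_absolutely_integrable:
  assumes T: "0 < T" and a: "a absolutely_integrable_on {0..T}"
  shows "even_ext T a absolutely_integrable_on {0..2 * T}"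
proof -
  have *: "even_ext T f integrable_on {0..2 * T}" if f: "f integrable_on {0..T}" for f
  proof -
    have 1: "even_ext T f integrable_on {0..T}"
      by (rule integrable_eq[OF f]) (simp add: even_ext_def)
    have "(\<lambda>x. f (2 * T - x)) integrable_on {2 * T - T..2 * T - 0}"
      using has_integral_reflect_shift[OF integrable_integral[OF f]] by (rule has_integral_integrable)
    then have "(\<lambda>x. f (2 * T - x)) integrable_on {T..2 * T}" by simp
    then have 2: "even_ext T f integrable_on {T..2 * T}"
      by (rule integrable_eq) (auto simp: even_ext_def)
    show ?thesis by (rule Henstock_Kurzweil_Integration.integrable_combine[OF _ _ 1 2]) (use T in auto)
  qed
  have "a integrable_on {0..T}" "(\<lambda>t. \<bar>a t\<bar>) integrable_on {0..T}"
    using a by (auto simp: absolutely_integrable_on_def)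
  note this[THEN *]
  moreover have "even_ext T (\<lambda>t. \<bar>a t\<bar>) = (\<lambda>t. \<bar>even_ext T a t\<bar>)" by (rule ext) (simp add: even_ext_def)
  ultimately show ?thesis unfolding absolutely_integrable_on_def real_norm_def by simp
qed

lemma even_ext_primitive:
  assumes T: "0 < T" and a: "a absolutely_integrable_on {0..T}"
  defines "A \<equiv> \<lambda>t. integral {0..t} (even_ext T a)"
  shows "t \<in> {0..T} \<Longrightarrow> A t = integral {0..t} a"
    and "t \<in> {0..2 * T} \<Longrightarrow> A (2 * T - t) = 2 * A T - A t"
proof -
  have qi: "even_ext T a integrable_on {0..2 * T}"
    using even_ext_absolutely_integrable[OF T a] by (simp add: absolutely_integrable_on_def)
  show "A t = integral {0..t} a" if "t \<in> {0..T}"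
    unfolding A_def by (rule integral_cong) (use that in \<open>auto simp: even_ext_def\<close>)
  have r: "A (2 * T) - A (2 * T - t) = A t" if t: "t \<in> {0..2 * T}" for t
  proof -
    have "integral {0..2 * T - t} (even_ext T a) + integral {2 * T - t..2 * T} (even_ext T a) = integral {0..2 * T} (even_ext T a)"
      by (rule Henstock_Kurzweil_Integration.integral_combine[OF _ _ qi]) (use t in auto)
    moreover have "(even_ext T a has_integral A t) {0..t}"
      unfolding A_def using t by (intro integrable_integral integrable_on_subinterval[OF qi]) auto
    from has_integral_reflect_shift[OF this, of "2 * T"]
    have "integral {2 * T - t..2 * T} (even_ext T a) = A t"
      by (simp add: even_ext_symmetric integral_unique)
    ultimately show ?thesis by (simp add: A_def)
  qed
  show "A (2 * T - t) = 2 * A T - A t" if "t \<in> {0..2 * T}"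
    using r[OF that] r[of T] T by auto
qed

section \<open>The Neumann problem and the even extension\<close>

text \<open>Solutions on \<open>[0,2T]\<close> for the even extension, one basis for each parameter; their restrictions to \<open>[0,T]\<close> serve
  the problems for \<open>a\<close>, so that both families of problems share the same functions.\<close>

locale even_family =
  fixes T :: real and a :: "real \<Rightarrow> real" and A :: "real \<Rightarrow> real"
    and \<phi> d\<phi> \<psi> d\<psi> :: "real \<Rightarrow> real \<Rightarrow> real"
  assumes T: "0 < T" and a: "a absolutely_integrable_on {0..T}"
    and A_half: "\<And>t. t \<in> {0..T} \<Longrightarrow> A t = integral {0..t} a"
    and A_reflect: "\<And>t. t \<in> {0..2 * T} \<Longrightarrow> A (2 * T - t) = 2 * A T - A t"
    and full: "\<And>\<mu>. fundamental_system (even_ext T a) (2 * T) A \<mu> (\<phi> \<mu>) (d\<phi> \<mu>) (\<psi> \<mu>) (d\<psi> \<mu>)"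
begin

lemma half: "fundamental_system a T A \<mu> (\<phi> \<mu>) (d\<phi> \<mu>) (\<psi> \<mu>) (d\<psi> \<mu>)"
proof -
  interpret fundamental_system "even_ext T a" "2 * T" A \<mu> "\<phi> \<mu>" "d\<phi> \<mu>" "\<psi> \<mu>" "d\<psi> \<mu>" by (rule full)
  show ?thesis
    by unfold_locales (use T a A_half reg_sol_subinterval[OF sol\<phi>] reg_sol_subinterval[OF sol\<psi>] in auto)
qed

lemma continuous_A: "continuous_on {0..T} A"
proof -
  have "continuous_on {0..T} (\<lambda>t. integral {0..t} a)"
    using a by (intro indefinite_integral_continuous_1) (simp add: absolutely_integrable_on_def)
  then show ?thesis using A_half continuous_on_cong[of "{0..T}" "{0..T}" A] by simp
qed

lemma init: "\<phi> \<mu> 0 = 1" "d\<phi> \<mu> 0 = 0" "\<psi> \<mu> 0 = 0" "d\<psi> \<mu> 0 = 1" "A 0 = 0"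
  using full[of \<mu>] fundamental_system.A0[OF full] by (simp_all add: fundamental_system_def)

lemma reg\<phi>: "reg_sol A (\<lambda>_. \<mu>) T (\<phi> \<mu>) (\<lambda>t. d\<phi> \<mu> t + A t * \<phi> \<mu> t)"
  using half[of \<mu>] by (simp add: fundamental_system_def)

lemma reg\<psi>: "reg_sol A (\<lambda>_. \<mu>) T (\<psi> \<mu>) (\<lambda>t. d\<psi> \<mu> t + A t * \<psi> \<mu> t)"
  using half[of \<mu>] by (simp add: fundamental_system_def)

lemma wronskian_T: "\<phi> \<mu> T * d\<psi> \<mu> T - d\<phi> \<mu> T * \<psi> \<mu> T = 1"
  using fundamental_system.wronskian[OF half, of T \<mu>] T by simp

sublocale N: shooting A T 1 0 "- A T" 1 \<phi> "\<lambda>\<mu> t. d\<phi> \<mu> t + A t * \<phi> \<mu> t"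
  by unfold_locales (use T continuous_A reg\<phi> init in auto)

sublocale M1: shooting A T 1 0 1 0 \<phi> "\<lambda>\<mu> t. d\<phi> \<mu> t + A t * \<phi> \<mu> t"
  by unfold_locales (use T continuous_A reg\<phi> init in auto)

sublocale M2: shooting A T 0 1 "- A T" 1 \<psi> "\<lambda>\<mu> t. d\<psi> \<mu> t + A t * \<psi> \<mu> t"
  by unfold_locales (use T continuous_A reg\<psi> init in auto)

sublocale D: shooting A T 0 1 1 0 \<psi> "\<lambda>\<mu> t. d\<psi> \<mu> t + A t * \<psi> \<mu> t"
  by unfold_locales (use T continuous_A reg\<psi> init in auto)

lemma end_value_simps: "N.end_value \<mu> = d\<phi> \<mu> T" "M1.end_value \<mu> = \<phi> \<mu> T" "M2.end_value \<mu> = d\<psi> \<mu> T" "D.end_value \<mu> = \<psi> \<mu> T"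
  by (simp_all add: N.end_value_def M1.end_value_def M2.end_value_def D.end_value_def)

text \<open>For a solution \<open>u\<close> on \<open>[0,2T]\<close> expand its mirror image \<open>u(2T - t)\<close> in the basis, with the values and derivatives
  of \<open>u\<close> at \<open>2T\<close> as coefficients up to sign, and evaluate at the midpoint \<open>T\<close>. Solving for the coefficients gives the
  data at \<open>2T\<close> in terms of those at \<open>T\<close>.\<close>

lemma monodromy:
  "\<phi> \<mu> (2 * T) = \<phi> \<mu> T * d\<psi> \<mu> T + d\<phi> \<mu> T * \<psi> \<mu> T"
  "d\<phi> \<mu> (2 * T) = 2 * (\<phi> \<mu> T * d\<phi> \<mu> T)"
  "\<psi> \<mu> (2 * T) = 2 * (\<psi> \<mu> T * d\<psi> \<mu> T)"
  "d\<psi> \<mu> (2 * T) = \<phi> \<mu> T * d\<psi> \<mu> T + d\<phi> \<mu> T * \<psi> \<mu> T"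
proof -
  interpret fundamental_system "even_ext T a" "2 * T" A \<mu> "\<phi> \<mu>" "d\<phi> \<mu>" "\<psi> \<mu>" "d\<psi> \<mu>" by (rule full)
  have A2: "A (2 * T) = 2 * A T" using A_reflect[of 0] T init by simp
  have T2: "T \<in> {0..2 * T}" "0 \<in> {0..2 * T}" using T by auto
  have gen: "u (2 * T) = u T * d\<psi> \<mu> T + v T * \<psi> \<mu> T \<and> v (2 * T) = v T * \<phi> \<mu> T + u T * d\<phi> \<mu> T"
    if u: "reg_sol A (\<lambda>_. \<mu>) (2 * T) u (\<lambda>t. v t + A t * u t)" for u v
  proof -
    have "reg_sol A (\<lambda>_. \<mu>) (2 * T) (\<lambda>t. u (2 * T - t)) (\<lambda>t. - (v (2 * T - t) + A (2 * T - t) * u (2 * T - t)) + 2 * A T * u (2 * T - t))"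
      by (rule reg_sol_reflect[OF u A_reflect])
    from reg_sol_expand[OF this sol\<phi> sol\<psi> _ _ _ _ T2(1)]
    have 1: "u T = u (2 * T) * \<phi> \<mu> T - v (2 * T) * \<psi> \<mu> T"
      and e: "- v T + A T * u T = u (2 * T) * (d\<phi> \<mu> T + A T * \<phi> \<mu> T) - v (2 * T) * (d\<psi> \<mu> T + A T * \<psi> \<mu> T)"
      using A2 by (simp_all add: init algebra_simps)
    have 2: "- v T = u (2 * T) * d\<phi> \<mu> T - v (2 * T) * d\<psi> \<mu> T"
      using e unfolding 1 by (simp add: algebra_simps)
    have "u T * d\<psi> \<mu> T + v T * \<psi> \<mu> T = u T * d\<psi> \<mu> T - (- v T) * \<psi> \<mu> T" by simp
    also have "\<dots> = u (2 * T) * (\<phi> \<mu> T * d\<psi> \<mu> T - d\<phi> \<mu> T * \<psi> \<mu> T)"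
      unfolding 1 2 by (simp add: algebra_simps)
    finally have 3: "u (2 * T) = u T * d\<psi> \<mu> T + v T * \<psi> \<mu> T" using wronskian_T by simp
    have "v T * \<phi> \<mu> T + u T * d\<phi> \<mu> T = u T * d\<phi> \<mu> T - (- v T) * \<phi> \<mu> T" by simp
    also have "\<dots> = v (2 * T) * (\<phi> \<mu> T * d\<psi> \<mu> T - d\<phi> \<mu> T * \<psi> \<mu> T)"
      unfolding 1 2 by (simp add: algebra_simps)
    finally show ?thesis using 3 wronskian_T by simp
  qed
  show "\<phi> \<mu> (2 * T) = \<phi> \<mu> T * d\<psi> \<mu> T + d\<phi> \<mu> T * \<psi> \<mu> T" "d\<phi> \<mu> (2 * T) = 2 * (\<phi> \<mu> T * d\<phi> \<mu> T)"
    using gen[OF sol\<phi>] by simp_all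
  show "\<psi> \<mu> (2 * T) = 2 * (\<psi> \<mu> T * d\<psi> \<mu> T)" "d\<psi> \<mu> (2 * T) = \<phi> \<mu> T * d\<psi> \<mu> T + d\<phi> \<mu> T * \<psi> \<mu> T"
    using gen[OF sol\<psi>] by (simp_all add: algebra_simps)
qed

lemma trace_monodromy:
  "\<phi> \<mu> (2 * T) + d\<psi> \<mu> (2 * T) = 2 + 4 * (d\<phi> \<mu> T * \<psi> \<mu> T)"
  "\<phi> \<mu> (2 * T) + d\<psi> \<mu> (2 * T) = 4 * (\<phi> \<mu> T * d\<psi> \<mu> T) - 2"
  unfolding monodromy using wronskian_T[of \<mu>] by linarith+

lemma eigenvalues_half:
  "is_eigenvalue Neumann a T \<mu> \<longleftrightarrow> d\<phi> \<mu> T = 0"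
  "is_eigenvalue Mixed1 a T \<mu> \<longleftrightarrow> \<phi> \<mu> T = 0"
  "is_eigenvalue Mixed2 a T \<mu> \<longleftrightarrow> d\<psi> \<mu> T = 0"
  "is_eigenvalue Dirichlet a T \<mu> \<longleftrightarrow> \<psi> \<mu> T = 0"
  using fundamental_system.eigenvalue_Neumann[OF half] fundamental_system.eigenvalue_Mixed1[OF half]
    fundamental_system.eigenvalue_Mixed2[OF half] fundamental_system.eigenvalue_Dirichlet[OF half] by auto

lemma eigenvalues_full:
  "is_eigenvalue Neumann (even_ext T a) (2 * T) \<mu> \<longleftrightarrow> d\<phi> \<mu> T = 0 \<or> \<phi> \<mu> T = 0"
  "is_eigenvalue Periodic (even_ext T a) (2 * T) \<mu> \<longleftrightarrow> d\<phi> \<mu> T = 0 \<or> \<psi> \<mu> T = 0"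
  "is_eigenvalue Antiperiodic (even_ext T a) (2 * T) \<mu> \<longleftrightarrow> \<phi> \<mu> T = 0 \<or> d\<psi> \<mu> T = 0"
  "is_eigenvalue Dirichlet (even_ext T a) (2 * T) \<mu> \<longleftrightarrow> \<psi> \<mu> T = 0 \<or> d\<psi> \<mu> T = 0"
  using fundamental_system.eigenvalue_Neumann[OF full, of \<mu>] fundamental_system.eigenvalue_Dirichlet[OF full, of \<mu>]
    fundamental_system.eigenvalue_Periodic[OF full, of \<mu>] fundamental_system.eigenvalue_Antiperiodic[OF full, of \<mu>]
    trace_monodromy[of \<mu>] monodromy(2,3)[of \<mu>] by auto

text \<open>At the first Neumann eigenvalue \<open>\<phi>\<close> is positive up to and including \<open>T\<close>, so that parameter is still subcritical for
  \<open>M\<^sub>1\<close>.\<close>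

lemma N_less_M1: "N.critical < M1.critical"
proof -
  have "\<phi> N.critical t > 0" if "t \<in> {0<..T}" for t
    using that N.critical_pos[of t] N.critical_endpoint_pos by (cases "t = T") auto
  then have "N.critical \<in> M1.subcritical" using T by (simp add: M1.subcritical_def end_value_simps)
  then show ?thesis by (simp add: M1.subcritical_iff)
qed

lemma M2_less_D: "M2.critical < D.critical"
proof -
  have "\<psi> M2.critical t > 0" if "t \<in> {0<..T}" for t
    using that M2.critical_pos[of t] M2.critical_endpoint_pos by (cases "t = T") auto
  then have "M2.critical \<in> D.subcritical" using T by (simp add: D.subcritical_def end_value_simps)
  then show ?thesis by (simp add: D.subcritical_iff)
qed

text \<open>Where \<open>\<phi>\<close> is positive, \<open>\<psi>\<close> cannot have a zero \<open>c > 0\<close>: at the first one the Wronskian would be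
  \<open>\<phi>(c) \<psi>'(c) \<le> 0\<close> instead of \<open>1\<close>.\<close>

lemma N_less_D: "N.critical < D.critical"
proof -
  let ?l = "N.critical"
  have pos: "\<phi> ?l t > 0" if "t \<in> {0<..T}" for t
    using that N.critical_pos[of t] N.critical_endpoint_pos by (cases "t = T") auto
  have "\<psi> ?l t > 0" if "t \<in> {0<..T}" for t
  proof (rule ccontr)
    assume "\<not> \<psi> ?l t > 0"
    then have ex: "\<exists>t\<in>{0<..T}. \<psi> ?l t \<le> 0" using that by force
    have "\<psi> ?l 0 > 0 \<or> \<psi> ?l 0 = 0 \<and> d\<psi> ?l 0 + A 0 * \<psi> ?l 0 > 0" by (simp add: init)
    from positive_start[OF T reg\<psi> this]
    obtain d where d: "0 < d" "\<And>t. t \<in> {0<..<d} \<Longrightarrow> \<psi> ?l t > 0" by metis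
    obtain c where c: "c \<in> {0<..T}" "\<psi> ?l c = 0" "\<And>t. t \<in> {0<..<c} \<Longrightarrow> \<psi> ?l t > 0"
      using first_nonpositive_point[OF reg_sol_continuous(1)[OF reg\<psi>] d ex] by blast
    have "d\<psi> ?l c \<le> 0"
      using nonpos_deriv_at_zero[of c T "\<psi> ?l" "d\<psi> ?l c"] reg_solD(1)[OF reg\<psi>, of c ?l] c by (auto intro: less_imp_le)
    moreover have "\<phi> ?l c * d\<psi> ?l c = 1"
      using fundamental_system.wronskian[OF half, of c ?l] c by simp
    ultimately show False using pos[OF c(1)] mult_nonneg_nonpos[of "\<phi> ?l c" "d\<psi> ?l c"] by simp
  qed
  then have "?l \<in> D.subcritical" using T by (simp add: D.subcritical_def end_value_simps)
  then show ?thesis by (simp add: D.subcritical_iff)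
qed

lemma first_eigenvalues_half:
  "first_eigenvalue Neumann a T = N.critical" "first_eigenvalue Mixed1 a T = M1.critical"
  "first_eigenvalue Mixed2 a T = M2.critical" "first_eigenvalue Dirichlet a T = D.critical"
  using N.end_value_critical M1.end_value_critical M2.end_value_critical D.end_value_critical
    N.critical_least M1.critical_least M2.critical_least D.critical_least
  by (auto intro!: first_eigenvalue_eqI simp: eigenvalues_half end_value_simps)

lemma first_eigenvalues_full:
  "first_eigenvalue Neumann (even_ext T a) (2 * T) = N.critical"
  "first_eigenvalue Periodic (even_ext T a) (2 * T) = N.critical"
  "first_eigenvalue Antiperiodic (even_ext T a) (2 * T) = min M1.critical M2.critical"
  "first_eigenvalue Dirichlet (even_ext T a) (2 * T) = M2.critical"
proof -
  note zero = N.end_value_critical[unfolded end_value_simps] M1.end_value_critical[unfolded end_value_simps]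
    M2.end_value_critical[unfolded end_value_simps] D.end_value_critical[unfolded end_value_simps]
  note least = N.critical_least[unfolded end_value_simps] M1.critical_least[unfolded end_value_simps]
    M2.critical_least[unfolded end_value_simps] D.critical_least[unfolded end_value_simps]
  note le = order_trans[OF less_imp_le[OF N_less_M1]] order_trans[OF less_imp_le[OF M2_less_D]]
    order_trans[OF less_imp_le[OF N_less_D]]
  show "first_eigenvalue Neumann (even_ext T a) (2 * T) = N.critical"
  proof (rule first_eigenvalue_eqI)
    show "is_eigenvalue Neumann (even_ext T a) (2 * T) N.critical"
      unfolding eigenvalues_full using zero by blast
    fix \<nu> assume "is_eigenvalue Neumann (even_ext T a) (2 * T) \<nu>"
    then show "N.critical \<le> \<nu>" unfolding eigenvalues_full using least le by blast
  qed
  show "first_eigenvalue Periodic (even_ext T a) (2 * T) = N.critical"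
  proof (rule first_eigenvalue_eqI)
    show "is_eigenvalue Periodic (even_ext T a) (2 * T) N.critical"
      unfolding eigenvalues_full using zero by blast
    fix \<nu> assume "is_eigenvalue Periodic (even_ext T a) (2 * T) \<nu>"
    then show "N.critical \<le> \<nu>" unfolding eigenvalues_full using least le by blast
  qed
  show "first_eigenvalue Antiperiodic (even_ext T a) (2 * T) = min M1.critical M2.critical"
  proof (rule first_eigenvalue_eqI)
    show "is_eigenvalue Antiperiodic (even_ext T a) (2 * T) (min M1.critical M2.critical)"
      unfolding eigenvalues_full using zero unfolding min_def by presburger
    fix \<nu> assume "is_eigenvalue Antiperiodic (even_ext T a) (2 * T) \<nu>"
    then show "min M1.critical M2.critical \<le> \<nu>" unfolding eigenvalues_full using least min.coboundedI1 min.coboundedI2 by blast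
  qed
  show "first_eigenvalue Dirichlet (even_ext T a) (2 * T) = M2.critical"
  proof (rule first_eigenvalue_eqI)
    show "is_eigenvalue Dirichlet (even_ext T a) (2 * T) M2.critical"
      unfolding eigenvalues_full using zero by blast
    fix \<nu> assume "is_eigenvalue Dirichlet (even_ext T a) (2 * T) \<nu>"
    then show "M2.critical \<le> \<nu>" unfolding eigenvalues_full using least le by blast
  qed
qed

text \<open>The solution with \<open>\<eta>(T) = 1\<close> and \<open>\<eta>'(T) = 0\<close>.\<close>

definition \<eta> :: "real \<Rightarrow> real \<Rightarrow> real" where
  "\<eta> \<mu> t = d\<psi> \<mu> T * \<phi> \<mu> t - d\<phi> \<mu> T * \<psi> \<mu> t"

text \<open>The quasi-derivative of \<open>\<eta>\<close>.\<close>

definition p\<eta> :: "real \<Rightarrow> real \<Rightarrow> real" where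
  "p\<eta> \<mu> t = d\<psi> \<mu> T * (d\<phi> \<mu> t + A t * \<phi> \<mu> t) - d\<phi> \<mu> T * (d\<psi> \<mu> t + A t * \<psi> \<mu> t)"

lemma reg\<eta>: "reg_sol A (\<lambda>_. \<mu>) T (\<eta> \<mu>) (p\<eta> \<mu>)"
  using reg_sol_lincomb[OF reg\<phi> reg\<psi>, of \<mu> "d\<psi> \<mu> T" "- d\<phi> \<mu> T"]
  by (simp add: \<eta>_def[abs_def] p\<eta>_def[abs_def])

lemma \<eta>_values: "\<eta> \<mu> 0 = d\<psi> \<mu> T" "\<eta> \<mu> T = 1" "p\<eta> \<mu> T = A T"
proof -
  show "\<eta> \<mu> 0 = d\<psi> \<mu> T" by (simp add: \<eta>_def init)
  show 1: "\<eta> \<mu> T = 1" using wronskian_T[of \<mu>] by (simp add: \<eta>_def algebra_simps)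
  have "p\<eta> \<mu> T = A T * \<eta> \<mu> T" by (simp add: \<eta>_def p\<eta>_def algebra_simps)
  then show "p\<eta> \<mu> T = A T" using 1 by simp
qed

abbreviation G\<^sub>N :: "real \<Rightarrow> real \<Rightarrow> real \<Rightarrow> real" where
  "G\<^sub>N \<mu> \<equiv> green Neumann (\<lambda>x. a x + \<mu>) T"

abbreviation G\<^sub>P :: "real \<Rightarrow> real \<Rightarrow> real \<Rightarrow> real" where
  "G\<^sub>P \<mu> \<equiv> green Periodic (\<lambda>x. even_ext T a x + \<mu>) (2 * T)"

lemma green_N:
  assumes "d\<phi> \<mu> T \<noteq> 0" "t \<in> {0..T}" "s \<in> {0..T}"
  shows "G\<^sub>N \<mu> t s = - (\<phi> \<mu> (min s t) * \<eta> \<mu> (max s t)) / d\<phi> \<mu> T"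
  using fundamental_system.green_Neumann[OF half assms] by (simp add: \<eta>_def)

lemma nonresonant_N: "nonresonant Neumann (\<lambda>x. a x + \<mu>) T \<longleftrightarrow> d\<phi> \<mu> T \<noteq> 0"
  by (simp add: nonresonant_iff eigenvalues_half)

lemma nonresonant_P: "nonresonant Periodic (\<lambda>x. even_ext T a x + \<mu>) (2 * T) \<longleftrightarrow> d\<phi> \<mu> T \<noteq> 0 \<and> \<psi> \<mu> T \<noteq> 0"
  by (simp add: nonresonant_iff eigenvalues_full)

lemma green_N_corners:
  assumes "d\<phi> \<mu> T \<noteq> 0"
  shows "G\<^sub>N \<mu> 0 0 = - d\<psi> \<mu> T / d\<phi> \<mu> T"
    "G\<^sub>N \<mu> T T = - \<phi> \<mu> T / d\<phi> \<mu> T"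
  using green_N[OF assms, of 0 0] green_N[OF assms, of T T] T by (simp_all add: \<eta>_values init)

lemma green_P_diagonal:
  assumes nr: "d\<phi> \<mu> T \<noteq> 0" "\<psi> \<mu> T \<noteq> 0"
  shows "2 * G\<^sub>P \<mu> 0 0 = - d\<psi> \<mu> T / d\<phi> \<mu> T"
    "2 * G\<^sub>P \<mu> T T = - \<phi> \<mu> T / d\<phi> \<mu> T"
proof -
  have ne: "\<phi> \<mu> (2 * T) + d\<psi> \<mu> (2 * T) \<noteq> 2" using nr trace_monodromy(1)[of \<mu>] by simp
  have D: "2 - (\<phi> \<mu> (2 * T) + d\<psi> \<mu> (2 * T)) = - 4 * (d\<phi> \<mu> T * \<psi> \<mu> T)" using trace_monodromy(1)[of \<mu>] by simp
  have g: "G\<^sub>P \<mu> t t =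
      (\<psi> \<mu> (2 * T) * (\<phi> \<mu> t)\<^sup>2 + ((1 - \<phi> \<mu> (2 * T)) + (d\<psi> \<mu> (2 * T) - 1)) * (\<phi> \<mu> t * \<psi> \<mu> t) + - d\<phi> \<mu> (2 * T) * (\<psi> \<mu> t)\<^sup>2)
      / (- 4 * (d\<phi> \<mu> T * \<psi> \<mu> T))" if "t \<in> {0..2 * T}" for t
    using fundamental_system.green_Periodic[OF full ne that that] unfolding kernel_diagonal D .
  show "2 * G\<^sub>P \<mu> 0 0 = - d\<psi> \<mu> T / d\<phi> \<mu> T"
    using g[of 0] T nr by (simp add: init monodromy(3))
  have "\<psi> \<mu> (2 * T) * (\<phi> \<mu> T)\<^sup>2 + ((1 - \<phi> \<mu> (2 * T)) + (d\<psi> \<mu> (2 * T) - 1)) * (\<phi> \<mu> T * \<psi> \<mu> T) + - d\<phi> \<mu> (2 * T) * (\<psi> \<mu> T)\<^sup>2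
      = 2 * (\<phi> \<mu> T * \<psi> \<mu> T) * (\<phi> \<mu> T * d\<psi> \<mu> T - d\<phi> \<mu> T * \<psi> \<mu> T)"
    unfolding monodromy by (simp add: power2_eq_square algebra_simps)
  also have "\<dots> = 2 * (\<phi> \<mu> T * \<psi> \<mu> T)" by (simp add: wronskian_T)
  finally have "G\<^sub>P \<mu> T T = 2 * (\<phi> \<mu> T * \<psi> \<mu> T) / (- 4 * (d\<phi> \<mu> T * \<psi> \<mu> T))"
    using g[of T] T by simp
  then show "2 * G\<^sub>P \<mu> T T = - \<phi> \<mu> T / d\<phi> \<mu> T"
    using nr by simp
qed

lemma \<phi>_pos_upto_M1:
  "\<mu> < M1.critical \<Longrightarrow> t \<in> {0..T} \<Longrightarrow> \<phi> \<mu> t > 0"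
  "\<mu> \<le> M1.critical \<Longrightarrow> t \<in> {0..<T} \<Longrightarrow> \<phi> \<mu> t > 0"
proof -
  show 1: "\<phi> \<mu> t > 0" if "\<mu> < M1.critical" "t \<in> {0..T}" for t
    using M1.less_critical[OF that(1)] that(2) init by (cases "t = 0") (auto simp: M1.subcritical_def)
  show "\<phi> \<mu> t > 0" if "\<mu> \<le> M1.critical" "t \<in> {0..<T}"
    using 1[of t] M1.critical_pos[of t] that init by (cases "\<mu> = M1.critical"; cases "t = 0") auto
qed

lemma \<eta>_pos_upto_M2:
  assumes "\<mu> \<le> M2.critical" "t \<in> {0<..T}"
  shows "\<eta> \<mu> t > 0"
proof -
  have pos: "\<psi> \<mu> s > 0" if "s \<in> {0<..T}" for s
  proof (cases "\<mu> = M2.critical")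
    case True
    then show ?thesis using that M2.critical_pos[of s] M2.critical_endpoint_pos by (cases "s = T") simp_all
  next
    case False
    then have "\<mu> < M2.critical" using assms(1) by simp
    then show ?thesis using that M2.less_critical[of \<mu>] by (simp add: M2.subcritical_def)
  qed
  have "M2.end_value \<mu> \<ge> 0"
  proof (cases "\<mu> = M2.critical")
    case True
    then show ?thesis using M2.end_value_critical by simp
  next
    case False
    then have "\<mu> < M2.critical" using assms(1) by simp
    then show ?thesis using M2.less_critical[of \<mu>] by (simp add: M2.subcritical_def)
  qed
  then have d: "d\<psi> \<mu> T \<ge> 0" by (simp add: end_value_simps)
  show ?thesis
  proof (rule positive_by_ratio[OF reg\<psi> reg\<eta>])
    show "t \<in> {0..T}" using assms(2) by simp
    show "\<psi> \<mu> s > 0" if "s \<in> {t..T}" for s using that assms(2) by (intro pos) simp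
    show "\<eta> \<mu> T > 0" by (simp add: \<eta>_values)
    show "\<psi> \<mu> T * p\<eta> \<mu> T - (d\<psi> \<mu> T + A T * \<psi> \<mu> T) * \<eta> \<mu> T \<le> 0"
      using d by (simp add: \<eta>_values)
  qed
qed

lemma \<eta>_pos_below_M2: "\<mu> < M2.critical \<Longrightarrow> t \<in> {0..T} \<Longrightarrow> \<eta> \<mu> t > 0"
  using \<eta>_pos_upto_M2[of \<mu> t] M2.less_critical[of \<mu>]
  by (cases "t = 0") (auto simp: \<eta>_values M2.subcritical_def end_value_simps)

text \<open>Past the critical parameter, positivity in the interior would force \<open>\<phi>(T) < 0\<close>, contradicting continuity.\<close>

lemma M1_if_\<phi>_pos:
  assumes "\<And>t. t \<in> {0<..<T} \<Longrightarrow> \<phi> \<mu> t > 0"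
  shows "\<mu> \<le> M1.critical"
proof (rule ccontr)
  assume "\<not> ?thesis"
  then have "\<phi> \<mu> T < 0" using M1.supercritical_end_value[of \<mu>] assms by (simp add: end_value_simps)
  then show False
    using nonneg_at_endpoints(1)[OF T reg_sol_continuous(1)[OF reg\<phi>] assms] by simp
qed

text \<open>If \<open>\<mu>\<close> exceeded the first \<open>M\<^sub>2\<close> eigenvalue, the Wronskian of its eigenfunction with \<open>\<eta>\<close> would decrease
  strictly; it vanishes at \<open>T\<close> and equals \<open>- \<eta>(0)\<close> at \<open>0\<close>, so \<open>\<eta>(0) < 0\<close>,
  contradicting continuity.\<close>

lemma M2_if_\<eta>_pos:
  assumes "\<And>t. t \<in> {0<..<T} \<Longrightarrow> \<eta> \<mu> t > 0"
  shows "\<mu> \<le> M2.critical"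
proof (rule ccontr)
  let ?l = "M2.critical"
  assume "\<not> ?thesis"
  then have "\<psi> ?l T * p\<eta> \<mu> T - (d\<psi> ?l T + A T * \<psi> ?l T) * \<eta> \<mu> T < \<psi> ?l 0 * p\<eta> \<mu> 0 - (d\<psi> ?l 0 + A 0 * \<psi> ?l 0) * \<eta> \<mu> 0"
    using M2.critical_pos assms by (intro wronskian_less[OF reg\<psi> reg\<eta> T order_refl]) auto
  then have "\<eta> \<mu> 0 < 0"
    using M2.end_value_critical by (simp add: \<eta>_values(2,3) end_value_simps init)
  then show False
    using nonneg_at_endpoints(2)[OF T reg_sol_continuous(1)[OF reg\<eta>] assms] by simp
qed

lemma d\<phi>_neg_above_N:
  assumes "N.critical < \<mu>" "\<mu> \<le> M1.critical"
  shows "d\<phi> \<mu> T < 0"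
  using N.supercritical_end_value[OF assms(1)] \<phi>_pos_upto_M1(2)[OF assms(2)] by (simp add: end_value_simps)

lemma N_if_d\<phi>_neg:
  assumes "d\<phi> \<mu> T < 0"
  shows "N.critical < \<mu>"
  using assms N.less_critical[of \<mu>] N.end_value_critical
  by (cases \<mu> N.critical rule: linorder_cases) (auto simp: N.subcritical_def end_value_simps)

lemma green_N_neg_iff:
  "(nonresonant Neumann (\<lambda>x. a x + \<mu>) T \<and> (\<forall>t\<in>{0..T}. \<forall>s\<in>{0..T}. G\<^sub>N \<mu> t s < 0))
    \<longleftrightarrow> \<mu> < N.critical" (is "?L \<longleftrightarrow> ?R")
proof
  assume ?R
  then have sub: "\<mu> \<in> N.subcritical" by (rule N.less_critical)
  then have d: "d\<phi> \<mu> T > 0" by (simp add: N.subcritical_def end_value_simps)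
  have pos: "\<phi> \<mu> t > 0" if "t \<in> {0..T}" for t
    using sub that init by (cases "t = 0") (auto simp: N.subcritical_def)
  have \<eta>pos: "\<eta> \<mu> t > 0" if "t \<in> {0..T}" for t
  proof (rule positive_by_ratio[OF reg\<phi> reg\<eta> that])
    show "\<phi> \<mu> s > 0" if "s \<in> {t..T}" for s using that \<open>t \<in> {0..T}\<close> by (intro pos) simp
    show "\<eta> \<mu> T > 0" by (simp add: \<eta>_values)
    show "\<phi> \<mu> T * p\<eta> \<mu> T - (d\<phi> \<mu> T + A T * \<phi> \<mu> T) * \<eta> \<mu> T \<le> 0"
      using d by (simp add: \<eta>_values)
  qed
  have "G\<^sub>N \<mu> t s < 0" if "t \<in> {0..T}" "s \<in> {0..T}" for t s
  proof -
    have "\<phi> \<mu> (min s t) * \<eta> \<mu> (max s t) > 0" using that pos \<eta>pos by (intro mult_pos_pos) (auto simp: min_def max_def)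
    then show ?thesis using green_N[of \<mu> t s] that d by (simp add: divide_neg_pos)
  qed
  then show ?L
    using d by (simp add: nonresonant_N)
next
  assume *: ?L
  then have nr: "d\<phi> \<mu> T \<noteq> 0" by (simp add: nonresonant_N)
  have neg: "- \<phi> \<mu> t / d\<phi> \<mu> T < 0" if "t \<in> {0..T}" for t
  proof -
    have "G\<^sub>N \<mu> t T < 0" using * that T by auto
    then show ?thesis using green_N[OF nr that, of T] that T by (simp add: min_absorb2 max_absorb1 \<eta>_values)
  qed
  have d: "d\<phi> \<mu> T > 0" using neg[of 0] T nr by (simp add: init)
  then have "\<phi> \<mu> t > 0" if "t \<in> {0..T}" for t using neg[OF that] d by (simp add: zero_less_divide_iff)
  then have "\<mu> \<in> N.subcritical" using d by (simp add: N.subcritical_def end_value_simps)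
  then show ?R by (simp add: N.subcritical_iff)
qed

lemma green_N_pos_iff:
  "(nonresonant Neumann (\<lambda>x. a x + \<mu>) T \<and>
      (\<forall>(t, s)\<in>({0..T} \<times> {0..T}) - {(0, 0), (T, T)}. G\<^sub>N \<mu> t s > 0))
    \<longleftrightarrow> N.critical < \<mu> \<and> \<mu> \<le> min M1.critical M2.critical" (is "?L \<longleftrightarrow> ?R")
proof
  assume *: ?R
  then have d: "d\<phi> \<mu> T < 0" by (intro d\<phi>_neg_above_N) auto
  have "G\<^sub>N \<mu> t s > 0" if ts: "(t, s) \<in> ({0..T} \<times> {0..T}) - {(0, 0), (T, T)}" for t s
  proof -
    have "min s t \<in> {0..<T}" "max s t \<in> {0<..T}" using ts T by (auto simp: min_def max_def)
    then have "\<phi> \<mu> (min s t) * \<eta> \<mu> (max s t) > 0"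
      using \<phi>_pos_upto_M1(2) \<eta>_pos_upto_M2 * by (intro mult_pos_pos) auto
    then show ?thesis using green_N[of \<mu> t s] ts d by (simp add: divide_pos_neg)
  qed
  note pos = this
  show ?L
  proof (intro conjI ballI)
    show "nonresonant Neumann (\<lambda>x. a x + \<mu>) T" using d by (simp add: nonresonant_N)
    fix x assume x: "x \<in> ({0..T} \<times> {0..T}) - {(0, 0), (T, T)}"
    obtain t s where ts: "x = (t, s)" by (cases x)
    show "case x of (t, s) \<Rightarrow> G\<^sub>N \<mu> t s > 0"
      unfolding ts prod.case by (rule pos) (use x ts in simp)
  qed
next
  assume *: ?L
  then have nr: "d\<phi> \<mu> T \<noteq> 0" by (simp add: nonresonant_N)
  have pos1: "- \<phi> \<mu> t / d\<phi> \<mu> T > 0" if "t \<in> {0..<T}" for t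
  proof -
    have "G\<^sub>N \<mu> t T > 0" using * that T by auto
    then show ?thesis using green_N[OF nr, of t T] that T by (simp add: min_absorb2 max_absorb1 \<eta>_values)
  qed
  have pos2: "- \<eta> \<mu> t / d\<phi> \<mu> T > 0" if "t \<in> {0<..T}" for t
  proof -
    have "G\<^sub>N \<mu> t 0 > 0" using * that T by auto
    then show ?thesis using green_N[OF nr, of t 0] that T by (simp add: min_absorb1 max_absorb2 init)
  qed
  have d: "d\<phi> \<mu> T < 0" using pos1[of 0] T nr by (simp add: init)
  have "\<phi> \<mu> t > 0" if "t \<in> {0<..<T}" for t using pos1[of t] d that by (simp add: divide_less_0_iff)
  moreover have "\<eta> \<mu> t > 0" if "t \<in> {0<..<T}" for t using pos2[of t] d that by (simp add: divide_less_0_iff)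
  ultimately show ?R
    using N_if_d\<phi>_neg[OF d] M1_if_\<phi>_pos M2_if_\<eta>_pos by simp
qed

lemma green_N_strictly_pos_iff:
  "(nonresonant Neumann (\<lambda>x. a x + \<mu>) T \<and> (\<forall>t\<in>{0..T}. \<forall>s\<in>{0..T}. G\<^sub>N \<mu> t s > 0))
    \<longleftrightarrow> N.critical < \<mu> \<and> \<mu> < min M1.critical M2.critical" (is "?L \<longleftrightarrow> ?R")
proof
  assume *: ?R
  then have d: "d\<phi> \<mu> T < 0" by (intro d\<phi>_neg_above_N) auto
  have "G\<^sub>N \<mu> t s > 0" if ts: "t \<in> {0..T}" "s \<in> {0..T}" for t s
  proof -
    have "min s t \<in> {0..T}" "max s t \<in> {0..T}" using ts by (auto simp: min_def max_def)
    then have "\<phi> \<mu> (min s t) * \<eta> \<mu> (max s t) > 0"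
      using \<phi>_pos_upto_M1(1) \<eta>_pos_below_M2 * by (intro mult_pos_pos) auto
    then show ?thesis using green_N[of \<mu> t s] ts d by (simp add: divide_pos_neg)
  qed
  then show ?L
    using d by (simp add: nonresonant_N)
next
  assume *: ?L
  then have b: "N.critical < \<mu> \<and> \<mu> \<le> min M1.critical M2.critical" using green_N_pos_iff[of \<mu>] by auto
  have nr: "d\<phi> \<mu> T \<noteq> 0" using * by (simp add: nonresonant_N)
  have "G\<^sub>N \<mu> 0 0 > 0" "G\<^sub>N \<mu> T T > 0" using * T by auto
  then have "d\<psi> \<mu> T \<noteq> 0" "\<phi> \<mu> T \<noteq> 0" unfolding green_N_corners[OF nr] by auto
  then have "\<mu> \<noteq> M2.critical" "\<mu> \<noteq> M1.critical" using M1.end_value_critical M2.end_value_critical by (auto simp: end_value_simps)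
  then show ?R using b by (auto simp: min_def)
qed

text \<open>If \<open>\<psi>'(T) = 0\<close>, the Wronskian identity makes \<open>\<phi>'(T)\<close> and \<open>\<psi>(T)\<close> nonzero, so both problems are nonresonant
  at such a root.\<close>

lemma green_root_00:
  "is_green_root Neumann a T 0 0 \<mu> \<longleftrightarrow> d\<psi> \<mu> T = 0"
  "is_green_root Periodic (even_ext T a) (2 * T) 0 0 \<mu> \<longleftrightarrow> d\<psi> \<mu> T = 0"
proof -
  have "d\<phi> \<mu> T \<noteq> 0 \<and> \<psi> \<mu> T \<noteq> 0" if "d\<psi> \<mu> T = 0" using wronskian_T[of \<mu>] that by auto
  then show "is_green_root Neumann a T 0 0 \<mu> \<longleftrightarrow> d\<psi> \<mu> T = 0"
    "is_green_root Periodic (even_ext T a) (2 * T) 0 0 \<mu> \<longleftrightarrow> d\<psi> \<mu> T = 0"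
    using green_N_corners(1)[of \<mu>] green_P_diagonal(1)[of \<mu>]
    by (auto simp: is_green_root_def nonresonant_N nonresonant_P)
qed

lemma green_root_TT:
  "is_green_root Neumann a T T T \<mu> \<longleftrightarrow> \<phi> \<mu> T = 0"
  "is_green_root Periodic (even_ext T a) (2 * T) T T \<mu> \<longleftrightarrow> \<phi> \<mu> T = 0"
proof -
  have "d\<phi> \<mu> T \<noteq> 0 \<and> \<psi> \<mu> T \<noteq> 0" if "\<phi> \<mu> T = 0" using wronskian_T[of \<mu>] that by auto
  then show "is_green_root Neumann a T T T \<mu> \<longleftrightarrow> \<phi> \<mu> T = 0"
    "is_green_root Periodic (even_ext T a) (2 * T) T T \<mu> \<longleftrightarrow> \<phi> \<mu> T = 0"
    using green_N_corners(2)[of \<mu>] green_P_diagonal(2)[of \<mu>]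
    by (auto simp: is_green_root_def nonresonant_N nonresonant_P)
qed

lemma is_first_critical:
  "is_first (\<lambda>\<mu>. d\<psi> \<mu> T = 0) M2.critical" "is_first (\<lambda>\<mu>. \<phi> \<mu> T = 0) M1.critical"
  using M1.end_value_critical M2.end_value_critical M1.critical_least M2.critical_least by (auto simp: is_first_def end_value_simps)

end

lemma even_family_exists:
  assumes T: "0 < T" and a: "a absolutely_integrable_on {0..T}"
  obtains A \<phi> d\<phi> \<psi> d\<psi> where "even_family T a A \<phi> d\<phi> \<psi> d\<psi>"
proof -
  define A where "A t = integral {0..t} (even_ext T a)" for t
  have q: "even_ext T a absolutely_integrable_on {0..2 * T}" by (rule even_ext_absolutely_integrable[OF T a])
  then have cA: "continuous_on {0..2 * T} A"
    unfolding A_def by (intro indefinite_integral_continuous_1) (simp add: absolutely_integrable_on_def)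
  have "\<exists>u p. reg_sol A (\<lambda>_. \<mu>) (2 * T) u p \<and> u 0 = c0 \<and> p 0 = c1" for \<mu> c0 c1
    using reg_sol_exists[OF _ cA] T by (metis less_imp_le mult_pos_pos zero_less_numeral)
  then obtain u p where up: "\<And>\<mu> c0 c1. reg_sol A (\<lambda>_. \<mu>) (2 * T) (u \<mu> c0 c1) (p \<mu> c0 c1)"
    "\<And>\<mu> c0 c1. u \<mu> c0 c1 0 = c0" "\<And>\<mu> c0 c1. p \<mu> c0 c1 0 = c1"
    by metis
  have A0: "A 0 = 0" by (simp add: A_def)
  have "even_family T a A (\<lambda>\<mu>. u \<mu> 1 0) (\<lambda>\<mu> t. p \<mu> 1 0 t - A t * u \<mu> 1 0 t)
      (\<lambda>\<mu>. u \<mu> 0 1) (\<lambda>\<mu> t. p \<mu> 0 1 t - A t * u \<mu> 0 1 t)"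
    using T a q up A0 even_ext_primitive[OF T a]
    by unfold_locales (simp_all add: A_def[abs_def])
  then show thesis by (rule that)
qed

theorem theorem4p3:
  fixes T :: real and a :: "real \<Rightarrow> real"
  assumes "T > 0" and "a absolutely_integrable_on {0..T}"
  shows "(first_eigenvalue Neumann a T = first_eigenvalue Neumann (even_ext T a) (2 * T) \<and>
      first_eigenvalue Neumann (even_ext T a) (2 * T)
        = first_eigenvalue Periodic (even_ext T a) (2 * T)) \<and>
     (\<forall>\<mu>. (nonresonant Neumann (\<lambda>x. a x + \<mu>) T \<and>
           (\<forall>t\<in>{0..T}. \<forall>s\<in>{0..T}. green Neumann (\<lambda>x. a x + \<mu>) T t s < 0))
        \<longleftrightarrow> \<mu> < first_eigenvalue Periodic (even_ext T a) (2 * T)) \<and>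
     (\<forall>\<mu>. (nonresonant Neumann (\<lambda>x. a x + \<mu>) T \<and>
           (\<forall>t\<in>{0..T}. \<forall>s\<in>{0..T}. green Neumann (\<lambda>x. a x + \<mu>) T t s > 0))
        \<longleftrightarrow> first_eigenvalue Periodic (even_ext T a) (2 * T) < \<mu> \<and>
            \<mu> < min (first_eigenvalue Mixed1 a T) (first_eigenvalue Mixed2 a T)) \<and>
     (\<forall>\<mu>. (nonresonant Neumann (\<lambda>x. a x + \<mu>) T \<and>
           (\<forall>(t, s) \<in> ({0..T} \<times> {0..T}) - {(0, 0), (T, T)}.
              green Neumann (\<lambda>x. a x + \<mu>) T t s > 0))
        \<longleftrightarrow> first_eigenvalue Periodic (even_ext T a) (2 * T) < \<mu> \<and>
            \<mu> \<le> min (first_eigenvalue Mixed1 a T) (first_eigenvalue Mixed2 a T)) \<and>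
     ((nonresonant Neumann a T \<and> nonresonant Periodic (even_ext T a) (2 * T) \<longrightarrow>
        green Neumann a T 0 0 = 2 * green Periodic (even_ext T a) (2 * T) 0 0) \<and>
      is_first (is_green_root Periodic (even_ext T a) (2 * T) 0 0) (first_eigenvalue Mixed2 a T) \<and>
      is_first (is_green_root Neumann a T 0 0) (first_eigenvalue Mixed2 a T) \<and>
      (\<forall>\<mu>. is_green_root Periodic (even_ext T a) (2 * T) 0 0 \<mu> \<longleftrightarrow>
           is_green_root Neumann a T 0 0 \<mu>)) \<and>
     ((nonresonant Neumann a T \<and> nonresonant Periodic (even_ext T a) (2 * T) \<longrightarrow>
        green Neumann a T T T = 2 * green Periodic (even_ext T a) (2 * T) T T) \<and>
      is_first (is_green_root Periodic (even_ext T a) (2 * T) T T) (first_eigenvalue Mixed1 a T) \<and>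
      is_first (is_green_root Neumann a T T T) (first_eigenvalue Mixed1 a T) \<and>
      (\<forall>\<mu>. is_green_root Periodic (even_ext T a) (2 * T) T T \<mu> \<longleftrightarrow>
           is_green_root Neumann a T T T \<mu>)) \<and>
     first_eigenvalue Antiperiodic (even_ext T a) (2 * T)
       = min (first_eigenvalue Mixed1 a T) (first_eigenvalue Mixed2 a T) \<and>
     (first_eigenvalue Mixed2 a T = first_eigenvalue Dirichlet (even_ext T a) (2 * T) \<and>
      first_eigenvalue Dirichlet (even_ext T a) (2 * T) < first_eigenvalue Dirichlet a T) \<and>
     first_eigenvalue Neumann a T < first_eigenvalue Mixed1 a T"
proof -
  obtain A \<phi> d\<phi> \<psi> d\<psi> where "even_family T a A \<phi> d\<phi> \<psi> d\<psi>"
    using even_family_exists[OF assms] by blast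
  then interpret even_family T a A \<phi> d\<phi> \<psi> d\<psi> .
  have corners: "green Neumann a T 0 0 = 2 * green Periodic (even_ext T a) (2 * T) 0 0 \<and>
      green Neumann a T T T = 2 * green Periodic (even_ext T a) (2 * T) T T"
    if "nonresonant Neumann a T \<and> nonresonant Periodic (even_ext T a) (2 * T)"
    using that nonresonant_P[of 0] green_N_corners[of 0] green_P_diagonal[of 0] by simp
  show ?thesis
    unfolding first_eigenvalues_half first_eigenvalues_full
      green_N_neg_iff green_N_pos_iff green_N_strictly_pos_iff
    using corners N_less_M1 M2_less_D is_first_critical green_root_00 green_root_TT
    by (simp add: is_first_def)
qed

end
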